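(* Let $\Bbbk$ be a commutative, associative, unital ring, and let $\mathcal{C}$ and $\mathcal{D}$ be small EI categories. Assume that: (i) $\varepsilon\colon P_\bullet\to M$ is a minimal projective resolution of a $\Bbbk\mathcal{C}$-module $M$; (ii) $\delta\colon Q_\bullet\to N$ is a minimal projective resolution of a $\Bbbk\mathcal{D}$-module $N$; (iii) the upper sets $\uparrow\operatorname{supp}(M)\subseteq\operatorname{cl}(\operatorname{obj}\mathcal{C})$ and $\uparrow\operatorname{supp}(N)\subseteq\operatorname{cl}(\operatorname{obj}\mathcal{D})$ are Artinian; (iv) $\mathcal{C}'$ is a full subcategory of $\mathcal{C}$ such that $\operatorname{minsupp}(P_\bullet)\subseteq\operatorname{cl}(\operatorname{obj}\mathcal{C}')$; (v) $\mathcal{D}'$ is a full subcategory of $\mathcal{D}$ such that $\operatorname{minsupp}(Q_\bullet)\subseteq\operatorname{cl}(\operatorname{obj}\mathcal{D}')$; (vi) there exist an equivalence of categories $\alpha\colon\mathcal{C}'\to\mathcal{D}'$ and an isomorphism $f\colon\operatorname{res}_{\varrho}(M)\to\operatorname{res}_{\varsigma\circ\alpha}(N)$ of $\Bbbk\mathcal{C}'$-modules, where $\varrho\colon\mathcal{C}'\to\mathcal{C}$ and $\varsigma\colon\mathcal{D}'\to\mathcal{D}$ are the inclusion functors. Then $\alpha$ induces an equivalence of Betti categories $\mathcal{B}(M)\to\mathcal{B}(N)$, and $f$ induces an isomorphism $$P_\bullet\cong\operatorname{ind}_{\varrho}\operatorname{res}_{\varsigma\circ\alpha}(Q_\bullet)$$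 of chain complexes of $\Bbbk\mathcal{C}$-modules.
   Context: Modules over categories. For a small category $\mathcal{C}$, a $\Bbbk\mathcal{C}$-module is a functor $\mathcal{C}\to\Bbbk\text{-Mod}$, and homomorphisms are natural transformations. This is an abelian category, with exactness checked objectwise. EI categories. A category is EI if every endomorphism is an isomorphism. $\operatorname{cl}(\operatorname{obj}\mathcal{C})$ is the set of isomorphism classes $\operatorname{cl}(c)$ of objects $c$, ordered by $\operatorname{cl}(c)\le\operatorname{cl}(d)$ iff there is a morphism $c\to d$; this is a partial order if $\mathcal{C}$ is EI. For a full subcategory $\mathcal{C}'$ of $\mathcal{C}$, $\operatorname{cl}(\operatorname{obj}\mathcal{C}')$ is regarded as a subset of $\operatorname{cl}(\operatorname{obj}\mathcal{C})$ (the classes having a representative in $\mathcal{C}'$). A subset of a poset is Artinian if every descending chain in it stabilizes; $\uparrow S$ is the smallest upper set containing $S$. Supports. $\operatorname{supp}(M)=\{\operatorname{cl}(c): M(c)\ne0\}$. For each object $c$ let $\mathfrak{S}M(c)$ be the quotient of $M(c)$ by the sum of the images of all $M(u)\colon M(b)\to M(c)$ with $u\colon b\to c$ a non-isomorphism of $\mathcal{C}$. $\operatorname{minsupp}(M)=\{\operatorname{cl}(c):\mathfrak{S}M(c)\neq0\}$, and for a chain complex $C_\bullet$, $\operatorname{minsupp}(C_\bullet)=\bigcup_n\operatorname{minsupp}(C_n)$. Minimal projective resolutions. An epimorphism $f\colon L\to M$ in an abelian category is superfluous if for every $g\colon K\to L$, $g$ is epic iff $fg$ is epic. A projective cover of $M$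 is a superfluous epimorphism $P\to M$ with $P$ projective. A projective resolution $\varepsilon\colon P_\bullet\to M$ is minimal if $\varepsilon\colon P_0\to M$ and $d_n\colon P_n\to\operatorname{im}(d_n)=\ker(d_{n-1})$ (with $d_0=\varepsilon$), $n\ge1$, are projective covers. Betti category. If $\mathcal{C}$ is EI and $M$ has a minimal projective resolution $P_\bullet$, then the Betti category $\mathcal{B}(M)$ is the full subcategory of $\mathcal{C}$ with objects $\{c:\operatorname{cl}(c)\in\operatorname{minsupp}(P_\bullet)\}$; it does not depend on the choice of $P_\bullet$. Restriction and induction. For a functor $\alpha\colon\mathcal{C}\to\mathcal{D}$, $\operatorname{res}_\alpha(L)=L\circ\alpha$ for a $\Bbbk\mathcal{D}$-module $L$, and $\operatorname{ind}_\alpha$ is the left adjoint of $\operatorname{res}_\alpha$ (left Kan extension along $\alpha$); both are applied degreewise to complexes. Meaning of "induces". The full subcategory of $\mathcal{C}'$ on the objects lying in $\mathcal{B}(M)$ is equivalent to $\mathcal{B}(M)$ via inclusion, similarly for $\mathcal{D}'$ and $\mathcal{B}(N)$, and $\alpha$ restricts to an equivalence between these full subcategories. The isomorphism of complexes comes from lifting $f$ to a chain map $\operatorname{res}_\varrho P_\bullet\to\operatorname{res}_{\varsigma\circ\alpha}Q_\bullet$, applying $\operatorname{ind}_\varrho$, and identifying $\operatorname{ind}_\varrho\operatorname{res}_\varrho P_\bullet$ with $P_\bullet$ via the counit. *)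

theory Defs
  imports "HOL-Algebra.Module" "HOL-Algebra.AbelCoset" "HOL-Library.FuncSet" "HOL.Hull"
begin

section \<open>Categories, functors, equivalences\<close>

record ('o, 'a) cat =
  Obj :: "'o set"
  Arr :: "'a set"
  Dom :: "'a \<Rightarrow> 'o"
  Cod :: "'a \<Rightarrow> 'o"
  Id :: "'o \<Rightarrow> 'a"
  Comp :: "'a \<Rightarrow> 'a \<Rightarrow> 'a"

definition Hom :: "('o, 'a) cat \<Rightarrow> 'o \<Rightarrow> 'o \<Rightarrow> 'a set" where
  "Hom C b c = {u \<in> Arr C. Dom C u = b \<and> Cod C u = c}"

text \<open>\<open>Comp C v u\<close> is \<open>v\<close> after \<open>u\<close>. Nothing is required of the operations outside \<open>Obj C\<close>,
  \<open>Arr C\<close> and the composable pairs; in the same way functors, modules and homomorphisms below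
  are only constrained, and only compared, on the relevant objects, arrows and carriers.\<close>

locale category =
  fixes C :: "('o, 'a) cat"
  assumes Dom_Obj: "u \<in> Arr C \<Longrightarrow> Dom C u \<in> Obj C"
    and Cod_Obj: "u \<in> Arr C \<Longrightarrow> Cod C u \<in> Obj C"
    and Id_Hom: "c \<in> Obj C \<Longrightarrow> Id C c \<in> Hom C c c"
    and Comp_Hom: "\<lbrakk>u \<in> Hom C a b; v \<in> Hom C b c\<rbrakk> \<Longrightarrow> Comp C v u \<in> Hom C a c"
    and Comp_Id: "u \<in> Hom C a b \<Longrightarrow> Comp C u (Id C a) = u"
    and Id_Comp: "u \<in> Hom C a b \<Longrightarrow> Comp C (Id C b) u = u"
    and Comp_assoc: "\<lbrakk>u \<in> Hom C a b; v \<in> Hom C b c; w \<in> Hom C c d\<rbrakk> \<Longrightarrow>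
      Comp C w (Comp C v u) = Comp C (Comp C w v) u"

definition iso_arr :: "('o, 'a) cat \<Rightarrow> 'a \<Rightarrow> bool" where
  "iso_arr C u \<longleftrightarrow> u \<in> Arr C \<and> (\<exists>v \<in> Hom C (Cod C u) (Dom C u).
     Comp C v u = Id C (Dom C u) \<and> Comp C u v = Id C (Cod C u))"

definition EI_category :: "('o, 'a) cat \<Rightarrow> bool" where
  "EI_category C \<longleftrightarrow> category C \<and> (\<forall>c \<in> Obj C. \<forall>u \<in> Hom C c c. iso_arr C u)"

definition full_subcat :: "('o, 'a) cat \<Rightarrow> 'o set \<Rightarrow> ('o, 'a) cat" where
  "full_subcat C S = C\<lparr>Obj := S, Arr := {u \<in> Arr C. Dom C u \<in> S \<and> Cod C u \<in> S}\<rparr>"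

definition is_full_subcat :: "('o, 'a) cat \<Rightarrow> ('o, 'a) cat \<Rightarrow> bool" where
  "is_full_subcat C' C \<longleftrightarrow> Obj C' \<subseteq> Obj C \<and> C' = full_subcat C (Obj C')"

record ('o, 'a, 'p, 'b) catfun =
  fobj :: "'o \<Rightarrow> 'p"
  farr :: "'a \<Rightarrow> 'b"

definition is_functor :: "('o, 'a) cat \<Rightarrow> ('p, 'b) cat \<Rightarrow> ('o, 'a, 'p, 'b) catfun \<Rightarrow> bool" where
  "is_functor C D F \<longleftrightarrow> category C \<and> category D
     \<and> (\<forall>c \<in> Obj C. fobj F c \<in> Obj D)
     \<and> (\<forall>u \<in> Arr C. farr F u \<in> Hom D (fobj F (Dom C u)) (fobj F (Cod C u)))
     \<and> (\<forall>c \<in> Obj C. farr F (Id C c) = Id D (fobj F c))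
     \<and> (\<forall>u \<in> Arr C. \<forall>v \<in> Arr C. Cod C u = Dom C v \<longrightarrow>
          farr F (Comp C v u) = Comp D (farr F v) (farr F u))"

definition incl :: "('o, 'a, 'o, 'a) catfun" where
  "incl = \<lparr>fobj = (\<lambda>c. c), farr = (\<lambda>u. u)\<rparr>"

definition fcomp :: "('p, 'b, 'q, 'c) catfun \<Rightarrow> ('o, 'a, 'p, 'b) catfun \<Rightarrow> ('o, 'a, 'q, 'c) catfun"
  (infixr \<open>\<circ>\<^sub>F\<close> 70) where
  "G \<circ>\<^sub>F F = \<lparr>fobj = fobj G \<circ> fobj F, farr = farr G \<circ> farr F\<rparr>"

definition naturally_isomorphic :: "('o, 'a) cat \<Rightarrow> ('p, 'b) cat \<Rightarrow>
    ('o, 'a, 'p, 'b) catfun \<Rightarrow> ('o, 'a, 'p, 'b) catfun \<Rightarrow> bool" where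
  "naturally_isomorphic C D F G \<longleftrightarrow> is_functor C D F \<and> is_functor C D G \<and>
     (\<exists>\<tau>. (\<forall>c \<in> Obj C. \<tau> c \<in> Hom D (fobj F c) (fobj G c) \<and> iso_arr D (\<tau> c))
        \<and> (\<forall>u \<in> Arr C. Comp D (\<tau> (Cod C u)) (farr F u) = Comp D (farr G u) (\<tau> (Dom C u))))"

definition cat_equivalence :: "('o, 'a) cat \<Rightarrow> ('p, 'b) cat \<Rightarrow> ('o, 'a, 'p, 'b) catfun \<Rightarrow> bool" where
  "cat_equivalence C D F \<longleftrightarrow> is_functor C D F \<and> (\<exists>G. is_functor D C G
     \<and> naturally_isomorphic C C (G \<circ>\<^sub>F F) incl \<and> naturally_isomorphic D D (F \<circ>\<^sub>F G) incl)"

section \<open>Isomorphism classes of objects\<close>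

definition cl :: "('o, 'a) cat \<Rightarrow> 'o \<Rightarrow> 'o set" where
  "cl C c = {d \<in> Obj C. \<exists>u \<in> Hom C c d. iso_arr C u}"

definition cl_le :: "('o, 'a) cat \<Rightarrow> 'o set \<Rightarrow> 'o set \<Rightarrow> bool" where
  "cl_le C X Y \<longleftrightarrow> (\<exists>c \<in> Obj C. \<exists>d \<in> Obj C. X = cl C c \<and> Y = cl C d \<and> Hom C c d \<noteq> {})"

definition upper_set :: "('o, 'a) cat \<Rightarrow> 'o set set \<Rightarrow> bool" where
  "upper_set C U \<longleftrightarrow> U \<subseteq> cl C ` Obj C \<and> (\<forall>X \<in> U. \<forall>Y. cl_le C X Y \<longrightarrow> Y \<in> U)"

definition up :: "('o, 'a) cat \<Rightarrow> 'o set set \<Rightarrow> 'o set set" where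
  "up C S = upper_set C hull S"

definition Artinian :: "('o, 'a) cat \<Rightarrow> 'o set set \<Rightarrow> bool" where
  "Artinian C S \<longleftrightarrow> (\<forall>X :: nat \<Rightarrow> 'o set.
     (\<forall>n. X n \<in> S \<and> cl_le C (X (Suc n)) (X n)) \<longrightarrow> (\<exists>N. \<forall>n \<ge> N. X n = X N))"

section \<open>Constructions with modules over a commutative ring\<close>

text \<open>Of the record \<open>module\<close>, the fields \<open>mult\<close> and \<open>one\<close>, inherited from \<open>ring\<close>, play no role.\<close>

definition linear_maps :: "'r ring \<Rightarrow> ('r, 'm) module \<Rightarrow> ('r, 'n) module \<Rightarrow> ('m \<Rightarrow> 'n) set" where
  "linear_maps R M N = {h \<in> carrier M \<rightarrow> carrier N.
     (\<forall>x \<in> carrier M. \<forall>y \<in> carrier M. h (x \<oplus>\<^bsub>M\<^esub> y) = h x \<oplus>\<^bsub>N\<^esub> h y) \<and>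
     (\<forall>a \<in> carrier R. \<forall>x \<in> carrier M. h (a \<odot>\<^bsub>M\<^esub> x) = a \<odot>\<^bsub>N\<^esub> h x)}"

definition nonzero :: "('r, 'm) module \<Rightarrow> bool" where
  "nonzero M \<longleftrightarrow> carrier M \<noteq> {\<zero>\<^bsub>M\<^esub>}"

definition span :: "'r ring \<Rightarrow> ('r, 'm) module \<Rightarrow> 'm set \<Rightarrow> 'm set" where
  "span R M S = (\<lambda>H. submodule H R M) hull S"

definition quot_module :: "('r, 'm) module \<Rightarrow> 'm set \<Rightarrow> ('r, 'm set) module" where
  "quot_module M H = \<lparr>carrier = a_rcosets\<^bsub>M\<^esub> H, mult = undefined, one = undefined,
     zero = H, add = set_add M, smult = (\<lambda>a X. \<Union>x \<in> X. H +>\<^bsub>M\<^esub> (a \<odot>\<^bsub>M\<^esub> x))\<rparr>"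

definition ds_supp :: "'i set \<Rightarrow> ('i \<Rightarrow> ('r, 'm) module) \<Rightarrow> ('i \<Rightarrow> 'm) \<Rightarrow> 'i set" where
  "ds_supp I M f = {i \<in> I. f i \<noteq> \<zero>\<^bsub>M i\<^esub>}"

definition direct_sum :: "'i set \<Rightarrow> ('i \<Rightarrow> ('r, 'm) module) \<Rightarrow> ('r, 'i \<Rightarrow> 'm) module" where
  "direct_sum I M = \<lparr>carrier = {f \<in> \<Pi>\<^sub>E i \<in> I. carrier (M i). finite (ds_supp I M f)},
     mult = undefined, one = undefined, zero = (\<lambda>i \<in> I. \<zero>\<^bsub>M i\<^esub>),
     add = (\<lambda>f g. \<lambda>i \<in> I. f i \<oplus>\<^bsub>M i\<^esub> g i), smult = (\<lambda>a f. \<lambda>i \<in> I. a \<odot>\<^bsub>M i\<^esub> f i)\<rparr>"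

definition ds_in :: "'i set \<Rightarrow> ('i \<Rightarrow> ('r, 'm) module) \<Rightarrow> 'i \<Rightarrow> 'm \<Rightarrow> 'i \<Rightarrow> 'm" where
  "ds_in I M i x = (\<lambda>j \<in> I. if j = i then x else \<zero>\<^bsub>M j\<^esub>)"

text \<open>\<open>ds_out I M N h\<close> is the map out of the direct sum whose components are the maps \<open>h i\<close>.\<close>

definition ds_out :: "'i set \<Rightarrow> ('i \<Rightarrow> ('r, 'm) module) \<Rightarrow> ('r, 'n) module \<Rightarrow>
    ('i \<Rightarrow> 'm \<Rightarrow> 'n) \<Rightarrow> ('i \<Rightarrow> 'm) \<Rightarrow> 'n" where
  "ds_out I M N h f = (\<Oplus>\<^bsub>N\<^esub>i \<in> ds_supp I M f. h i (f i))"

section \<open>Modules over a category\<close>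

record ('o, 'a, 'r, 'm) cmod =
  Val :: "'o \<Rightarrow> ('r, 'm) module"
  Act :: "'a \<Rightarrow> 'm \<Rightarrow> 'm"

definition kmodule :: "'r ring \<Rightarrow> ('o, 'a) cat \<Rightarrow> ('o, 'a, 'r, 'm) cmod \<Rightarrow> bool" where
  "kmodule R C L \<longleftrightarrow> (\<forall>c \<in> Obj C. module R (Val L c))
     \<and> (\<forall>u \<in> Arr C. Act L u \<in> linear_maps R (Val L (Dom C u)) (Val L (Cod C u)))
     \<and> (\<forall>c \<in> Obj C. \<forall>x \<in> carrier (Val L c). Act L (Id C c) x = x)
     \<and> (\<forall>u \<in> Arr C. \<forall>v \<in> Arr C. Cod C u = Dom C v \<longrightarrow>
          (\<forall>x \<in> carrier (Val L (Dom C u)). Act L (Comp C v u) x = Act L v (Act L u x)))"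

definition kmod_hom :: "'r ring \<Rightarrow> ('o, 'a) cat \<Rightarrow> ('o, 'a, 'r, 'm) cmod \<Rightarrow>
    ('o, 'a, 'r, 'n) cmod \<Rightarrow> ('o \<Rightarrow> 'm \<Rightarrow> 'n) \<Rightarrow> bool" where
  "kmod_hom R C L M g \<longleftrightarrow> kmodule R C L \<and> kmodule R C M
     \<and> (\<forall>c \<in> Obj C. g c \<in> linear_maps R (Val L c) (Val M c))
     \<and> (\<forall>u \<in> Arr C. \<forall>x \<in> carrier (Val L (Dom C u)).
          g (Cod C u) (Act L u x) = Act M u (g (Dom C u) x))"

definition kmod_epi :: "'r ring \<Rightarrow> ('o, 'a) cat \<Rightarrow> ('o, 'a, 'r, 'm) cmod \<Rightarrow>
    ('o, 'a, 'r, 'n) cmod \<Rightarrow> ('o \<Rightarrow> 'm \<Rightarrow> 'n) \<Rightarrow> bool" where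
  "kmod_epi R C L M g \<longleftrightarrow> kmod_hom R C L M g
     \<and> (\<forall>c \<in> Obj C. g c ` carrier (Val L c) = carrier (Val M c))"

definition kmod_iso :: "'r ring \<Rightarrow> ('o, 'a) cat \<Rightarrow> ('o, 'a, 'r, 'm) cmod \<Rightarrow>
    ('o, 'a, 'r, 'n) cmod \<Rightarrow> ('o \<Rightarrow> 'm \<Rightarrow> 'n) \<Rightarrow> bool" where
  "kmod_iso R C L M g \<longleftrightarrow> kmod_hom R C L M g
     \<and> (\<forall>c \<in> Obj C. bij_betw (g c) (carrier (Val L c)) (carrier (Val M c)))"

definition hcomp :: "('o \<Rightarrow> 'n \<Rightarrow> 'l) \<Rightarrow> ('o \<Rightarrow> 'm \<Rightarrow> 'n) \<Rightarrow> 'o \<Rightarrow> 'm \<Rightarrow> 'l" where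
  "hcomp g f = (\<lambda>c x. g c (f c x))"

definition image_kmod :: "('o, 'a, 'r, 'm) cmod \<Rightarrow> ('o, 'a, 'r, 'n) cmod \<Rightarrow>
    ('o \<Rightarrow> 'm \<Rightarrow> 'n) \<Rightarrow> ('o, 'a, 'r, 'n) cmod" where
  "image_kmod L M g = M\<lparr>Val := (\<lambda>c. (Val M c)\<lparr>carrier := g c ` carrier (Val L c)\<rparr>)\<rparr>"

text \<open>A definition cannot quantify over types, so the test objects have to be modules with
  elements in fixed types. For superfluous epimorphisms \<open>f\<close> from \<open>L\<close> to \<open>M\<close> the type of \<open>L\<close>
  suffices, since \<open>g\<close> may be replaced by the inclusion of its image. For projectivity of \<open>P\<close>,
  the type \<open>'a \<times> 'm \<Rightarrow> 'r\<close> contains the free module on the elements of \<open>P\<close>: a lift of the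
  identity of \<open>P\<close> through it exhibits \<open>P\<close> as a direct summand of a free module. The lemmas
  \<open>superfluous_epi_any\<close> and \<open>projective_any\<close> below show that nothing depends on this choice.\<close>

definition superfluous_epi :: "'r ring \<Rightarrow> ('o, 'a) cat \<Rightarrow> ('o, 'a, 'r, 'm) cmod \<Rightarrow>
    ('o, 'a, 'r, 'n) cmod \<Rightarrow> ('o \<Rightarrow> 'm \<Rightarrow> 'n) \<Rightarrow> bool" where
  "superfluous_epi R C L M f \<longleftrightarrow> kmod_epi R C L M f
     \<and> (\<forall>(K :: ('o, 'a, 'r, 'm) cmod) g. kmod_hom R C K L g \<longrightarrow>
          (kmod_epi R C K L g \<longleftrightarrow> kmod_epi R C K M (hcomp f g)))"

definition projective :: "'r ring \<Rightarrow> ('o, 'a) cat \<Rightarrow> ('o, 'a, 'r, 'm) cmod \<Rightarrow> bool" where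
  "projective R C P \<longleftrightarrow> kmodule R C P
     \<and> (\<forall>(L :: ('o, 'a, 'r, 'a \<times> 'm \<Rightarrow> 'r) cmod) (K :: ('o, 'a, 'r, 'm) cmod) g h.
          kmod_epi R C L K g \<and> kmod_hom R C P K h \<longrightarrow>
          (\<exists>k. kmod_hom R C P L k
             \<and> (\<forall>c \<in> Obj C. \<forall>x \<in> carrier (Val P c). g c (k c x) = h c x)))"

definition projective_cover :: "'r ring \<Rightarrow> ('o, 'a) cat \<Rightarrow> ('o, 'a, 'r, 'm) cmod \<Rightarrow>
    ('o, 'a, 'r, 'n) cmod \<Rightarrow> ('o \<Rightarrow> 'm \<Rightarrow> 'n) \<Rightarrow> bool" where
  "projective_cover R C P M f \<longleftrightarrow> projective R C P \<and> superfluous_epi R C P M f"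

section \<open>Chain complexes and resolutions\<close>

text \<open>Complexes are indexed by \<open>n \<ge> 0\<close>. The differential \<open>Diff P n\<close> from \<open>Ch P n\<close> to
  \<open>Ch P (n - 1)\<close> is meaningful for \<open>n \<ge> 1\<close> only; \<open>Diff P 0\<close> is ignored.\<close>

record ('o, 'a, 'r, 'm) cplx =
  Ch :: "nat \<Rightarrow> ('o, 'a, 'r, 'm) cmod"
  Diff :: "nat \<Rightarrow> 'o \<Rightarrow> 'm \<Rightarrow> 'm"

definition chain_complex :: "'r ring \<Rightarrow> ('o, 'a) cat \<Rightarrow> ('o, 'a, 'r, 'm) cplx \<Rightarrow> bool" where
  "chain_complex R C P \<longleftrightarrow> (\<forall>n. kmodule R C (Ch P n))
     \<and> (\<forall>n. kmod_hom R C (Ch P (Suc n)) (Ch P n) (Diff P (Suc n)))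
     \<and> (\<forall>n. \<forall>c \<in> Obj C. \<forall>x \<in> carrier (Val (Ch P (Suc (Suc n))) c).
          Diff P (Suc n) c (Diff P (Suc (Suc n)) c x) = \<zero>\<^bsub>Val (Ch P n) c\<^esub>)"

definition chain_map :: "'r ring \<Rightarrow> ('o, 'a) cat \<Rightarrow> ('o, 'a, 'r, 'm) cplx \<Rightarrow>
    ('o, 'a, 'r, 'n) cplx \<Rightarrow> (nat \<Rightarrow> 'o \<Rightarrow> 'm \<Rightarrow> 'n) \<Rightarrow> bool" where
  "chain_map R C P Q \<phi> \<longleftrightarrow> chain_complex R C P \<and> chain_complex R C Q
     \<and> (\<forall>n. kmod_hom R C (Ch P n) (Ch Q n) (\<phi> n))
     \<and> (\<forall>n. \<forall>c \<in> Obj C. \<forall>x \<in> carrier (Val (Ch P (Suc n)) c).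
          \<phi> n c (Diff P (Suc n) c x) = Diff Q (Suc n) c (\<phi> (Suc n) c x))"

definition chain_iso :: "'r ring \<Rightarrow> ('o, 'a) cat \<Rightarrow> ('o, 'a, 'r, 'm) cplx \<Rightarrow>
    ('o, 'a, 'r, 'n) cplx \<Rightarrow> (nat \<Rightarrow> 'o \<Rightarrow> 'm \<Rightarrow> 'n) \<Rightarrow> bool" where
  "chain_iso R C P Q \<phi> \<longleftrightarrow> chain_map R C P Q \<phi>
     \<and> (\<forall>n. kmod_iso R C (Ch P n) (Ch Q n) (\<phi> n))"

definition projective_resolution :: "'r ring \<Rightarrow> ('o, 'a) cat \<Rightarrow> ('o, 'a, 'r, 'm) cplx \<Rightarrow>
    ('o \<Rightarrow> 'm \<Rightarrow> 'n) \<Rightarrow> ('o, 'a, 'r, 'n) cmod \<Rightarrow> bool" where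
  "projective_resolution R C P \<epsilon> M \<longleftrightarrow> chain_complex R C P \<and> kmodule R C M
     \<and> (\<forall>n. projective R C (Ch P n))
     \<and> kmod_epi R C (Ch P 0) M \<epsilon>
     \<and> (\<forall>c \<in> Obj C. Diff P 1 c ` carrier (Val (Ch P 1) c)
          = a_kernel (Val (Ch P 0) c) (Val M c) (\<epsilon> c))
     \<and> (\<forall>n. \<forall>c \<in> Obj C. Diff P (Suc (Suc n)) c ` carrier (Val (Ch P (Suc (Suc n))) c)
          = a_kernel (Val (Ch P (Suc n)) c) (Val (Ch P n) c) (Diff P (Suc n) c))"

definition minimal_projective_resolution :: "'r ring \<Rightarrow> ('o, 'a) cat \<Rightarrow> ('o, 'a, 'r, 'm) cplx \<Rightarrow>
    ('o \<Rightarrow> 'm \<Rightarrow> 'n) \<Rightarrow> ('o, 'a, 'r, 'n) cmod \<Rightarrow> bool" where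
  "minimal_projective_resolution R C P \<epsilon> M \<longleftrightarrow> projective_resolution R C P \<epsilon> M
     \<and> projective_cover R C (Ch P 0) M \<epsilon>
     \<and> (\<forall>n. projective_cover R C (Ch P (Suc n))
          (image_kmod (Ch P (Suc n)) (Ch P n) (Diff P (Suc n))) (Diff P (Suc n)))"

text \<open>\<open>\<phi>\<close> is a lift of \<open>f\<close> to a chain map between complexes augmented by \<open>\<epsilon>\<close> and \<open>\<delta>\<close>.\<close>

definition lifts :: "'r ring \<Rightarrow> ('o, 'a) cat \<Rightarrow> ('o, 'a, 'r, 'x) cplx \<Rightarrow> ('o \<Rightarrow> 'x \<Rightarrow> 'm) \<Rightarrow>
    ('o, 'a, 'r, 'y) cplx \<Rightarrow> ('o \<Rightarrow> 'y \<Rightarrow> 'n) \<Rightarrow> ('o \<Rightarrow> 'm \<Rightarrow> 'n) \<Rightarrow> (nat \<Rightarrow> 'o \<Rightarrow> 'x \<Rightarrow> 'y) \<Rightarrow> bool" where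
  "lifts R C P \<epsilon> Q \<delta> f \<phi> \<longleftrightarrow> chain_map R C P Q \<phi>
     \<and> (\<forall>c \<in> Obj C. \<forall>x \<in> carrier (Val (Ch P 0) c). \<delta> c (\<phi> 0 c x) = f c (\<epsilon> c x))"

section \<open>Supports and the Betti category\<close>

definition supp :: "('o, 'a) cat \<Rightarrow> ('o, 'a, 'r, 'm) cmod \<Rightarrow> 'o set set" where
  "supp C M = {cl C c | c. c \<in> Obj C \<and> nonzero (Val M c)}"

text \<open>The sum of a family of submodules is the span of their union.\<close>

definition splitting :: "'r ring \<Rightarrow> ('o, 'a) cat \<Rightarrow> ('o, 'a, 'r, 'm) cmod \<Rightarrow> 'o \<Rightarrow>
    ('r, 'm set) module" where
  "splitting R C M c = quot_module (Val M c) (span R (Val M c)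
     (\<Union>u \<in> {u \<in> Arr C. Cod C u = c \<and> \<not> iso_arr C u}. Act M u ` carrier (Val M (Dom C u))))"

definition minsupp :: "'r ring \<Rightarrow> ('o, 'a) cat \<Rightarrow> ('o, 'a, 'r, 'm) cmod \<Rightarrow> 'o set set" where
  "minsupp R C M = {cl C c | c. c \<in> Obj C \<and> nonzero (splitting R C M c)}"

definition minsupp_cplx :: "'r ring \<Rightarrow> ('o, 'a) cat \<Rightarrow> ('o, 'a, 'r, 'm) cplx \<Rightarrow> 'o set set" where
  "minsupp_cplx R C P = (\<Union>n. minsupp R C (Ch P n))"

text \<open>The Betti category of \<open>M\<close>, computed from a minimal projective resolution \<open>P\<close> of \<open>M\<close>.\<close>

definition betti_category :: "'r ring \<Rightarrow> ('o, 'a) cat \<Rightarrow> ('o, 'a, 'r, 'm) cplx \<Rightarrow> ('o, 'a) cat" where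
  "betti_category R C P = full_subcat C {c \<in> Obj C. cl C c \<in> minsupp_cplx R C P}"

section \<open>Restriction and induction\<close>

definition res :: "('o, 'a, 'p, 'b) catfun \<Rightarrow> ('p, 'b, 'r, 'm) cmod \<Rightarrow> ('o, 'a, 'r, 'm) cmod" where
  "res \<alpha> L = \<lparr>Val = Val L \<circ> fobj \<alpha>, Act = Act L \<circ> farr \<alpha>\<rparr>"

definition res_hom :: "('o, 'a, 'p, 'b) catfun \<Rightarrow> ('p \<Rightarrow> 'm \<Rightarrow> 'n) \<Rightarrow> 'o \<Rightarrow> 'm \<Rightarrow> 'n" where
  "res_hom \<alpha> g = g \<circ> fobj \<alpha>"

definition res_cplx :: "('o, 'a, 'p, 'b) catfun \<Rightarrow> ('p, 'b, 'r, 'm) cplx \<Rightarrow> ('o, 'a, 'r, 'm) cplx" where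
  "res_cplx \<alpha> P = \<lparr>Ch = (\<lambda>n. res \<alpha> (Ch P n)), Diff = (\<lambda>n. res_hom \<alpha> (Diff P n))\<rparr>"

text \<open>The left Kan extension along \<open>\<alpha>\<close> is given by the usual pointwise formula: its value at \<open>d\<close>
  is the colimit of \<open>L(c)\<close> over the comma category of pairs \<open>(c, u)\<close> with \<open>u\<close> from \<open>\<alpha>(c)\<close> to
  \<open>d\<close>, that is, the direct sum of the \<open>L(c)\<close> over these pairs, modulo the identification of \<open>x\<close>
  in the summand \<open>(c, u \<circ> \<alpha>(v))\<close> with \<open>L(v)(x)\<close> in the summand \<open>(c', u)\<close> for \<open>v\<close> from \<open>c\<close> to
  \<open>c'\<close>. That this is left adjoint to \<open>res\<close> is the lemma \<open>ind_left_adjoint\<close> below.\<close>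

definition ind_index :: "('o, 'a) cat \<Rightarrow> ('p, 'b) cat \<Rightarrow> ('o, 'a, 'p, 'b) catfun \<Rightarrow> 'p \<Rightarrow>
    ('o \<times> 'b) set" where
  "ind_index C D \<alpha> d = {(c, u). c \<in> Obj C \<and> u \<in> Hom D (fobj \<alpha> c) d}"

definition ind_sum :: "('o, 'a) cat \<Rightarrow> ('p, 'b) cat \<Rightarrow> ('o, 'a, 'p, 'b) catfun \<Rightarrow>
    ('o, 'a, 'r, 'm) cmod \<Rightarrow> 'p \<Rightarrow> ('r, 'o \<times> 'b \<Rightarrow> 'm) module" where
  "ind_sum C D \<alpha> L d = direct_sum (ind_index C D \<alpha> d) (Val L \<circ> fst)"

definition ind_in :: "('o, 'a) cat \<Rightarrow> ('p, 'b) cat \<Rightarrow> ('o, 'a, 'p, 'b) catfun \<Rightarrow>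
    ('o, 'a, 'r, 'm) cmod \<Rightarrow> 'p \<Rightarrow> 'o \<times> 'b \<Rightarrow> 'm \<Rightarrow> 'o \<times> 'b \<Rightarrow> 'm" where
  "ind_in C D \<alpha> L d = ds_in (ind_index C D \<alpha> d) (Val L \<circ> fst)"

definition ind_rel :: "'r ring \<Rightarrow> ('o, 'a) cat \<Rightarrow> ('p, 'b) cat \<Rightarrow> ('o, 'a, 'p, 'b) catfun \<Rightarrow>
    ('o, 'a, 'r, 'm) cmod \<Rightarrow> 'p \<Rightarrow> ('o \<times> 'b \<Rightarrow> 'm) set" where
  "ind_rel R C D \<alpha> L d = span R (ind_sum C D \<alpha> L d)
     {ind_in C D \<alpha> L d (Dom C v, Comp D u (farr \<alpha> v)) x
        \<ominus>\<^bsub>ind_sum C D \<alpha> L d\<^esub> ind_in C D \<alpha> L d (Cod C v, u) (Act L v x) | v u x.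
        v \<in> Arr C \<and> u \<in> Hom D (fobj \<alpha> (Cod C v)) d \<and> x \<in> carrier (Val L (Dom C v))}"

definition ind_class :: "'r ring \<Rightarrow> ('o, 'a) cat \<Rightarrow> ('p, 'b) cat \<Rightarrow> ('o, 'a, 'p, 'b) catfun \<Rightarrow>
    ('o, 'a, 'r, 'm) cmod \<Rightarrow> 'p \<Rightarrow> ('o \<times> 'b \<Rightarrow> 'm) \<Rightarrow> ('o \<times> 'b \<Rightarrow> 'm) set" where
  "ind_class R C D \<alpha> L d f = ind_rel R C D \<alpha> L d +>\<^bsub>ind_sum C D \<alpha> L d\<^esub> f"

definition ind :: "'r ring \<Rightarrow> ('o, 'a) cat \<Rightarrow> ('p, 'b) cat \<Rightarrow> ('o, 'a, 'p, 'b) catfun \<Rightarrow>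
    ('o, 'a, 'r, 'm) cmod \<Rightarrow> ('p, 'b, 'r, ('o \<times> 'b \<Rightarrow> 'm) set) cmod" where
  "ind R C D \<alpha> L = \<lparr>
     Val = (\<lambda>d. quot_module (ind_sum C D \<alpha> L d) (ind_rel R C D \<alpha> L d)),
     Act = (\<lambda>w X. \<Union>f \<in> X. ind_class R C D \<alpha> L (Cod D w)
       (ds_out (ind_index C D \<alpha> (Dom D w)) (Val L \<circ> fst) (ind_sum C D \<alpha> L (Cod D w))
          (\<lambda>(c, u). ind_in C D \<alpha> L (Cod D w) (c, Comp D w u)) f))\<rparr>"

definition ind_unit :: "'r ring \<Rightarrow> ('o, 'a) cat \<Rightarrow> ('p, 'b) cat \<Rightarrow> ('o, 'a, 'p, 'b) catfun \<Rightarrow>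
    ('o, 'a, 'r, 'm) cmod \<Rightarrow> 'o \<Rightarrow> 'm \<Rightarrow> ('o \<times> 'b \<Rightarrow> 'm) set" where
  "ind_unit R C D \<alpha> L c x = ind_class R C D \<alpha> L (fobj \<alpha> c)
     (ind_in C D \<alpha> L (fobj \<alpha> c) (c, Id D (fobj \<alpha> c)) x)"

text \<open>The homomorphism from \<open>ind L\<close> to \<open>Y\<close> adjoint to a homomorphism \<open>g\<close> from \<open>L\<close> to
  \<open>res Y\<close>: it sends the class of \<open>f\<close> to the sum of the \<open>Y(u)(g(f(c, u)))\<close>.\<close>

definition ind_adj :: "('o, 'a) cat \<Rightarrow> ('p, 'b) cat \<Rightarrow> ('o, 'a, 'p, 'b) catfun \<Rightarrow>
    ('o, 'a, 'r, 'm) cmod \<Rightarrow> ('p, 'b, 'r, 'n) cmod \<Rightarrow> ('o \<Rightarrow> 'm \<Rightarrow> 'n) \<Rightarrow>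
    'p \<Rightarrow> ('o \<times> 'b \<Rightarrow> 'm) set \<Rightarrow> 'n" where
  "ind_adj C D \<alpha> L Y g d X = the_elem
     (ds_out (ind_index C D \<alpha> d) (Val L \<circ> fst) (Val Y d) (\<lambda>(c, u) x. Act Y u (g c x)) ` X)"

definition ind_hom :: "'r ring \<Rightarrow> ('o, 'a) cat \<Rightarrow> ('p, 'b) cat \<Rightarrow> ('o, 'a, 'p, 'b) catfun \<Rightarrow>
    ('o, 'a, 'r, 'm) cmod \<Rightarrow> ('o, 'a, 'r, 'n) cmod \<Rightarrow> ('o \<Rightarrow> 'm \<Rightarrow> 'n) \<Rightarrow>
    'p \<Rightarrow> ('o \<times> 'b \<Rightarrow> 'm) set \<Rightarrow> ('o \<times> 'b \<Rightarrow> 'n) set" where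
  "ind_hom R C D \<alpha> L L' g =
     ind_adj C D \<alpha> L (ind R C D \<alpha> L') (hcomp (ind_unit R C D \<alpha> L') g)"

definition ind_counit :: "('o, 'a) cat \<Rightarrow> ('p, 'b) cat \<Rightarrow> ('o, 'a, 'p, 'b) catfun \<Rightarrow>
    ('p, 'b, 'r, 'm) cmod \<Rightarrow> 'p \<Rightarrow> ('o \<times> 'b \<Rightarrow> 'm) set \<Rightarrow> 'm" where
  "ind_counit C D \<alpha> Y = ind_adj C D \<alpha> (res \<alpha> Y) Y (\<lambda>c x. x)"

definition ind_cplx :: "'r ring \<Rightarrow> ('o, 'a) cat \<Rightarrow> ('p, 'b) cat \<Rightarrow> ('o, 'a, 'p, 'b) catfun \<Rightarrow>
    ('o, 'a, 'r, 'm) cplx \<Rightarrow> ('p, 'b, 'r, ('o \<times> 'b \<Rightarrow> 'm) set) cplx" where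
  "ind_cplx R C D \<alpha> P = \<lparr>Ch = (\<lambda>n. ind R C D \<alpha> (Ch P n)),
     Diff = (\<lambda>n. ind_hom R C D \<alpha> (Ch P n) (Ch P (n - 1)) (Diff P n))\<rparr>"

section \<open>Adequacy of the definitions\<close>

text \<open>The main results are \<open>ind_left_adjoint\<close> (the universal property of the unit, against modules
  with elements in an arbitrary type), \<open>superfluous_epi_any\<close> and \<open>projective_any\<close>.\<close>

subsection \<open>Linear maps\<close>

lemma linear_mapsD:
  assumes "h \<in> linear_maps R M N"
  shows "x \<in> carrier M \<Longrightarrow> h x \<in> carrier N"
    and "\<lbrakk>x \<in> carrier M; y \<in> carrier M\<rbrakk> \<Longrightarrow> h (x \<oplus>\<^bsub>M\<^esub> y) = h x \<oplus>\<^bsub>N\<^esub> h y"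
    and "\<lbrakk>a \<in> carrier R; x \<in> carrier M\<rbrakk> \<Longrightarrow> h (a \<odot>\<^bsub>M\<^esub> x) = a \<odot>\<^bsub>N\<^esub> h x"
  using assms by (auto simp: linear_maps_def)

lemma linear_mapsI:
  assumes "\<And>x. x \<in> carrier M \<Longrightarrow> h x \<in> carrier N"
    and "\<And>x y. \<lbrakk>x \<in> carrier M; y \<in> carrier M\<rbrakk> \<Longrightarrow> h (x \<oplus>\<^bsub>M\<^esub> y) = h x \<oplus>\<^bsub>N\<^esub> h y"
    and "\<And>a x. \<lbrakk>a \<in> carrier R; x \<in> carrier M\<rbrakk> \<Longrightarrow> h (a \<odot>\<^bsub>M\<^esub> x) = a \<odot>\<^bsub>N\<^esub> h x"
  shows "h \<in> linear_maps R M N"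
  using assms by (auto simp: linear_maps_def)

lemma module_ag: "module R M \<Longrightarrow> abelian_group M"
  by (simp add: module_def)

lemma linear_zero:
  assumes "module R M" "module R N" "h \<in> linear_maps R M N"
  shows "h \<zero>\<^bsub>M\<^esub> = \<zero>\<^bsub>N\<^esub>"
proof -
  interpret M: module R M by fact
  interpret N: module R N by fact
  have "h \<zero>\<^bsub>M\<^esub> = h (\<zero>\<^bsub>R\<^esub> \<odot>\<^bsub>M\<^esub> \<zero>\<^bsub>M\<^esub>)" by simp
  also have "\<dots> = \<zero>\<^bsub>R\<^esub> \<odot>\<^bsub>N\<^esub> h \<zero>\<^bsub>M\<^esub>"
    by (rule linear_mapsD(3)[OF assms(3)]) simp_all
  finally show ?thesis using linear_mapsD(1)[OF assms(3)] by simp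
qed

lemma linear_neg:
  assumes "module R M" "module R N" "h \<in> linear_maps R M N" "x \<in> carrier M"
  shows "h (\<ominus>\<^bsub>M\<^esub> x) = \<ominus>\<^bsub>N\<^esub> h x"
proof -
  interpret M: module R M by fact
  interpret N: module R N by fact
  have "h (\<ominus>\<^bsub>M\<^esub> x) \<oplus>\<^bsub>N\<^esub> h x = \<zero>\<^bsub>N\<^esub>"
    using linear_mapsD(2)[OF assms(3), of "\<ominus>\<^bsub>M\<^esub> x" x] linear_zero[OF assms(1-3)] assms(4)
    by (simp add: M.M.l_neg)
  then show ?thesis
    using linear_mapsD(1)[OF assms(3)] assms(4) by (metis M.M.a_inv_closed N.M.minus_equality)
qed

lemma linear_minus:
  assumes "module R M" "module R N" "h \<in> linear_maps R M N" "x \<in> carrier M" "y \<in> carrier M"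
  shows "h (x \<ominus>\<^bsub>M\<^esub> y) = h x \<ominus>\<^bsub>N\<^esub> h y"
proof -
  interpret M: module R M by fact
  show ?thesis
    using linear_mapsD(2)[OF assms(3)] linear_neg[OF assms(1-3)] assms(4,5)
    by (simp add: a_minus_def)
qed

lemma linear_comp:
  assumes "h \<in> linear_maps R M N" "k \<in> linear_maps R N L"
  shows "(\<lambda>x. k (h x)) \<in> linear_maps R M L"
  using assms by (intro linear_mapsI) (simp_all add: linear_mapsD)

lemma linear_finsum:
  assumes "module R M" "module R N" "h \<in> linear_maps R M N" "finite A" "\<And>i. i \<in> A \<Longrightarrow> g i \<in> carrier M"
  shows "h (\<Oplus>\<^bsub>M\<^esub>i \<in> A. g i) = (\<Oplus>\<^bsub>N\<^esub>i \<in> A. h (g i))"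
proof -
  interpret M: module R M by fact
  interpret N: module R N by fact
  show ?thesis using assms(4,5)
  proof (induction A)
    case empty
    then show ?case by (simp add: linear_zero[OF assms(1-3)])
  next
    case (insert a A)
    have "(\<Oplus>\<^bsub>M\<^esub>i \<in> A. g i) \<in> carrier M" using insert.prems by (auto intro: M.M.finsum_closed)
    moreover have "(\<Oplus>\<^bsub>M\<^esub>i \<in> insert a A. g i) = g a \<oplus>\<^bsub>M\<^esub> (\<Oplus>\<^bsub>M\<^esub>i \<in> A. g i)"
      using insert by (intro M.M.finsum_insert) auto
    moreover have "(\<Oplus>\<^bsub>N\<^esub>i \<in> insert a A. h (g i)) = h (g a) \<oplus>\<^bsub>N\<^esub> (\<Oplus>\<^bsub>N\<^esub>i \<in> A. h (g i))"
      using insert linear_mapsD(1)[OF assms(3)] by (intro N.M.finsum_insert) auto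
    ultimately show ?case using linear_mapsD(2)[OF assms(3)] insert by simp
  qed
qed

subsection \<open>Direct sums\<close>

lemma ds_carrier: "f \<in> carrier (direct_sum I M) \<longleftrightarrow>
   f \<in> extensional I \<and> (\<forall>i \<in> I. f i \<in> carrier (M i)) \<and> finite (ds_supp I M f)"
  by (auto simp: direct_sum_def PiE_def Pi_def)

lemma direct_sum_module:
  assumes "cring R" "\<And>i. i \<in> I \<Longrightarrow> module R (M i)"
  shows "module R (direct_sum I M)"
proof -
  let ?D = "direct_sum I M"
  have ag: "abelian_group (M i)" if "i \<in> I" for i using assms(2)[OF that] by (rule module_ag)
  have mon: "abelian_monoid (M i)" if "i \<in> I" for i using ag[OF that] by (simp add: abelian_group_def)
  have add: "f \<oplus>\<^bsub>?D\<^esub> g = (\<lambda>i \<in> I. f i \<oplus>\<^bsub>M i\<^esub> g i)" for f g by (simp add: direct_sum_def)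
  have smu: "a \<odot>\<^bsub>?D\<^esub> g = (\<lambda>i \<in> I. a \<odot>\<^bsub>M i\<^esub> g i)" for a g by (simp add: direct_sum_def)
  have zer: "\<zero>\<^bsub>?D\<^esub> = (\<lambda>i \<in> I. \<zero>\<^bsub>M i\<^esub>)" by (simp add: direct_sum_def)
  have addc: "f \<oplus>\<^bsub>?D\<^esub> g \<in> carrier ?D" if f: "f \<in> carrier ?D" and g: "g \<in> carrier ?D" for f g
  proof -
    have "ds_supp I M (f \<oplus>\<^bsub>?D\<^esub> g) \<subseteq> ds_supp I M f \<union> ds_supp I M g"
      using mon by (auto simp: ds_supp_def add abelian_monoid.l_zero abelian_monoid.zero_closed)
    then have "finite (ds_supp I M (f \<oplus>\<^bsub>?D\<^esub> g))"
      using f g by (auto simp: ds_carrier intro: finite_subset)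
    then show ?thesis using f g mon by (auto simp: ds_carrier add abelian_monoid.a_closed)
  qed
  have smuc: "a \<odot>\<^bsub>?D\<^esub> g \<in> carrier ?D" if f: "a \<in> carrier R" and g: "g \<in> carrier ?D" for a g
  proof -
    have "ds_supp I M (a \<odot>\<^bsub>?D\<^esub> g) \<subseteq> ds_supp I M g"
      using assms(2) f by (auto simp: ds_supp_def smu module.smult_r_null[of R])
    then have "finite (ds_supp I M (a \<odot>\<^bsub>?D\<^esub> g))"
      using g by (auto simp: ds_carrier intro: finite_subset)
    moreover have "a \<odot>\<^bsub>M i\<^esub> g i \<in> carrier (M i)" if "i \<in> I" for i
      by (rule module.smult_closed[OF assms(2)[OF that] f]) (use g that in \<open>simp add: ds_carrier\<close>)
    ultimately show ?thesis by (simp add: ds_carrier smu)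
  qed
  have zeroc: "\<zero>\<^bsub>?D\<^esub> \<in> carrier ?D"
    using mon by (auto simp: ds_carrier zer ds_supp_def abelian_monoid.zero_closed)
  have exteq: "f = g" if "f \<in> extensional I" "g \<in> extensional I" "\<And>i. i \<in> I \<Longrightarrow> f i = g i" for f g
    using that by (rule extensionalityI)
  have AG: "abelian_group ?D"
  proof (rule abelian_groupI)
    fix x assume x: "x \<in> carrier ?D"
    let ?y = "\<lambda>i \<in> I. \<ominus>\<^bsub>M i\<^esub> x i"
    have "ds_supp I M ?y \<subseteq> ds_supp I M x"
      using ag by (auto simp: ds_supp_def abelian_group.minus_equality abelian_group.a_inv_closed
          abelian_monoid.l_zero[OF mon] abelian_monoid.zero_closed[OF mon])
    then have "finite (ds_supp I M ?y)" using x by (auto simp: ds_carrier intro: finite_subset)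
    then have "?y \<in> carrier ?D" using x ag by (auto simp: ds_carrier abelian_group.a_inv_closed)
    moreover have "?y \<oplus>\<^bsub>?D\<^esub> x = \<zero>\<^bsub>?D\<^esub>"
      unfolding add zer using x ag by (auto simp: ds_carrier abelian_group.l_neg intro!: restrict_ext)
    ultimately show "\<exists>y \<in> carrier ?D. y \<oplus>\<^bsub>?D\<^esub> x = \<zero>\<^bsub>?D\<^esub>" by blast
  qed (use addc zeroc mon ag in \<open>auto simp: add zer ds_carrier abelian_monoid.a_assoc
        abelian_monoid.a_comm abelian_monoid.l_zero intro!: restrict_ext exteq\<close>)
  show ?thesis
  proof (rule moduleI)
    show "cring R" by fact
    then interpret R: cring R .
    show "abelian_group ?D" by (rule AG)
    fix a b x y assume a: "a \<in> carrier R" and x: "x \<in> carrier ?D"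
    show "a \<odot>\<^bsub>?D\<^esub> x \<in> carrier ?D" using a x by (rule smuc)
    assume b: "b \<in> carrier R"
    show "(a \<oplus>\<^bsub>R\<^esub> b) \<odot>\<^bsub>?D\<^esub> x = a \<odot>\<^bsub>?D\<^esub> x \<oplus>\<^bsub>?D\<^esub> b \<odot>\<^bsub>?D\<^esub> x"
      using a b x assms(2) by (auto simp: smu add ds_carrier module.smult_l_distr intro!: restrict_ext)
    show "(a \<otimes>\<^bsub>R\<^esub> b) \<odot>\<^bsub>?D\<^esub> x = a \<odot>\<^bsub>?D\<^esub> (b \<odot>\<^bsub>?D\<^esub> x)"
      using a b x assms(2) by (auto simp: smu add ds_carrier module.smult_assoc1 intro!: restrict_ext)
  next
    fix x assume x: "x \<in> carrier ?D"
    show "\<one>\<^bsub>R\<^esub> \<odot>\<^bsub>?D\<^esub> x = x" using x assms(2)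
      by (auto simp: smu ds_carrier module.smult_one intro!: exteq)
  next
    fix a x y assume a: "a \<in> carrier R" and x: "x \<in> carrier ?D" and y: "y \<in> carrier ?D"
    show "a \<odot>\<^bsub>?D\<^esub> (x \<oplus>\<^bsub>?D\<^esub> y) = a \<odot>\<^bsub>?D\<^esub> x \<oplus>\<^bsub>?D\<^esub> a \<odot>\<^bsub>?D\<^esub> y"
      using a x y assms(2) by (auto simp: smu add ds_carrier module.smult_r_distr[of R] intro!: restrict_ext)
  qed
qed

lemma ds_in_linear:
  assumes "\<And>i. i \<in> I \<Longrightarrow> module R (M i)" "i \<in> I"
  shows "ds_in I M i \<in> linear_maps R (M i) (direct_sum I M)"
proof (rule linear_mapsI)
  have ag: "abelian_group (M j)" if "j \<in> I" for j using assms(1)[OF that] by (rule module_ag)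
  have mon: "abelian_monoid (M j)" if "j \<in> I" for j using ag[OF that] by (simp add: abelian_group_def)
  fix x assume x: "x \<in> carrier (M i)"
  have "ds_supp I M (ds_in I M i x) \<subseteq> {i}" by (auto simp: ds_supp_def ds_in_def)
  then have "finite (ds_supp I M (ds_in I M i x))" by (rule finite_subset) simp
  then show "ds_in I M i x \<in> carrier (direct_sum I M)"
    using x mon by (auto simp: ds_carrier ds_in_def abelian_monoid.zero_closed)
  show "ds_in I M i (a \<odot>\<^bsub>M i\<^esub> x) = a \<odot>\<^bsub>direct_sum I M\<^esub> ds_in I M i x" if "a \<in> carrier R" for a
    using that assms(1) by (auto simp: direct_sum_def ds_in_def module.smult_r_null[of R] intro!: restrict_ext)
  show "ds_in I M i (x \<oplus>\<^bsub>M i\<^esub> y) = ds_in I M i x \<oplus>\<^bsub>direct_sum I M\<^esub> ds_in I M i y" for y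
    using mon by (auto simp: direct_sum_def ds_in_def abelian_monoid.l_zero abelian_monoid.zero_closed
        intro!: restrict_ext)
qed

lemma ds_out_superset:
  assumes "module R N" "\<And>i. i \<in> I \<Longrightarrow> module R (M i)"
    and "\<And>i. i \<in> I \<Longrightarrow> h i \<in> linear_maps R (M i) N"
    and "f \<in> carrier (direct_sum I M)" "finite A" "ds_supp I M f \<subseteq> A" "A \<subseteq> I"
  shows "ds_out I M N h f = (\<Oplus>\<^bsub>N\<^esub>i \<in> A. h i (f i))"
proof -
  interpret N: module R N by fact
  show ?thesis unfolding ds_out_def
  proof (rule N.M.add.finprod_mono_neutral_cong_left)
    show "h i (f i) = \<zero>\<^bsub>N\<^esub>" if "i \<in> A - ds_supp I M f" for i
    proof -
      have "f i = \<zero>\<^bsub>M i\<^esub>" "i \<in> I" using that assms(7) by (auto simp: ds_supp_def)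
      then show ?thesis using linear_zero[OF assms(2) assms(1) assms(3)] by simp
    qed
    show "(\<lambda>i. h i (f i)) \<in> A \<rightarrow> carrier N"
      using assms(4,7) linear_mapsD(1)[OF assms(3)] by (auto simp: ds_carrier)
  qed (use assms in auto)
qed

lemma ds_out_linear:
  assumes "module R N" "\<And>i. i \<in> I \<Longrightarrow> module R (M i)"
    and "\<And>i. i \<in> I \<Longrightarrow> h i \<in> linear_maps R (M i) N"
  shows "ds_out I M N h \<in> linear_maps R (direct_sum I M) N"
proof -
  interpret N: module R N by fact
  interpret D: module R "direct_sum I M" by (rule direct_sum_module) (use assms in \<open>auto simp: module_def\<close>)
  have sup: "ds_out I M N h f = (\<Oplus>\<^bsub>N\<^esub>i \<in> A. h i (f i))"
    if "f \<in> carrier (direct_sum I M)" "finite A" "ds_supp I M f \<subseteq> A" "A \<subseteq> I" for f A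
    using ds_out_superset[of R N I M h f A] assms that by blast
  have hc: "h i (f i) \<in> carrier N" if "f \<in> carrier (direct_sum I M)" "i \<in> I" for f i
    using that linear_mapsD(1)[OF assms(3)] by (auto simp: ds_carrier)
  have fin: "finite (ds_supp I M f)" if "f \<in> carrier (direct_sum I M)" for f
    using that by (simp add: ds_carrier)
  have sub: "ds_supp I M f \<subseteq> I" for f by (auto simp: ds_supp_def)
  show ?thesis
  proof (rule linear_mapsI)
    fix f assume f: "f \<in> carrier (direct_sum I M)"
    show "ds_out I M N h f \<in> carrier N" unfolding ds_out_def
      by (rule N.M.finsum_closed) (use f sub hc in auto)
    { fix a assume a: "a \<in> carrier R"
      have af: "a \<odot>\<^bsub>direct_sum I M\<^esub> f \<in> carrier (direct_sum I M)" using a f by simp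
      let ?A = "ds_supp I M f \<union> ds_supp I M (a \<odot>\<^bsub>direct_sum I M\<^esub> f)"
      have A: "finite ?A" "?A \<subseteq> I" using fin[OF f] fin[OF af] sub by auto
      have "ds_out I M N h (a \<odot>\<^bsub>direct_sum I M\<^esub> f) = (\<Oplus>\<^bsub>N\<^esub>i \<in> ?A. h i ((a \<odot>\<^bsub>direct_sum I M\<^esub> f) i))"
        by (rule sup[OF af]) (use A in auto)
      also have "\<dots> = (\<Oplus>\<^bsub>N\<^esub>i \<in> ?A. a \<odot>\<^bsub>N\<^esub> h i (f i))"
      proof (rule N.M.finsum_cong')
        fix i assume "i \<in> ?A"
        then have i: "i \<in> I" using A by auto
        have "(a \<odot>\<^bsub>direct_sum I M\<^esub> f) i = a \<odot>\<^bsub>M i\<^esub> f i" using i by (simp add: direct_sum_def)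
        then show "h i ((a \<odot>\<^bsub>direct_sum I M\<^esub> f) i) = a \<odot>\<^bsub>N\<^esub> h i (f i)"
          using linear_mapsD(3)[OF assms(3)[OF i]] f i a by (simp add: ds_carrier)
      qed (use A hc[OF f] a in auto)
      also have "\<dots> = a \<odot>\<^bsub>N\<^esub> (\<Oplus>\<^bsub>N\<^esub>i \<in> ?A. h i (f i))"
        by (rule N.finsum_smult_ldistr[symmetric]) (use A a hc[OF f] in auto)
      also have "\<dots> = a \<odot>\<^bsub>N\<^esub> ds_out I M N h f"
        by (subst sup[OF f, of ?A]) (use A in auto)
      finally show "ds_out I M N h (a \<odot>\<^bsub>direct_sum I M\<^esub> f) = a \<odot>\<^bsub>N\<^esub> ds_out I M N h f" . }
    fix g assume g: "g \<in> carrier (direct_sum I M)"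
    have af: "f \<oplus>\<^bsub>direct_sum I M\<^esub> g \<in> carrier (direct_sum I M)" using g f by simp
    let ?A = "ds_supp I M f \<union> ds_supp I M g \<union> ds_supp I M (f \<oplus>\<^bsub>direct_sum I M\<^esub> g)"
    have A: "finite ?A" "?A \<subseteq> I" using fin[OF f] fin[OF g] fin[OF af] sub by auto
    have "ds_out I M N h (f \<oplus>\<^bsub>direct_sum I M\<^esub> g) = (\<Oplus>\<^bsub>N\<^esub>i \<in> ?A. h i ((f \<oplus>\<^bsub>direct_sum I M\<^esub> g) i))"
      by (rule sup[OF af]) (use A in auto)
    also have "\<dots> = (\<Oplus>\<^bsub>N\<^esub>i \<in> ?A. h i (f i) \<oplus>\<^bsub>N\<^esub> h i (g i))"
    proof (rule N.M.finsum_cong')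
      fix i assume "i \<in> ?A"
      then have i: "i \<in> I" using A by auto
      have "(f \<oplus>\<^bsub>direct_sum I M\<^esub> g) i = f i \<oplus>\<^bsub>M i\<^esub> g i" using i by (simp add: direct_sum_def)
      then show "h i ((f \<oplus>\<^bsub>direct_sum I M\<^esub> g) i) = h i (f i) \<oplus>\<^bsub>N\<^esub> h i (g i)"
        using linear_mapsD(2)[OF assms(3)[OF i]] f i g by (simp add: ds_carrier)
    qed (use A hc[OF f] hc[OF g] in auto)
    also have "\<dots> = (\<Oplus>\<^bsub>N\<^esub>i \<in> ?A. h i (f i)) \<oplus>\<^bsub>N\<^esub> (\<Oplus>\<^bsub>N\<^esub>i \<in> ?A. h i (g i))"
      by (rule N.M.finsum_addf) (use A hc[OF f] hc[OF g] in auto)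
    also have "(\<Oplus>\<^bsub>N\<^esub>i \<in> ?A. h i (f i)) = ds_out I M N h f"
      by (subst sup[OF f, of ?A]) (use A in auto)
    also have "(\<Oplus>\<^bsub>N\<^esub>i \<in> ?A. h i (g i)) = ds_out I M N h g"
      by (subst sup[OF g, of ?A]) (use A in auto)
    finally show "ds_out I M N h (f \<oplus>\<^bsub>direct_sum I M\<^esub> g) = ds_out I M N h f \<oplus>\<^bsub>N\<^esub> ds_out I M N h g" .
  qed
qed

lemma ds_out_in:
  assumes "module R N" "\<And>i. i \<in> I \<Longrightarrow> module R (M i)"
    and "\<And>i. i \<in> I \<Longrightarrow> h i \<in> linear_maps R (M i) N"
    and "i \<in> I" "x \<in> carrier (M i)"
  shows "ds_out I M N h (ds_in I M i x) = h i x"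
proof -
  interpret N: module R N by fact
  have "ds_in I M i x \<in> carrier (direct_sum I M)"
    by (rule linear_mapsD(1)[OF ds_in_linear[where R=R and M=M and I=I]]) (use assms in auto)
  moreover have "ds_supp I M (ds_in I M i x) \<subseteq> {i}" by (auto simp: ds_supp_def ds_in_def)
  ultimately have "ds_out I M N h (ds_in I M i x) = (\<Oplus>\<^bsub>N\<^esub>j \<in> {i}. h j (ds_in I M i x j))"
    by (intro ds_out_superset[OF assms(1-3)]) (use assms(4) in auto)
  then show ?thesis using assms(4) linear_mapsD(1)[OF assms(3)[OF assms(4)] assms(5)]
    by (simp add: ds_in_def)
qed

lemma ds_linear_eq:
  assumes N: "module R N" and M: "\<And>i. i \<in> I \<Longrightarrow> module R (M i)"
    and g: "g \<in> linear_maps R (direct_sum I M) N" and h: "h \<in> linear_maps R (direct_sum I M) N"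
    and eq: "\<And>i x. \<lbrakk>i \<in> I; x \<in> carrier (M i)\<rbrakk> \<Longrightarrow> g (ds_in I M i x) = h (ds_in I M i x)"
    and f: "f \<in> carrier (direct_sum I M)"
  shows "g f = h f"
proof -
  interpret D: module R "direct_sum I M" by (rule direct_sum_module) (use N M in \<open>auto simp: module_def\<close>)
  have main: "\<forall>f \<in> carrier (direct_sum I M). ds_supp I M f = A \<longrightarrow> g f = h f" if "finite A" for A
    using that
  proof (induction A rule: finite_psubset_induct)
    case (psubset A)
    show ?case
    proof (intro ballI impI)
      fix f assume f: "f \<in> carrier (direct_sum I M)" and A: "ds_supp I M f = A"
      show "g f = h f"
      proof (cases "A = {}")
        case True
        have "f = \<zero>\<^bsub>direct_sum I M\<^esub>"
        proof (rule extensionalityI[of _ I])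
          show "f \<in> extensional I" using f by (simp add: ds_carrier)
        qed (use A True in \<open>auto simp: direct_sum_def ds_supp_def\<close>)
        then show ?thesis
          using linear_zero[OF D.module_axioms N g] linear_zero[OF D.module_axioms N h] by simp
      next
        case False
        then obtain i where i: "i \<in> A" by blast
        then have iI: "i \<in> I" using A by (auto simp: ds_supp_def)
        have fi: "f i \<in> carrier (M i)" using f iI by (simp add: ds_carrier)
        let ?f = "f(i := \<zero>\<^bsub>M i\<^esub>)"
        have supp: "ds_supp I M ?f = A - {i}" using A by (auto simp: ds_supp_def)
        have mon: "abelian_monoid (M j)" if "j \<in> I" for j
          using module_ag[OF M[OF that]] by (simp add: abelian_group_def)
        have f': "?f \<in> carrier (direct_sum I M)"
          using f supp psubset(1) iI mon
          by (auto simp: ds_carrier extensional_def abelian_monoid.zero_closed)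
        have inc: "ds_in I M i (f i) \<in> carrier (direct_sum I M)"
          by (rule linear_mapsD(1)[OF ds_in_linear[where R=R and M=M and I=I]]) (use M iI fi in auto)
        have dec: "f = ?f \<oplus>\<^bsub>direct_sum I M\<^esub> ds_in I M i (f i)"
        proof (rule extensionalityI[of _ I])
          show "f \<in> extensional I" using f by (simp add: ds_carrier)
          show "?f \<oplus>\<^bsub>direct_sum I M\<^esub> ds_in I M i (f i) \<in> extensional I" by (simp add: direct_sum_def)
          fix j assume j: "j \<in> I"
          then have "f j \<in> carrier (M j)" using f by (simp add: ds_carrier)
          then show "f j = (?f \<oplus>\<^bsub>direct_sum I M\<^esub> ds_in I M i (f i)) j"
            using j mon[OF j] by (auto simp: direct_sum_def ds_in_def abelian_monoid.l_zero abelian_monoid.r_zero)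
        qed
        have "g ?f = h ?f" using psubset(2)[of "A - {i}"] i f' supp by blast
        then have "g (?f \<oplus>\<^bsub>direct_sum I M\<^esub> ds_in I M i (f i)) = h (?f \<oplus>\<^bsub>direct_sum I M\<^esub> ds_in I M i (f i))"
          using linear_mapsD(2)[OF g f' inc] linear_mapsD(2)[OF h f' inc] eq[OF iI fi] by simp
        then show ?thesis using dec by metis
      qed
    qed
  qed
  have "finite (ds_supp I M f)" using f by (simp add: ds_carrier)
  from main[OF this] f show ?thesis by blast
qed

subsection \<open>Quotients and spans\<close>

lemma submodule_abelian_subgroup:
  assumes "module R M" "submodule H R M"
  shows "abelian_subgroup H M"
  using assms by (intro abelian_subgroupI3)
    (auto simp: additive_subgroup_def submodule_def module_def)

lemma quot_carrier:
  "X \<in> carrier (quot_module M H) \<longleftrightarrow> (\<exists>x \<in> carrier M. X = H +>\<^bsub>M\<^esub> x)"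
  by (auto simp: quot_module_def A_RCOSETS_def' a_r_coset_def')

lemma coset_eq_iff:
  assumes "module R M" "submodule H R M" "x \<in> carrier M" "y \<in> carrier M"
  shows "H +>\<^bsub>M\<^esub> x = H +>\<^bsub>M\<^esub> y \<longleftrightarrow> x \<ominus>\<^bsub>M\<^esub> y \<in> H"
proof -
  interpret abelian_subgroup H M using assms(1,2) by (rule submodule_abelian_subgroup)
  have "H +>\<^bsub>M\<^esub> x = H +>\<^bsub>M\<^esub> y \<longleftrightarrow> x \<in> H +>\<^bsub>M\<^esub> y"
    using a_repr_independenceD[of x y] a_repr_independence'[of x y] assms(3,4) by auto
  then show ?thesis using a_rcos_module[OF assms(4,3)] by (simp add: a_minus_def)
qed

lemma linear_coset:
  assumes "module R M" "module R N" "submodule H R M" "h \<in> linear_maps R M N"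
    and "\<And>z. z \<in> H \<Longrightarrow> h z = \<zero>\<^bsub>N\<^esub>" "x \<in> carrier M" "z \<in> H +>\<^bsub>M\<^esub> x"
  shows "z \<in> carrier M" "h z = h x"
proof -
  interpret abelian_subgroup H M using assms(1,3) by (rule submodule_abelian_subgroup)
  interpret N: module R N by fact
  obtain k where k: "k \<in> H" "z = k \<oplus>\<^bsub>M\<^esub> x" using assms(7) by (auto simp: a_r_coset_def')
  then have kc: "k \<in> carrier M" by simp
  then show "z \<in> carrier M" using k assms(6) by simp
  have "h z = h k \<oplus>\<^bsub>N\<^esub> h x" using linear_mapsD(2)[OF assms(4) kc assms(6)] k by simp
  then show "h z = h x" using assms(5)[OF k(1)] linear_mapsD(1)[OF assms(4,6)] by simp
qed

lemma coset_self:
  assumes "module R M" "submodule H R M" "x \<in> carrier M"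
  shows "x \<in> H +>\<^bsub>M\<^esub> x"
proof -
  interpret abelian_subgroup H M using assms(1,2) by (rule submodule_abelian_subgroup)
  show ?thesis by (rule a_rcos_self) fact
qed

lemma quot_smult:
  assumes "module R M" "submodule H R M" "a \<in> carrier R" "x \<in> carrier M"
  shows "a \<odot>\<^bsub>quot_module M H\<^esub> (H +>\<^bsub>M\<^esub> x) = H +>\<^bsub>M\<^esub> (a \<odot>\<^bsub>M\<^esub> x)"
proof -
  interpret abelian_subgroup H M using assms(1,2) by (rule submodule_abelian_subgroup)
  interpret M: module R M by fact
  have const: "H +>\<^bsub>M\<^esub> (a \<odot>\<^bsub>M\<^esub> z) = H +>\<^bsub>M\<^esub> (a \<odot>\<^bsub>M\<^esub> x)" if z: "z \<in> H +>\<^bsub>M\<^esub> x" for z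
  proof -
    have zc: "z \<in> carrier M" using z assms(4) by (rule a_elemrcos_carrier[rotated])
    have "z \<oplus>\<^bsub>M\<^esub> \<ominus>\<^bsub>M\<^esub> x \<in> H" using assms(4) z by (rule a_rcos_module_imp)
    then have "a \<odot>\<^bsub>M\<^esub> (z \<oplus>\<^bsub>M\<^esub> \<ominus>\<^bsub>M\<^esub> x) \<in> H" using submodule.smult_closed[OF assms(2,3)] by blast
    then have "a \<odot>\<^bsub>M\<^esub> z \<ominus>\<^bsub>M\<^esub> a \<odot>\<^bsub>M\<^esub> x \<in> H"
      using zc assms(3,4) by (simp add: M.smult_r_distr M.smult_r_minus a_minus_def)
    then show ?thesis using coset_eq_iff[OF assms(1,2)] zc assms(3,4) by simp
  qed
  have "(\<Union>z \<in> H +>\<^bsub>M\<^esub> x. H +>\<^bsub>M\<^esub> (a \<odot>\<^bsub>M\<^esub> z)) = H +>\<^bsub>M\<^esub> (a \<odot>\<^bsub>M\<^esub> x)"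
    by (rule UN_constant_eq[OF a_rcos_self[OF assms(4)]], rule ballI, rule const)
  then show ?thesis by (simp only: quot_module_def module.simps)
qed

lemma quot_module_module:
  assumes "module R M" "submodule H R M"
  shows "module R (quot_module M H)"
    and "(\<lambda>x. H +>\<^bsub>M\<^esub> x) \<in> linear_maps R M (quot_module M H)"
proof -
  interpret M: module R M by fact
  interpret abelian_subgroup H M using assms by (rule submodule_abelian_subgroup)
  let ?Q = "quot_module M H"
  have add: "(H +>\<^bsub>M\<^esub> x) \<oplus>\<^bsub>?Q\<^esub> (H +>\<^bsub>M\<^esub> y) = H +>\<^bsub>M\<^esub> (x \<oplus>\<^bsub>M\<^esub> y)"
    if "x \<in> carrier M" "y \<in> carrier M" for x y
    using a_rcos_sum[OF that] by (simp add: quot_module_def)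
  note sm = quot_smult[OF assms]
  have zer: "\<zero>\<^bsub>?Q\<^esub> = H +>\<^bsub>M\<^esub> \<zero>\<^bsub>M\<^esub>"
    using a_rcos_const[of "\<zero>\<^bsub>M\<^esub>"] by (simp add: quot_module_def)
  have car: "H +>\<^bsub>M\<^esub> x \<in> carrier ?Q" if "x \<in> carrier M" for x using that quot_carrier by blast
  have car': "\<exists>x \<in> carrier M. X = H +>\<^bsub>M\<^esub> x" if "X \<in> carrier ?Q" for X using that quot_carrier by blast
  have AG: "abelian_group ?Q"
  proof (rule abelian_groupI)
    show "\<zero>\<^bsub>?Q\<^esub> \<in> carrier ?Q" unfolding zer by (rule car) simp
    fix X assume "X \<in> carrier ?Q"
    then obtain x where x: "x \<in> carrier M" "X = H +>\<^bsub>M\<^esub> x" using car' by blast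
    show "\<zero>\<^bsub>?Q\<^esub> \<oplus>\<^bsub>?Q\<^esub> X = X" unfolding zer x(2) using x(1) by (simp add: add)
    show "\<exists>Y \<in> carrier ?Q. Y \<oplus>\<^bsub>?Q\<^esub> X = \<zero>\<^bsub>?Q\<^esub>"
    proof (rule bexI)
      show "(H +>\<^bsub>M\<^esub> (\<ominus>\<^bsub>M\<^esub> x)) \<oplus>\<^bsub>?Q\<^esub> X = \<zero>\<^bsub>?Q\<^esub>"
        unfolding zer x(2) using x(1) by (simp add: add M.M.l_neg)
      show "H +>\<^bsub>M\<^esub> (\<ominus>\<^bsub>M\<^esub> x) \<in> carrier ?Q" by (rule car) (use x in simp)
    qed
    fix Y assume "Y \<in> carrier ?Q"
    then obtain y where y: "y \<in> carrier M" "Y = H +>\<^bsub>M\<^esub> y" using car' by blast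
    show "X \<oplus>\<^bsub>?Q\<^esub> Y \<in> carrier ?Q" unfolding x(2) y(2) using x(1) y(1) by (simp add: add car)
    show "X \<oplus>\<^bsub>?Q\<^esub> Y = Y \<oplus>\<^bsub>?Q\<^esub> X" unfolding x(2) y(2) using x(1) y(1) by (simp add: add M.M.a_comm)
    fix Z assume "Z \<in> carrier ?Q"
    then obtain z where z: "z \<in> carrier M" "Z = H +>\<^bsub>M\<^esub> z" using car' by blast
    show "X \<oplus>\<^bsub>?Q\<^esub> Y \<oplus>\<^bsub>?Q\<^esub> Z = X \<oplus>\<^bsub>?Q\<^esub> (Y \<oplus>\<^bsub>?Q\<^esub> Z)"
      unfolding x(2) y(2) z(2) using x(1) y(1) z(1) by (simp add: add M.M.a_assoc)
  qed
  show "module R ?Q"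
  proof (rule moduleI)
    show "cring R" by (rule M.R.is_cring)
    show "abelian_group ?Q" by (rule AG)
    fix a X assume a: "a \<in> carrier R" and "X \<in> carrier ?Q"
    then obtain x where x: "x \<in> carrier M" "X = H +>\<^bsub>M\<^esub> x" using car' by blast
    show "a \<odot>\<^bsub>?Q\<^esub> X \<in> carrier ?Q" unfolding x(2) using a x(1) by (simp add: sm car)
    show "(a \<oplus>\<^bsub>R\<^esub> b) \<odot>\<^bsub>?Q\<^esub> X = a \<odot>\<^bsub>?Q\<^esub> X \<oplus>\<^bsub>?Q\<^esub> b \<odot>\<^bsub>?Q\<^esub> X"
      "(a \<otimes>\<^bsub>R\<^esub> b) \<odot>\<^bsub>?Q\<^esub> X = a \<odot>\<^bsub>?Q\<^esub> (b \<odot>\<^bsub>?Q\<^esub> X)" if b: "b \<in> carrier R" for b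
      unfolding x(2) using a b x(1) by (simp_all add: sm add M.smult_l_distr M.smult_assoc1)
    fix Y assume "Y \<in> carrier ?Q"
    then obtain y where y: "y \<in> carrier M" "Y = H +>\<^bsub>M\<^esub> y" using car' by blast
    show "a \<odot>\<^bsub>?Q\<^esub> (X \<oplus>\<^bsub>?Q\<^esub> Y) = a \<odot>\<^bsub>?Q\<^esub> X \<oplus>\<^bsub>?Q\<^esub> a \<odot>\<^bsub>?Q\<^esub> Y"
      unfolding x(2) y(2) using a x(1) y(1) by (simp add: sm add M.smult_r_distr)
  next
    fix X assume "X \<in> carrier ?Q"
    then obtain x where x: "x \<in> carrier M" "X = H +>\<^bsub>M\<^esub> x" using car' by blast
    show "\<one>\<^bsub>R\<^esub> \<odot>\<^bsub>?Q\<^esub> X = X" unfolding x(2) using x(1) by (simp add: sm)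
  qed
  show "(\<lambda>x. H +>\<^bsub>M\<^esub> x) \<in> linear_maps R M ?Q"
    by (rule linear_mapsI) (erule car, simp only: add, simp only: sm)
qed

lemma quot_linear_eq:
  assumes "\<And>x. x \<in> carrier M \<Longrightarrow> g (H +>\<^bsub>M\<^esub> x) = h (H +>\<^bsub>M\<^esub> x)" "X \<in> carrier (quot_module M H)"
  shows "g X = h X"
proof -
  obtain x where x: "x \<in> carrier M" "X = H +>\<^bsub>M\<^esub> x"
    using assms(2) unfolding quot_carrier by (elim bexE)
  show ?thesis unfolding x(2) by (rule assms(1)[OF x(1)])
qed

lemma span_submodule:
  assumes "module R M" "S \<subseteq> carrier M"
  shows "submodule (span R M S) R M" and "S \<subseteq> span R M S"
proof -
  interpret M: module R M by fact
  show "S \<subseteq> span R M S" unfolding span_def by (rule hull_subset)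
  have sub: "submodule (carrier M) R M" by (rule M.carrier_is_submodule)
  have eq: "span R M S = \<Inter>{H. submodule H R M \<and> S \<subseteq> H}" by (simp add: span_def hull_def)
  show "submodule (span R M S) R M" unfolding eq
  proof (rule M.submoduleI)
    show "\<Inter>{H. submodule H R M \<and> S \<subseteq> H} \<subseteq> carrier M" using sub assms(2) by blast
    show "\<zero>\<^bsub>M\<^esub> \<in> \<Inter>{H. submodule H R M \<and> S \<subseteq> H}"
      by (auto simp: submodule_def dest: subgroup.one_closed)
    show "\<ominus>\<^bsub>M\<^esub> a \<in> \<Inter>{H. submodule H R M \<and> S \<subseteq> H}" if "a \<in> \<Inter>{H. submodule H R M \<and> S \<subseteq> H}" for a
      using that M.submoduleE(3) by blast
    show "a \<oplus>\<^bsub>M\<^esub> b \<in> \<Inter>{H. submodule H R M \<and> S \<subseteq> H}"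
      if "a \<in> \<Inter>{H. submodule H R M \<and> S \<subseteq> H}" "b \<in> \<Inter>{H. submodule H R M \<and> S \<subseteq> H}" for a b
      using that M.submoduleE(5) by blast
    show "a \<odot>\<^bsub>M\<^esub> b \<in> \<Inter>{H. submodule H R M \<and> S \<subseteq> H}"
      if "a \<in> carrier R" "b \<in> \<Inter>{H. submodule H R M \<and> S \<subseteq> H}" for a b
      using that M.submoduleE(4) by blast
  qed
qed

lemma kernel_submodule:
  assumes "module R M" "module R N" "h \<in> linear_maps R M N"
  shows "submodule {x \<in> carrier M. h x = \<zero>\<^bsub>N\<^esub>} R M"
proof -
  interpret M: module R M by fact
  interpret N: module R N by fact
  show ?thesis
    by (rule M.submoduleI)
      (auto simp: linear_zero[OF assms] linear_neg[OF assms] linear_mapsD(2,3)[OF assms(3)])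
qed

lemma linear_span_zero:
  assumes "module R M" "module R N" "h \<in> linear_maps R M N" "S \<subseteq> carrier M"
    and "\<And>x. x \<in> S \<Longrightarrow> h x = \<zero>\<^bsub>N\<^esub>" "z \<in> span R M S"
  shows "h z = \<zero>\<^bsub>N\<^esub>"
proof -
  have "span R M S \<subseteq> {x \<in> carrier M. h x = \<zero>\<^bsub>N\<^esub>}"
    unfolding span_def by (rule hull_minimal) (use assms kernel_submodule[OF assms(1-3)] in auto)
  then show ?thesis using assms(6) by blast
qed

subsection \<open>Induction is left adjoint to restriction\<close>

lemma ind_Act_class:
  fixes L :: "('o, 'a, 'r, 'm) cmod"
  shows "Act (ind R C D \<alpha> L) w X = (\<Union>f \<in> X. ind_class R C D \<alpha> L (Cod D w)
       (ds_out (ind_index C D \<alpha> (Dom D w)) (Val L \<circ> fst) (ind_sum C D \<alpha> L (Cod D w))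
          (\<lambda>(c, u). ind_in C D \<alpha> L (Cod D w) (c, Comp D w u)) f))"
  by (simp add: ind_def)

locale ind_setting =
  fixes R :: "'r ring" and C :: "('o, 'a) cat" and D :: "('p, 'b) cat"
    and \<alpha> :: "('o, 'a, 'p, 'b) catfun" and L :: "('o, 'a, 'r, 'm) cmod"
  assumes R: "cring R" and \<alpha>: "is_functor C D \<alpha>" and L: "kmodule R C L"
begin

lemma C: "category C" and D: "category D"
  using \<alpha> by (auto simp: is_functor_def)

lemma
  shows f_obj: "c \<in> Obj C \<Longrightarrow> fobj \<alpha> c \<in> Obj D"
    and f_arr: "v \<in> Arr C \<Longrightarrow> farr \<alpha> v \<in> Hom D (fobj \<alpha> (Dom C v)) (fobj \<alpha> (Cod C v))"
    and f_id: "c \<in> Obj C \<Longrightarrow> farr \<alpha> (Id C c) = Id D (fobj \<alpha> c)"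
  using \<alpha> by (auto simp: is_functor_def)

lemma Dom_C: "v \<in> Arr C \<Longrightarrow> Dom C v \<in> Obj C" and Cod_C: "v \<in> Arr C \<Longrightarrow> Cod C v \<in> Obj C"
  using category.Dom_Obj[OF C] category.Cod_Obj[OF C] by auto

lemma L_mod: "c \<in> Obj C \<Longrightarrow> module R (Val L c)"
  and L_act: "v \<in> Arr C \<Longrightarrow> Act L v \<in> linear_maps R (Val L (Dom C v)) (Val L (Cod C v))"
  using L by (auto simp: kmodule_def)

abbreviation "I \<equiv> ind_index C D \<alpha>"
abbreviation "S \<equiv> ind_sum C D \<alpha> L"
abbreviation "inn \<equiv> ind_in C D \<alpha> L"
abbreviation "H \<equiv> ind_rel R C D \<alpha> L"
abbreviation "cls \<equiv> ind_class R C D \<alpha> L"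
abbreviation "V \<equiv> Val (ind R C D \<alpha> L)"
abbreviation "A \<equiv> Act (ind R C D \<alpha> L)"
abbreviation "out N h d \<equiv> ds_out (I d) (Val L \<circ> fst) N h"

lemma I_iff: "(c, u) \<in> I d \<longleftrightarrow> c \<in> Obj C \<and> u \<in> Hom D (fobj \<alpha> c) d"
  by (simp add: ind_index_def)

lemma I_mod: "i \<in> I d \<Longrightarrow> module R ((Val L \<circ> fst) i)"
  using L_mod by (auto simp: ind_index_def)

lemma S_mod: "module R (S d)"
  unfolding ind_sum_def by (rule direct_sum_module[OF R I_mod])

lemma inn_lin: "i \<in> I d \<Longrightarrow> inn d i \<in> linear_maps R (Val L (fst i)) (S d)"
  unfolding ind_sum_def ind_in_def using ds_in_linear[of "I d" R "Val L \<circ> fst" i] I_mod by simp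

lemma comp_I: "\<lbrakk>(c, u) \<in> I d; w \<in> Arr D; Dom D w = d; Cod D w = e\<rbrakk> \<Longrightarrow> (c, Comp D w u) \<in> I e"
  unfolding I_iff using category.Comp_Hom[OF D, of u "fobj \<alpha> c" d w e] by (auto simp: Hom_def)

lemma rel_I:
  assumes "v \<in> Arr C" "u \<in> Hom D (fobj \<alpha> (Cod C v)) d"
  shows "(Dom C v, Comp D u (farr \<alpha> v)) \<in> I d" "(Cod C v, u) \<in> I d"
  unfolding I_iff using category.Comp_Hom[OF D f_arr[OF assms(1)] assms(2)] assms
  by (auto simp: Dom_C Cod_C)

definition gens :: "'p \<Rightarrow> ('o \<times> 'b \<Rightarrow> 'm) set" where
  "gens d = {inn d (Dom C v, Comp D u (farr \<alpha> v)) x \<ominus>\<^bsub>S d\<^esub> inn d (Cod C v, u) (Act L v x) | v u x.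
        v \<in> Arr C \<and> u \<in> Hom D (fobj \<alpha> (Cod C v)) d \<and> x \<in> carrier (Val L (Dom C v))}"

lemma gen_carrier:
  assumes "v \<in> Arr C" "u \<in> Hom D (fobj \<alpha> (Cod C v)) d" "x \<in> carrier (Val L (Dom C v))"
  shows "inn d (Dom C v, Comp D u (farr \<alpha> v)) x \<in> carrier (S d)"
    "inn d (Cod C v, u) (Act L v x) \<in> carrier (S d)"
  using linear_mapsD(1)[OF inn_lin[OF rel_I(1)[OF assms(1,2)]]]
    linear_mapsD(1)[OF inn_lin[OF rel_I(2)[OF assms(1,2)]]]
    linear_mapsD(1)[OF L_act[OF assms(1)] assms(3)] assms(3) by auto

lemma gens_carrier: "gens d \<subseteq> carrier (S d)"
proof -
  interpret S: module R "S d" by (rule S_mod)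
  show ?thesis unfolding gens_def using gen_carrier by (auto intro!: S.M.minus_closed)
qed

lemma H_span: "H d = span R (S d) (gens d)"
  by (simp add: ind_rel_def gens_def)

lemma H_sub: "submodule (H d) R (S d)"
  unfolding H_span by (rule span_submodule(1)[OF S_mod gens_carrier])

lemma V_eq: "V d = quot_module (S d) (H d)"
  by (simp add: ind_def)

lemma V_mod: "module R (V d)"
  unfolding V_eq by (rule quot_module_module(1)[OF S_mod H_sub])

lemma cls_lin: "cls d \<in> linear_maps R (S d) (V d)"
  using quot_module_module(2)[OF S_mod H_sub, of d] unfolding V_eq ind_class_def .

lemma cls_eq: "\<lbrakk>x \<in> carrier (S d); y \<in> carrier (S d)\<rbrakk> \<Longrightarrow> cls d x = cls d y \<longleftrightarrow> x \<ominus>\<^bsub>S d\<^esub> y \<in> H d"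
  unfolding ind_class_def by (rule coset_eq_iff[OF S_mod H_sub])

lemma cls_rel:
  assumes "v \<in> Arr C" "u \<in> Hom D (fobj \<alpha> (Cod C v)) d" "x \<in> carrier (Val L (Dom C v))"
  shows "cls d (inn d (Dom C v, Comp D u (farr \<alpha> v)) x) = cls d (inn d (Cod C v, u) (Act L v x))"
proof -
  have "inn d (Dom C v, Comp D u (farr \<alpha> v)) x \<ominus>\<^bsub>S d\<^esub> inn d (Cod C v, u) (Act L v x) \<in> gens d"
    unfolding gens_def using assms by blast
  then have "inn d (Dom C v, Comp D u (farr \<alpha> v)) x \<ominus>\<^bsub>S d\<^esub> inn d (Cod C v, u) (Act L v x) \<in> H d"
    unfolding H_span using span_submodule(2)[OF S_mod gens_carrier] by blast
  then show ?thesis using cls_eq[OF gen_carrier[OF assms]] by blast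
qed

lemma inn_carrier: "\<lbrakk>i \<in> I d; x \<in> carrier (Val L (fst i))\<rbrakk> \<Longrightarrow> inn d i x \<in> carrier (S d)"
  using linear_mapsD(1)[OF inn_lin] .

lemma cls_carrier: "f \<in> carrier (S d) \<Longrightarrow> cls d f \<in> carrier (V d)"
  using linear_mapsD(1)[OF cls_lin] .

lemma V_cases:
  assumes "X \<in> carrier (V d)"
  obtains f where "f \<in> carrier (S d)" "X = cls d f"
  using assms unfolding V_eq quot_carrier ind_class_def by blast

lemma V_linear_eq:
  assumes N: "module R N" and g: "g \<in> linear_maps R (V d) N" and h: "h \<in> linear_maps R (V d) N"
    and eq: "\<And>i x. \<lbrakk>i \<in> I d; x \<in> carrier (Val L (fst i))\<rbrakk> \<Longrightarrow> g (cls d (inn d i x)) = h (cls d (inn d i x))"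
    and X: "X \<in> carrier (V d)"
  shows "g X = h X"
proof -
  obtain f where f: "f \<in> carrier (S d)" "X = cls d f" using X by (rule V_cases)
  have "(\<lambda>f. g (cls d f)) f = (\<lambda>f. h (cls d f)) f"
  proof (rule ds_linear_eq[where R = R and I = "I d" and M = "Val L \<circ> fst" and N = N])
    show "(\<lambda>f. g (cls d f)) \<in> linear_maps R (direct_sum (I d) (Val L \<circ> fst)) N"
      using linear_comp[OF cls_lin g] by (simp add: ind_sum_def)
    show "(\<lambda>f. h (cls d f)) \<in> linear_maps R (direct_sum (I d) (Val L \<circ> fst)) N"
      using linear_comp[OF cls_lin h] by (simp add: ind_sum_def)
    show "g (cls d (ds_in (I d) (Val L \<circ> fst) i x)) = h (cls d (ds_in (I d) (Val L \<circ> fst) i x))"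
      if "i \<in> I d" "x \<in> carrier ((Val L \<circ> fst) i)" for i x
      using eq[of i x] that by (simp add: ind_in_def)
    show "f \<in> carrier (direct_sum (I d) (Val L \<circ> fst))" using f(1) by (simp add: ind_sum_def)
  qed (use N I_mod in auto)
  then show ?thesis using f(2) by simp
qed

text \<open>Maps out of \<open>V d\<close> from compatible families.\<close>

context
  fixes N :: "('r, 'n) module" and h :: "'o \<times> 'b \<Rightarrow> 'm \<Rightarrow> 'n" and d :: 'p
  assumes N: "module R N"
    and h: "\<And>i. i \<in> I d \<Longrightarrow> h i \<in> linear_maps R (Val L (fst i)) N"
    and compat: "\<And>v u x. \<lbrakk>v \<in> Arr C; u \<in> Hom D (fobj \<alpha> (Cod C v)) d; x \<in> carrier (Val L (Dom C v))\<rbrakk>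
      \<Longrightarrow> h (Dom C v, Comp D u (farr \<alpha> v)) x = h (Cod C v, u) (Act L v x)"
begin

lemma out_lin: "out N h d \<in> linear_maps R (S d) N"
  unfolding ind_sum_def by (rule ds_out_linear[OF N I_mod]) (use h in simp_all)

lemma out_inn: "\<lbrakk>i \<in> I d; x \<in> carrier (Val L (fst i))\<rbrakk> \<Longrightarrow> out N h d (inn d i x) = h i x"
  unfolding ind_in_def by (rule ds_out_in[OF N I_mod]) (use h in simp_all)

lemma out_H: "z \<in> H d \<Longrightarrow> out N h d z = \<zero>\<^bsub>N\<^esub>"
  unfolding H_span
proof (rule linear_span_zero[OF S_mod N out_lin gens_carrier])
  interpret N: module R N by (rule N)
  fix y assume "y \<in> gens d"
  then obtain v u x where *: "v \<in> Arr C" "u \<in> Hom D (fobj \<alpha> (Cod C v)) d" "x \<in> carrier (Val L (Dom C v))"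
    and y: "y = inn d (Dom C v, Comp D u (farr \<alpha> v)) x \<ominus>\<^bsub>S d\<^esub> inn d (Cod C v, u) (Act L v x)"
    unfolding gens_def by blast
  have c: "Act L v x \<in> carrier (Val L (Cod C v))" using linear_mapsD(1)[OF L_act] * by blast
  have "out N h d y = h (Dom C v, Comp D u (farr \<alpha> v)) x \<ominus>\<^bsub>N\<^esub> h (Cod C v, u) (Act L v x)"
    unfolding y linear_minus[OF S_mod N out_lin gen_carrier[OF *]]
    using out_inn[OF rel_I(1)[OF *(1,2)]] out_inn[OF rel_I(2)[OF *(1,2)]] *(3) c by simp
  moreover have "h (Cod C v, u) (Act L v x) \<in> carrier N"
    using linear_mapsD(1)[OF h[OF rel_I(2)[OF *(1,2)]]] c by simp
  ultimately show "out N h d y = \<zero>\<^bsub>N\<^esub>" using compat[OF *] by (simp add: a_minus_def N.M.r_neg)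
qed

lemma out_cls:
  assumes "f \<in> carrier (S d)" "z \<in> cls d f"
  shows "out N h d z = out N h d f"
  by (rule linear_coset(2)[OF S_mod N H_sub out_lin out_H assms(1)]) (use assms(2) in \<open>simp_all add: ind_class_def\<close>)

lemma cls_self: "f \<in> carrier (S d) \<Longrightarrow> f \<in> cls d f"
  unfolding ind_class_def by (rule coset_self[OF S_mod H_sub])

lemma descend_the_elem: "f \<in> carrier (S d) \<Longrightarrow> the_elem (out N h d ` cls d f) = out N h d f"
proof -
  assume f: "f \<in> carrier (S d)"
  have "out N h d ` cls d f = {out N h d f}" using out_cls[OF f] cls_self[OF f] by blast
  then show ?thesis by simp
qed

lemma descend_linear:
  assumes k: "\<And>f. f \<in> carrier (S d) \<Longrightarrow> k (cls d f) = out N h d f"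
  shows "k \<in> linear_maps R (V d) N"
proof (rule linear_mapsI)
  interpret S: module R "S d" by (rule S_mod)
  fix X assume "X \<in> carrier (V d)"
  then obtain f where f: "f \<in> carrier (S d)" "X = cls d f" by (rule V_cases)
  show "k X \<in> carrier N" using k f linear_mapsD(1)[OF out_lin] by simp
  { fix a assume a: "a \<in> carrier R"
    have "k (a \<odot>\<^bsub>V d\<^esub> X) = k (cls d (a \<odot>\<^bsub>S d\<^esub> f))" using linear_mapsD(3)[OF cls_lin a f(1)] f(2) by simp
    also have "\<dots> = out N h d (a \<odot>\<^bsub>S d\<^esub> f)" by (rule k) (use a f in simp)
    also have "\<dots> = a \<odot>\<^bsub>N\<^esub> k X" using linear_mapsD(3)[OF out_lin a f(1)] k f by simp
    finally show "k (a \<odot>\<^bsub>V d\<^esub> X) = a \<odot>\<^bsub>N\<^esub> k X" . }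
  fix Y assume "Y \<in> carrier (V d)"
  then obtain g where g: "g \<in> carrier (S d)" "Y = cls d g" by (rule V_cases)
  have "k (X \<oplus>\<^bsub>V d\<^esub> Y) = k (cls d (f \<oplus>\<^bsub>S d\<^esub> g))" using linear_mapsD(2)[OF cls_lin f(1) g(1)] f(2) g(2) by simp
  also have "\<dots> = out N h d (f \<oplus>\<^bsub>S d\<^esub> g)" by (rule k) (use g f in simp)
  also have "\<dots> = k X \<oplus>\<^bsub>N\<^esub> k Y" using linear_mapsD(2)[OF out_lin f(1) g(1)] k f g by simp
  finally show "k (X \<oplus>\<^bsub>V d\<^esub> Y) = k X \<oplus>\<^bsub>N\<^esub> k Y" .
qed

end

context
  fixes w
  assumes w: "w \<in> Arr D"
begin

abbreviation "push \<equiv> \<lambda>(c, u). inn (Cod D w) (c, Comp D w u)"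

lemma push_lin: "i \<in> I (Dom D w) \<Longrightarrow> push i \<in> linear_maps R (Val L (fst i)) (S (Cod D w))"
  using inn_lin[of "(fst i, Comp D w (snd i))" "Cod D w"] comp_I[of "fst i" "snd i" "Dom D w" w] w
  by (simp add: case_prod_beta)

lemma cls_push_lin:
  "i \<in> I (Dom D w) \<Longrightarrow> (\<lambda>x. cls (Cod D w) (push i x)) \<in> linear_maps R (Val L (fst i)) (V (Cod D w))"
  by (rule linear_comp[OF push_lin cls_lin])

lemma w_Hom: "w \<in> Hom D (Dom D w) (Cod D w)" using w by (simp add: Hom_def)

lemma cls_push_compat:
  assumes "v \<in> Arr C" "u \<in> Hom D (fobj \<alpha> (Cod C v)) (Dom D w)" "x \<in> carrier (Val L (Dom C v))"
  shows "cls (Cod D w) (push (Dom C v, Comp D u (farr \<alpha> v)) x) = cls (Cod D w) (push (Cod C v, u) (Act L v x))"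
proof -
  have 1: "Comp D w (Comp D u (farr \<alpha> v)) = Comp D (Comp D w u) (farr \<alpha> v)"
    by (rule category.Comp_assoc[OF D f_arr[OF assms(1)] assms(2) w_Hom])
  have 2: "Comp D w u \<in> Hom D (fobj \<alpha> (Cod C v)) (Cod D w)"
    by (rule category.Comp_Hom[OF D assms(2) w_Hom])
  show ?thesis using cls_rel[OF assms(1) 2 assms(3)] by (simp add: 1)
qed

lemma push_out:
  assumes "f \<in> carrier (S (Dom D w))"
  shows "cls (Cod D w) (out (S (Cod D w)) push (Dom D w) f)
       = out (V (Cod D w)) (\<lambda>i x. cls (Cod D w) (push i x)) (Dom D w) f"
proof -
  have 1: "out (S (Cod D w)) push (Dom D w) \<in> linear_maps R (S (Dom D w)) (S (Cod D w))"
    unfolding ind_sum_def[where d = "Dom D w"] by (rule ds_out_linear[OF S_mod I_mod]) (use push_lin in simp_all)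
  have 2: "out (V (Cod D w)) (\<lambda>i x. cls (Cod D w) (push i x)) (Dom D w) \<in> linear_maps R (S (Dom D w)) (V (Cod D w))"
    by (rule out_lin[OF V_mod cls_push_lin cls_push_compat])
  have "(\<lambda>f. cls (Cod D w) (out (S (Cod D w)) push (Dom D w) f)) f
       = out (V (Cod D w)) (\<lambda>i x. cls (Cod D w) (push i x)) (Dom D w) f"
  proof (rule ds_linear_eq[where R = R and I = "I (Dom D w)" and M = "Val L \<circ> fst" and N = "V (Cod D w)"])
    show "(\<lambda>f. cls (Cod D w) (out (S (Cod D w)) push (Dom D w) f))
        \<in> linear_maps R (direct_sum (I (Dom D w)) (Val L \<circ> fst)) (V (Cod D w))"
      using linear_comp[OF 1 cls_lin] by (simp only: ind_sum_def)
    show "out (V (Cod D w)) (\<lambda>i x. cls (Cod D w) (push i x)) (Dom D w)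
        \<in> linear_maps R (direct_sum (I (Dom D w)) (Val L \<circ> fst)) (V (Cod D w))"
      using 2 by (simp only: ind_sum_def)
    fix i x assume i: "i \<in> I (Dom D w)" and x: "x \<in> carrier ((Val L \<circ> fst) i)"
    have "out (S (Cod D w)) push (Dom D w) (ds_in (I (Dom D w)) (Val L \<circ> fst) i x) = push i x"
      by (rule ds_out_in[where R = R and M = "Val L \<circ> fst" and h = push, OF S_mod I_mod _ i x])
        (use push_lin in simp_all)
    moreover have "out (V (Cod D w)) (\<lambda>i x. cls (Cod D w) (push i x)) (Dom D w)
        (ds_in (I (Dom D w)) (Val L \<circ> fst) i x) = cls (Cod D w) (push i x)"
      by (rule ds_out_in[where R = R and M = "Val L \<circ> fst" and h = "\<lambda>i x. cls (Cod D w) (push i x)",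
            OF V_mod I_mod _ i x]) (use cls_push_lin in simp_all)
    ultimately show "cls (Cod D w) (out (S (Cod D w)) push (Dom D w) (ds_in (I (Dom D w)) (Val L \<circ> fst) i x))
       = out (V (Cod D w)) (\<lambda>i x. cls (Cod D w) (push i x)) (Dom D w) (ds_in (I (Dom D w)) (Val L \<circ> fst) i x)"
      by simp
  qed (use V_mod I_mod assms in \<open>auto simp: ind_sum_def\<close>)
  then show ?thesis by simp
qed

lemma A_cls:
  assumes f: "f \<in> carrier (S (Dom D w))"
  shows "A w (cls (Dom D w) f) = out (V (Cod D w)) (\<lambda>i x. cls (Cod D w) (push i x)) (Dom D w) f"
proof -
  let ?h = "\<lambda>i x. cls (Cod D w) (push i x)"
  have self: "f \<in> cls (Dom D w) f" unfolding ind_class_def by (rule coset_self[OF S_mod H_sub f])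
  show ?thesis unfolding ind_Act_class
  proof (rule UN_constant_eq[OF self], rule ballI)
    fix z assume z: "z \<in> cls (Dom D w) f"
    have zc: "z \<in> carrier (S (Dom D w))"
      by (rule linear_coset(1)[OF S_mod V_mod H_sub out_lin[OF V_mod cls_push_lin cls_push_compat]
            out_H[OF V_mod cls_push_lin cls_push_compat] f]) (use z in \<open>simp_all add: ind_class_def\<close>)
    show "cls (Cod D w) (out (S (Cod D w)) push (Dom D w) z) = out (V (Cod D w)) ?h (Dom D w) f"
      unfolding push_out[OF zc] by (rule out_cls[OF V_mod cls_push_lin cls_push_compat f z])
  qed
qed

lemma A_lin: "A w \<in> linear_maps R (V (Dom D w)) (V (Cod D w))"
  by (rule descend_linear[OF V_mod cls_push_lin cls_push_compat A_cls])

lemma A_inn: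
  assumes "(c, u) \<in> I (Dom D w)" "x \<in> carrier (Val L c)"
  shows "A w (cls (Dom D w) (inn (Dom D w) (c, u) x)) = cls (Cod D w) (inn (Cod D w) (c, Comp D w u) x)"
proof -
  have x: "x \<in> carrier (Val L (fst (c, u)))" using assms by simp
  show ?thesis
    using A_cls[OF inn_carrier[OF assms(1) x]] out_inn[OF V_mod cls_push_lin cls_push_compat assms(1) x]
    by simp
qed

end

lemma ind_kmodule: "kmodule R D (ind R C D \<alpha> L)"
  unfolding kmodule_def
proof (intro conjI ballI impI)
  show "module R (V d)" for d by (rule V_mod)
  show "A w \<in> linear_maps R (V (Dom D w)) (V (Cod D w))" if "w \<in> Arr D" for w using that by (rule A_lin)
  { fix d X assume d: "d \<in> Obj D" and X: "X \<in> carrier (V d)"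
    have Id: "Id D d \<in> Arr D" "Dom D (Id D d) = d" "Cod D (Id D d) = d"
      using category.Id_Hom[OF D d] by (auto simp: Hom_def)
    show "A (Id D d) X = X"
    proof (rule V_linear_eq[where h = "\<lambda>X. X", OF V_mod _ _ _ X])
      show "A (Id D d) \<in> linear_maps R (V d) (V d)" using A_lin[OF Id(1)] Id(2,3) by simp
      show "(\<lambda>X. X) \<in> linear_maps R (V d) (V d)" by (rule linear_mapsI) simp_all
      fix i x assume i: "i \<in> I d" and x: "x \<in> carrier (Val L (fst i))"
      obtain c u where cu: "i = (c, u)" by (cases i)
      have "Comp D (Id D d) u = u" using i category.Id_Comp[OF D, of u "fobj \<alpha> c" d] by (simp add: cu I_iff)
      then show "A (Id D d) (cls d (inn d i x)) = cls d (inn d i x)"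
        using A_inn[OF Id(1), of c u x] Id(2,3) i x by (simp add: cu)
    qed }
  fix w w' X assume w: "w \<in> Arr D" and w': "w' \<in> Arr D" and eq: "Cod D w = Dom D w'"
    and X: "X \<in> carrier (V (Dom D w))"
  have comp: "Comp D w' w \<in> Hom D (Dom D w) (Cod D w')"
    using category.Comp_Hom[OF D, of w "Dom D w" "Cod D w" w' "Cod D w'"] w w' eq by (simp add: Hom_def)
  then have comp': "Comp D w' w \<in> Arr D" "Dom D (Comp D w' w) = Dom D w" "Cod D (Comp D w' w) = Cod D w'"
    by (auto simp: Hom_def)
  show "A (Comp D w' w) X = A w' (A w X)"
  proof (rule V_linear_eq[where h = "\<lambda>X. A w' (A w X)", OF V_mod[of "Cod D w'"] _ _ _ X])
    show "A (Comp D w' w) \<in> linear_maps R (V (Dom D w)) (V (Cod D w'))" using A_lin[OF comp'(1)] comp'(2,3) by simp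
    show "(\<lambda>X. A w' (A w X)) \<in> linear_maps R (V (Dom D w)) (V (Cod D w'))"
      using linear_comp[OF A_lin[OF w]] A_lin[OF w'] eq by simp
    fix i x assume i: "i \<in> I (Dom D w)" and x: "x \<in> carrier (Val L (fst i))"
    obtain c u where cu: "i = (c, u)" by (cases i)
    have 1: "Comp D (Comp D w' w) u = Comp D w' (Comp D w u)"
      using i category.Comp_assoc[OF D, of u "fobj \<alpha> c" "Dom D w" w "Cod D w" w' "Cod D w'"] w w' eq
      by (simp add: cu I_iff Hom_def)
    have 2: "(c, Comp D w u) \<in> I (Dom D w')" using comp_I[of c u "Dom D w" w "Cod D w"] i w eq by (simp add: cu)
    show "A (Comp D w' w) (cls (Dom D w) (inn (Dom D w) i x)) = A w' (A w (cls (Dom D w) (inn (Dom D w) i x)))"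
      using A_inn[OF comp'(1), of c u x] A_inn[OF w, of c u x] A_inn[OF w' 2, of x] comp' i x eq 1
      by (simp add: cu)
  qed
qed

abbreviation "unit \<equiv> ind_unit R C D \<alpha> L"

lemma unit_I: "c \<in> Obj C \<Longrightarrow> (c, Id D (fobj \<alpha> c)) \<in> I (fobj \<alpha> c)"
  unfolding I_iff using category.Id_Hom[OF D f_obj] by simp

lemma A_unit:
  assumes "(c, u) \<in> I d" "x \<in> carrier (Val L c)"
  shows "A u (unit c x) = cls d (inn d (c, u) x)"
proof -
  have c: "c \<in> Obj C" and u: "u \<in> Arr D" "Dom D u = fobj \<alpha> c" "Cod D u = d"
    using assms(1) by (auto simp: I_iff Hom_def)
  have "Comp D u (Id D (fobj \<alpha> c)) = u"
    using category.Comp_Id[OF D, of u "fobj \<alpha> c" d] u by (simp add: Hom_def)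
  then show ?thesis
    using A_inn[OF u(1), of c "Id D (fobj \<alpha> c)" x] unit_I[OF c] assms(2) u by (simp add: ind_unit_def)
qed

lemma kmodule_res:
  assumes "kmodule R D Y"
  shows "kmodule R C (res \<alpha> Y)"
  unfolding kmodule_def
proof (intro conjI ballI impI)
  show "module R (Val (res \<alpha> Y) c)" if "c \<in> Obj C" for c
    using assms f_obj[OF that] by (simp add: kmodule_def res_def)
  show "Act (res \<alpha> Y) u \<in> linear_maps R (Val (res \<alpha> Y) (Dom C u)) (Val (res \<alpha> Y) (Cod C u))"
    if "u \<in> Arr C" for u
  proof -
    have "farr \<alpha> u \<in> Arr D" "Dom D (farr \<alpha> u) = fobj \<alpha> (Dom C u)" "Cod D (farr \<alpha> u) = fobj \<alpha> (Cod C u)"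
      using f_arr[OF that] by (auto simp: Hom_def)
    moreover from this(1) have "Act Y (farr \<alpha> u)
        \<in> linear_maps R (Val Y (Dom D (farr \<alpha> u))) (Val Y (Cod D (farr \<alpha> u)))"
      using assms by (simp add: kmodule_def)
    ultimately show ?thesis by (simp add: res_def)
  qed
  show "Act (res \<alpha> Y) (Id C c) x = x" if "c \<in> Obj C" "x \<in> carrier (Val (res \<alpha> Y) c)" for c x
    using assms f_obj[OF that(1)] f_id[OF that(1)] that(2) by (simp add: kmodule_def res_def)
  show "Act (res \<alpha> Y) (Comp C v u) x = Act (res \<alpha> Y) v (Act (res \<alpha> Y) u x)"
    if "u \<in> Arr C" "v \<in> Arr C" "Cod C u = Dom C v" "x \<in> carrier (Val (res \<alpha> Y) (Dom C u))" for u v x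
    using assms \<alpha> f_arr[OF that(1)] f_arr[OF that(2)] that
    by (simp add: kmodule_def res_def is_functor_def Hom_def)
qed

lemma unit_hom: "kmod_hom R C L (res \<alpha> (ind R C D \<alpha> L)) unit"
  unfolding kmod_hom_def
proof (intro conjI ballI)
  show "kmodule R C L" by (rule L)
  show "kmodule R C (res \<alpha> (ind R C D \<alpha> L))" by (rule kmodule_res[OF ind_kmodule])
  show "unit c \<in> linear_maps R (Val L c) (Val (res \<alpha> (ind R C D \<alpha> L)) c)" if c: "c \<in> Obj C" for c
    using linear_comp[OF inn_lin[OF unit_I[OF c]] cls_lin] by (simp add: res_def ind_unit_def[abs_def])
  fix v x assume v: "v \<in> Arr C" and x: "x \<in> carrier (Val L (Dom C v))"
  have Lx: "Act L v x \<in> carrier (Val L (Cod C v))" using linear_mapsD(1)[OF L_act[OF v] x] .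
  have fv: "farr \<alpha> v \<in> Hom D (fobj \<alpha> (Dom C v)) (fobj \<alpha> (Cod C v))" by (rule f_arr[OF v])
  have idv: "Id D (fobj \<alpha> (Cod C v)) \<in> Hom D (fobj \<alpha> (Cod C v)) (fobj \<alpha> (Cod C v))"
    by (rule category.Id_Hom[OF D f_obj[OF Cod_C[OF v]]])
  have "A (farr \<alpha> v) (unit (Dom C v) x) = cls (fobj \<alpha> (Cod C v)) (inn (fobj \<alpha> (Cod C v)) (Dom C v, farr \<alpha> v) x)"
    by (rule A_unit) (use fv Dom_C[OF v] x in \<open>simp_all add: I_iff\<close>)
  also have "farr \<alpha> v = Comp D (Id D (fobj \<alpha> (Cod C v))) (farr \<alpha> v)"
    using category.Id_Comp[OF D fv] by simp
  also have "cls (fobj \<alpha> (Cod C v)) (inn (fobj \<alpha> (Cod C v)) (Dom C v, Comp D (Id D (fobj \<alpha> (Cod C v))) (farr \<alpha> v)) x)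
      = unit (Cod C v) (Act L v x)"
    unfolding ind_unit_def by (rule cls_rel[OF v idv x])
  finally show "unit (Cod C v) (Act L v x) = Act (res \<alpha> (ind R C D \<alpha> L)) v (unit (Dom C v) x)"
    using category.Id_Comp[OF D fv] by (simp add: res_def)
qed

context
  fixes Y :: "('p, 'b, 'r, 'n) cmod" and g :: "'o \<Rightarrow> 'm \<Rightarrow> 'n"
  assumes Y: "kmodule R D Y" and g: "kmod_hom R C L (res \<alpha> Y) g"
begin

abbreviation "adj \<equiv> ind_adj C D \<alpha> L Y g"
abbreviation "gg \<equiv> \<lambda>(c, u) x. Act Y u (g c x)"

lemma Y_mod: "d \<in> Obj D \<Longrightarrow> module R (Val Y d)"
  and Y_act: "w \<in> Arr D \<Longrightarrow> Act Y w \<in> linear_maps R (Val Y (Dom D w)) (Val Y (Cod D w))"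
  and Y_comp: "\<lbrakk>u \<in> Hom D a b; v \<in> Hom D b c; x \<in> carrier (Val Y a)\<rbrakk> \<Longrightarrow> Act Y (Comp D v u) x = Act Y v (Act Y u x)"
  using Y by (auto simp: kmodule_def Hom_def)

lemma g_lin: "c \<in> Obj C \<Longrightarrow> g c \<in> linear_maps R (Val L c) (Val Y (fobj \<alpha> c))"
  and g_nat: "\<lbrakk>v \<in> Arr C; x \<in> carrier (Val L (Dom C v))\<rbrakk> \<Longrightarrow> g (Cod C v) (Act L v x) = Act Y (farr \<alpha> v) (g (Dom C v) x)"
  using g by (auto simp: kmod_hom_def res_def)

lemma gg_lin: "i \<in> I d \<Longrightarrow> gg i \<in> linear_maps R (Val L (fst i)) (Val Y d)"
proof -
  assume i: "i \<in> I d"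
  obtain c u where cu: "i = (c, u)" by (cases i)
  have "c \<in> Obj C" "u \<in> Arr D" "Dom D u = fobj \<alpha> c" "Cod D u = d" using i by (auto simp: cu I_iff Hom_def)
  then show ?thesis using linear_comp[OF g_lin[of c], of "Act Y u" "Val Y d"] Y_act[of u] by (simp add: cu)
qed

lemma gg_compat:
  assumes "v \<in> Arr C" "u \<in> Hom D (fobj \<alpha> (Cod C v)) d" "x \<in> carrier (Val L (Dom C v))"
  shows "gg (Dom C v, Comp D u (farr \<alpha> v)) x = gg (Cod C v, u) (Act L v x)"
  using Y_comp[OF f_arr[OF assms(1)] assms(2) linear_mapsD(1)[OF g_lin[OF Dom_C[OF assms(1)]] assms(3)]]
    g_nat[OF assms(1,3)] by simp

lemma adj_cls: "\<lbrakk>d \<in> Obj D; f \<in> carrier (S d)\<rbrakk> \<Longrightarrow> adj d (cls d f) = out (Val Y d) gg d f"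
  unfolding ind_adj_def by (rule descend_the_elem[OF Y_mod gg_lin gg_compat])

lemma adj_lin: "d \<in> Obj D \<Longrightarrow> adj d \<in> linear_maps R (V d) (Val Y d)"
  by (rule descend_linear[OF Y_mod gg_lin gg_compat adj_cls])

lemma adj_inn:
  assumes "d \<in> Obj D" "(c, u) \<in> I d" "x \<in> carrier (Val L c)"
  shows "adj d (cls d (inn d (c, u) x)) = Act Y u (g c x)"
proof -
  have x: "x \<in> carrier (Val L (fst (c, u)))" using assms by simp
  show ?thesis
    using adj_cls[OF assms(1) inn_carrier[OF assms(2) x]]
      out_inn[OF Y_mod[OF assms(1)] gg_lin gg_compat assms(2) x] by simp
qed

lemma adj_hom: "kmod_hom R D (ind R C D \<alpha> L) Y adj"
  unfolding kmod_hom_def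
proof (intro conjI ballI)
  show "kmodule R D (ind R C D \<alpha> L)" by (rule ind_kmodule)
  show "kmodule R D Y" by (rule Y)
  show "adj d \<in> linear_maps R (V d) (Val Y d)" if "d \<in> Obj D" for d using that by (rule adj_lin)
  fix w X assume w: "w \<in> Arr D" and X: "X \<in> carrier (V (Dom D w))"
  have dom: "Dom D w \<in> Obj D" and cod: "Cod D w \<in> Obj D"
    using category.Dom_Obj[OF D w] category.Cod_Obj[OF D w] .
  show "adj (Cod D w) (A w X) = Act Y w (adj (Dom D w) X)"
  proof (rule V_linear_eq[where g = "\<lambda>X. adj (Cod D w) (A w X)" and h = "\<lambda>X. Act Y w (adj (Dom D w) X)",
        OF Y_mod[OF cod] _ _ _ X])
    show "(\<lambda>X. adj (Cod D w) (A w X)) \<in> linear_maps R (V (Dom D w)) (Val Y (Cod D w))"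
      by (rule linear_comp[OF A_lin[OF w] adj_lin[OF cod]])
    show "(\<lambda>X. Act Y w (adj (Dom D w) X)) \<in> linear_maps R (V (Dom D w)) (Val Y (Cod D w))"
      by (rule linear_comp[OF adj_lin[OF dom] Y_act[OF w]])
    fix i x assume i: "i \<in> I (Dom D w)" and x: "x \<in> carrier (Val L (fst i))"
    obtain c u where cu: "i = (c, u)" by (cases i)
    have iI: "(c, u) \<in> I (Dom D w)" and xc: "x \<in> carrier (Val L c)" using i x by (auto simp: cu)
    have iI': "(c, Comp D w u) \<in> I (Cod D w)" using comp_I[OF iI w] by simp
    have u: "c \<in> Obj C" "u \<in> Hom D (fobj \<alpha> c) (Dom D w)" using iI by (auto simp: I_iff)
    have gx: "g c x \<in> carrier (Val Y (fobj \<alpha> c))" by (rule linear_mapsD(1)[OF g_lin[OF u(1)] xc])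
    have wH: "w \<in> Hom D (Dom D w) (Cod D w)" using w by (simp add: Hom_def)
    show "adj (Cod D w) (A w (cls (Dom D w) (inn (Dom D w) i x))) = Act Y w (adj (Dom D w) (cls (Dom D w) (inn (Dom D w) i x)))"
      unfolding cu A_inn[OF w iI xc] adj_inn[OF cod iI' xc] adj_inn[OF dom iI xc]
      by (rule Y_comp[OF u(2) wH gx])
  qed
qed

lemma adj_unit:
  assumes "c \<in> Obj C" "x \<in> carrier (Val L c)"
  shows "adj (fobj \<alpha> c) (unit c x) = g c x"
  unfolding ind_unit_def adj_inn[OF f_obj[OF assms(1)] unit_I[OF assms(1)] assms(2)]
  using Y f_obj[OF assms(1)] linear_mapsD(1)[OF g_lin[OF assms(1)] assms(2)] by (simp add: kmodule_def)

lemma adj_unique: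
  assumes h: "kmod_hom R D (ind R C D \<alpha> L) Y h"
    and hu: "\<And>c x. \<lbrakk>c \<in> Obj C; x \<in> carrier (Val L c)\<rbrakk> \<Longrightarrow> h (fobj \<alpha> c) (unit c x) = g c x"
    and d: "d \<in> Obj D" and X: "X \<in> carrier (V d)"
  shows "h d X = adj d X"
proof (rule V_linear_eq[OF Y_mod[OF d] _ adj_lin[OF d] _ X])
  show "h d \<in> linear_maps R (V d) (Val Y d)" using h d by (simp add: kmod_hom_def)
  fix i x assume i: "i \<in> I d" and x: "x \<in> carrier (Val L (fst i))"
  obtain c u where cu: "i = (c, u)" by (cases i)
  have iI: "(c, u) \<in> I d" and xc: "x \<in> carrier (Val L c)" using i x by (auto simp: cu)
  have c: "c \<in> Obj C" and u: "u \<in> Arr D" "Dom D u = fobj \<alpha> c" "Cod D u = d" using iI by (auto simp: I_iff Hom_def)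
  have uc: "unit c x \<in> carrier (V (Dom D u))"
    using unit_hom c xc u linear_mapsD(1)[of "unit c" R "Val L c" "V (fobj \<alpha> c)"]
    by (simp add: kmod_hom_def res_def)
  have "h d (cls d (inn d (c, u) x)) = h d (A u (unit c x))" by (simp only: A_unit[OF iI xc])
  also have "\<dots> = Act Y u (h (fobj \<alpha> c) (unit c x))"
  proof -
    have "h (Cod D u) (A u (unit c x)) = Act Y u (h (Dom D u) (unit c x))"
      using h u(1) uc unfolding kmod_hom_def by blast
    then show ?thesis using u(2,3) by simp
  qed
  also have "\<dots> = adj d (cls d (inn d (c, u) x))" unfolding hu[OF c xc] adj_inn[OF d iI xc] ..
  finally show "h d (cls d (inn d i x)) = adj d (cls d (inn d i x))" by (simp add: cu)
qed

end

end

theorem ind_left_adjoint: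
  fixes Y :: "('p, 'b, 'r, 'n) cmod"
  assumes "cring R" "is_functor C D \<alpha>" "kmodule R C L" "kmodule R D Y"
    and "kmod_hom R C L (res \<alpha> Y) g"
  shows "kmod_hom R C L (res \<alpha> (ind R C D \<alpha> L)) (ind_unit R C D \<alpha> L)"
    and "kmod_hom R D (ind R C D \<alpha> L) Y (ind_adj C D \<alpha> L Y g)"
    and "\<lbrakk>c \<in> Obj C; x \<in> carrier (Val L c)\<rbrakk> \<Longrightarrow>
      ind_adj C D \<alpha> L Y g (fobj \<alpha> c) (ind_unit R C D \<alpha> L c x) = g c x"
    and "\<lbrakk>kmod_hom R D (ind R C D \<alpha> L) Y h;
      \<And>c x. \<lbrakk>c \<in> Obj C; x \<in> carrier (Val L c)\<rbrakk> \<Longrightarrow> h (fobj \<alpha> c) (ind_unit R C D \<alpha> L c x) = g c x;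
      d \<in> Obj D; X \<in> carrier (Val (ind R C D \<alpha> L) d)\<rbrakk> \<Longrightarrow> h d X = ind_adj C D \<alpha> L Y g d X"
proof -
  interpret ind_setting R C D \<alpha> L using assms(1-3) by (rule ind_setting.intro)
  show "kmod_hom R C L (res \<alpha> (ind R C D \<alpha> L)) (ind_unit R C D \<alpha> L)" by (rule unit_hom)
  show "kmod_hom R D (ind R C D \<alpha> L) Y (ind_adj C D \<alpha> L Y g)" using assms(4,5) by (rule adj_hom)
  show "ind_adj C D \<alpha> L Y g (fobj \<alpha> c) (ind_unit R C D \<alpha> L c x) = g c x"
    if "c \<in> Obj C" "x \<in> carrier (Val L c)" using assms(4,5) that by (rule adj_unit)
  show "h d X = ind_adj C D \<alpha> L Y g d X"
    if "kmod_hom R D (ind R C D \<alpha> L) Y h"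
      "\<And>c x. \<lbrakk>c \<in> Obj C; x \<in> carrier (Val L c)\<rbrakk> \<Longrightarrow> h (fobj \<alpha> c) (ind_unit R C D \<alpha> L c x) = g c x"
      "d \<in> Obj D" "X \<in> carrier (Val (ind R C D \<alpha> L) d)"
    using assms(4,5) that by (rule adj_unique)
qed

subsection \<open>Independence of the types of test objects\<close>

lemma kmod_homD:
  assumes "kmod_hom R C L M g"
  shows "kmodule R C L" "kmodule R C M" "c \<in> Obj C \<Longrightarrow> g c \<in> linear_maps R (Val L c) (Val M c)"
    and "\<lbrakk>u \<in> Arr C; x \<in> carrier (Val L (Dom C u))\<rbrakk> \<Longrightarrow> g (Cod C u) (Act L u x) = Act M u (g (Dom C u) x)"
  using assms by (auto simp: kmod_hom_def)

lemma kmoduleD: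
  assumes "kmodule R C L"
  shows "c \<in> Obj C \<Longrightarrow> module R (Val L c)"
    and "u \<in> Arr C \<Longrightarrow> Act L u \<in> linear_maps R (Val L (Dom C u)) (Val L (Cod C u))"
    and "\<lbrakk>c \<in> Obj C; x \<in> carrier (Val L c)\<rbrakk> \<Longrightarrow> Act L (Id C c) x = x"
    and "\<lbrakk>u \<in> Hom C a b; v \<in> Hom C b c; x \<in> carrier (Val L a)\<rbrakk> \<Longrightarrow> Act L (Comp C v u) x = Act L v (Act L u x)"
  using assms by (auto simp: kmodule_def Hom_def)

lemma kmod_hom_comp:
  assumes "category C" "kmod_hom R C K L g" "kmod_hom R C L M f"
  shows "kmod_hom R C K M (hcomp f g)"
  unfolding kmod_hom_def hcomp_def
proof (intro conjI ballI)
  show "(\<lambda>x. f c (g c x)) \<in> linear_maps R (Val K c) (Val M c)" if "c \<in> Obj C" for c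
    by (rule linear_comp[OF kmod_homD(3)[OF assms(2) that] kmod_homD(3)[OF assms(3) that]])
  show "f (Cod C u) (g (Cod C u) (Act K u x)) = Act M u (f (Dom C u) (g (Dom C u) x))"
    if "u \<in> Arr C" "x \<in> carrier (Val K (Dom C u))" for u x
    using kmod_homD(4)[OF assms(2) that] kmod_homD(4)[OF assms(3) that(1)]
      linear_mapsD(1)[OF kmod_homD(3)[OF assms(2) category.Dom_Obj[OF assms(1) that(1)]] that(2)] by simp
qed (use assms in \<open>auto dest: kmod_homD\<close>)

lemma image_submodule:
  assumes "module R M" "module R N" "h \<in> linear_maps R M N"
  shows "submodule (h ` carrier M) R N"
proof -
  interpret M: module R M by fact
  interpret N: module R N by fact
  show ?thesis
  proof (rule N.submoduleI)
    show "h ` carrier M \<subseteq> carrier N" using linear_mapsD(1)[OF assms(3)] by blast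
    show "\<zero>\<^bsub>N\<^esub> \<in> h ` carrier M"
      by (rule image_eqI[where f = h, OF linear_zero[OF assms, symmetric]]) simp
    fix a assume "a \<in> h ` carrier M"
    then obtain x where x: "x \<in> carrier M" "a = h x" by blast
    show "\<ominus>\<^bsub>N\<^esub> a \<in> h ` carrier M"
      unfolding x(2) by (rule image_eqI[where f = h, OF linear_neg[OF assms x(1), symmetric]]) (use x in simp)
    { fix b assume b: "b \<in> carrier R"
      show "b \<odot>\<^bsub>N\<^esub> a \<in> h ` carrier M"
        unfolding x(2) by (rule image_eqI[where f = h, OF linear_mapsD(3)[OF assms(3) b x(1), symmetric]]) (use b x in simp) }
    fix b assume "b \<in> h ` carrier M"
    then obtain y where y: "y \<in> carrier M" "b = h y" by blast
    show "a \<oplus>\<^bsub>N\<^esub> b \<in> h ` carrier M"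
      unfolding x(2) y(2) by (rule image_eqI[where f = h, OF linear_mapsD(2)[OF assms(3) x(1) y(1), symmetric]]) (use x y in simp)
  qed
qed

lemma image_kmod_kmodule:
  assumes C: "category C" and g: "kmod_hom R C L M g"
  shows "kmodule R C (image_kmod L M g)" and "kmod_hom R C (image_kmod L M g) M (\<lambda>c x. x)"
proof -
  note gD = kmod_homD[OF g]
  note L = kmoduleD[OF gD(1)] and M = kmoduleD[OF gD(2)]
  have car: "carrier (Val (image_kmod L M g) c) = g c ` carrier (Val L c)"
    and add: "x \<oplus>\<^bsub>Val (image_kmod L M g) c\<^esub> y = x \<oplus>\<^bsub>Val M c\<^esub> y"
    and smult: "a \<odot>\<^bsub>Val (image_kmod L M g) c\<^esub> y = a \<odot>\<^bsub>Val M c\<^esub> y"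
    and act: "Act (image_kmod L M g) u = Act M u" for c x y a u
    by (simp_all add: image_kmod_def)
  have sub: "g c ` carrier (Val L c) \<subseteq> carrier (Val M c)" if "c \<in> Obj C" for c
    using linear_mapsD(1)[OF gD(3)[OF that]] by blast
  show 1: "kmodule R C (image_kmod L M g)"
    unfolding kmodule_def
  proof (intro conjI ballI impI)
    show "module R (Val (image_kmod L M g) c)" if "c \<in> Obj C" for c
      using submodule.submodule_is_module[OF image_submodule[OF L(1)[OF that] M(1)[OF that] gD(3)[OF that]] M(1)[OF that]]
      by (simp add: image_kmod_def)
    show "Act (image_kmod L M g) u \<in> linear_maps R (Val (image_kmod L M g) (Dom C u)) (Val (image_kmod L M g) (Cod C u))"
      if u: "u \<in> Arr C" for u
    proof (rule linear_mapsI, unfold car add smult act)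
      fix x assume "x \<in> g (Dom C u) ` carrier (Val L (Dom C u))"
      then obtain y where y: "y \<in> carrier (Val L (Dom C u))" "x = g (Dom C u) y" by blast
      then show "Act M u x \<in> g (Cod C u) ` carrier (Val L (Cod C u))"
        using gD(4)[OF u y(1)] linear_mapsD(1)[OF L(2)[OF u] y(1)] by (metis image_eqI)
    qed (use linear_mapsD[OF M(2)[OF u]] sub[OF category.Dom_Obj[OF C u]] in blast)+
  qed (use M(3,4) sub category.Dom_Obj[OF C] in \<open>simp_all add: car act Hom_def subset_iff\<close>)
  show "kmod_hom R C (image_kmod L M g) M (\<lambda>c x. x)"
    unfolding kmod_hom_def using 1 gD(2) sub
    by (auto intro!: linear_mapsI linear_mapsD(1)[OF gD(3)] simp: car add smult act)
qed

theorem superfluous_epi_any: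
  assumes C: "category C" and f: "superfluous_epi R C L M f" and g: "kmod_hom R C K L g"
  shows "kmod_epi R C K L g \<longleftrightarrow> kmod_epi R C K M (hcomp f g)"
proof -
  let ?J = "image_kmod K L g"
  have fh: "kmod_hom R C L M f" using f by (simp add: superfluous_epi_def kmod_epi_def)
  note J = image_kmod_kmodule[OF C g]
  have "kmod_epi R C ?J L (\<lambda>c x. x) \<longleftrightarrow> kmod_epi R C ?J M (hcomp f (\<lambda>c x. x))"
    using f J(2) by (simp add: superfluous_epi_def)
  moreover have "kmod_epi R C ?J L (\<lambda>c x. x) \<longleftrightarrow> kmod_epi R C K L g"
    using J(2) g by (simp add: kmod_epi_def image_kmod_def)
  moreover have "kmod_epi R C ?J M (hcomp f (\<lambda>c x. x)) \<longleftrightarrow> kmod_epi R C K M (hcomp f g)"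
    using kmod_hom_comp[OF C J(2) fh] kmod_hom_comp[OF C g fh]
    by (simp add: kmod_epi_def image_kmod_def hcomp_def image_image)
  ultimately show ?thesis by blast
qed

text \<open>The free module on the elements of a module.\<close>

definition ring_mod :: "'r ring \<Rightarrow> ('r, 'r) module" where
  "ring_mod R = \<lparr>carrier = carrier R, mult = undefined, one = undefined, zero = \<zero>\<^bsub>R\<^esub>, add = add R, smult = mult R\<rparr>"

lemma ring_mod_module:
  assumes "cring R"
  shows "module R (ring_mod R)"
proof -
  interpret R: cring R by fact
  show ?thesis
  proof (rule moduleI)
    show "abelian_group (ring_mod R)"
      by (rule abelian_groupI)
        (auto simp: ring_mod_def R.a_ac intro: bexI[of _ "\<ominus>\<^bsub>R\<^esub> x" for x] R.l_neg)
  qed (auto simp: ring_mod_def R.l_distr R.r_distr R.m_assoc R.cring_axioms)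
qed

definition free_index :: "('o, 'a) cat \<Rightarrow> ('o, 'a, 'r, 'm) cmod \<Rightarrow> 'o \<Rightarrow> ('a \<times> 'm) set" where
  "free_index C P c = {(u, x). u \<in> Arr C \<and> Cod C u = c \<and> x \<in> carrier (Val P (Dom C u))}"

definition free_val :: "'r ring \<Rightarrow> ('o, 'a) cat \<Rightarrow> ('o, 'a, 'r, 'm) cmod \<Rightarrow> 'o \<Rightarrow> ('r, 'a \<times> 'm \<Rightarrow> 'r) module" where
  "free_val R C P c = direct_sum (free_index C P c) (\<lambda>_. ring_mod R)"

definition free_in :: "'r ring \<Rightarrow> ('o, 'a) cat \<Rightarrow> ('o, 'a, 'r, 'm) cmod \<Rightarrow> 'o \<Rightarrow> 'a \<times> 'm \<Rightarrow> 'r \<Rightarrow> 'a \<times> 'm \<Rightarrow> 'r" where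
  "free_in R C P c = ds_in (free_index C P c) (\<lambda>_. ring_mod R)"

definition free_out :: "'r ring \<Rightarrow> ('o, 'a) cat \<Rightarrow> ('o, 'a, 'r, 'm) cmod \<Rightarrow> 'o \<Rightarrow> ('r, 'n) module \<Rightarrow>
   ('a \<times> 'm \<Rightarrow> 'n) \<Rightarrow> ('a \<times> 'm \<Rightarrow> 'r) \<Rightarrow> 'n" where
  "free_out R C P c N k = ds_out (free_index C P c) (\<lambda>_. ring_mod R) N (\<lambda>i a. a \<odot>\<^bsub>N\<^esub> k i)"

definition free_kmod :: "'r ring \<Rightarrow> ('o, 'a) cat \<Rightarrow> ('o, 'a, 'r, 'm) cmod \<Rightarrow> ('o, 'a, 'r, 'a \<times> 'm \<Rightarrow> 'r) cmod" where
  "free_kmod R C P = \<lparr>Val = free_val R C P, Act = (\<lambda>w. free_out R C P (Dom C w) (free_val R C P (Cod C w))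
     (\<lambda>(u, x). free_in R C P (Cod C w) (Comp C w u, x) \<one>\<^bsub>R\<^esub>))\<rparr>"

locale free_setting =
  fixes R :: "'r ring" and C :: "('o, 'a) cat" and P :: "('o, 'a, 'r, 'm) cmod"
  assumes R: "cring R" and C: "category C" and P: "kmodule R C P"
begin

abbreviation "J \<equiv> free_index C P"
abbreviation "F \<equiv> free_val R C P"
abbreviation "FA \<equiv> Act (free_kmod R C P)"

lemma F_mod: "module R (F c)"
  unfolding free_val_def by (rule direct_sum_module[OF R ring_mod_module[OF R]])

lemma gen_carrier: "i \<in> J c \<Longrightarrow> free_in R C P c i \<one>\<^bsub>R\<^esub> \<in> carrier (F c)"
  unfolding free_in_def free_val_def
  by (rule linear_mapsD(1)[OF ds_in_linear[where R = R]])
    (use ring_mod_module[OF R] cring.axioms(1)[OF R] in \<open>auto simp: ring_mod_def intro: ring.ring_simprules(6)\<close>)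

context
  fixes N :: "('r, 'n) module" and k :: "'a \<times> 'm \<Rightarrow> 'n" and c :: 'o
  assumes N: "module R N" and k: "\<And>i. i \<in> J c \<Longrightarrow> k i \<in> carrier N"
begin

lemma k_lin: "i \<in> J c \<Longrightarrow> (\<lambda>a. a \<odot>\<^bsub>N\<^esub> k i) \<in> linear_maps R (ring_mod R) N"
proof -
  interpret N: module R N by (rule N)
  show "i \<in> J c \<Longrightarrow> (\<lambda>a. a \<odot>\<^bsub>N\<^esub> k i) \<in> linear_maps R (ring_mod R) N"
    by (rule linear_mapsI) (use k in \<open>simp_all add: ring_mod_def N.smult_l_distr N.smult_assoc1\<close>)
qed

lemma free_out_lin: "free_out R C P c N k \<in> linear_maps R (F c) N"
  unfolding free_out_def free_val_def by (rule ds_out_linear[OF N ring_mod_module[OF R] k_lin])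

lemma free_out_in: "i \<in> J c \<Longrightarrow> free_out R C P c N k (free_in R C P c i \<one>\<^bsub>R\<^esub>) = k i"
proof -
  interpret N: module R N by (rule N)
  assume i: "i \<in> J c"
  have "free_out R C P c N k (free_in R C P c i \<one>\<^bsub>R\<^esub>) = \<one>\<^bsub>R\<^esub> \<odot>\<^bsub>N\<^esub> k i"
    unfolding free_out_def free_in_def
    by (rule ds_out_in[where h = "\<lambda>i a. a \<odot>\<^bsub>N\<^esub> k i" and R = R, OF N ring_mod_module[OF R] k_lin i])
      (simp_all add: ring_mod_def)
  then show ?thesis using k[OF i] by simp
qed

end

lemma F_linear_eq:
  assumes N: "module R N" and g: "g \<in> linear_maps R (F c) N" and h: "h \<in> linear_maps R (F c) N"
    and eq: "\<And>i. i \<in> J c \<Longrightarrow> g (free_in R C P c i \<one>\<^bsub>R\<^esub>) = h (free_in R C P c i \<one>\<^bsub>R\<^esub>)"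
    and X: "X \<in> carrier (F c)"
  shows "g X = h X"
proof (rule ds_linear_eq[where R = R and I = "J c" and M = "\<lambda>_. ring_mod R" and N = N])
  interpret R: cring R by (rule R)
  fix i a assume i: "i \<in> J c" and a: "a \<in> carrier (ring_mod R)"
  have aR: "a \<in> carrier R" using a by (simp add: ring_mod_def)
  have "ds_in (J c) (\<lambda>_. ring_mod R) i (a \<odot>\<^bsub>ring_mod R\<^esub> \<one>\<^bsub>R\<^esub>) = a \<odot>\<^bsub>F c\<^esub> free_in R C P c i \<one>\<^bsub>R\<^esub>"
    unfolding free_val_def free_in_def
    by (rule linear_mapsD(3)[OF ds_in_linear[where R = R]])
      (use ring_mod_module[OF R] i aR in \<open>auto simp: ring_mod_def\<close>)
  then have e: "ds_in (J c) (\<lambda>_. ring_mod R) i a = a \<odot>\<^bsub>F c\<^esub> free_in R C P c i \<one>\<^bsub>R\<^esub>"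
    using aR by (simp add: ring_mod_def)
  show "g (ds_in (J c) (\<lambda>_. ring_mod R) i a) = h (ds_in (J c) (\<lambda>_. ring_mod R) i a)"
    unfolding e using linear_mapsD(3)[OF g aR gen_carrier[OF i]] linear_mapsD(3)[OF h aR gen_carrier[OF i]] eq[OF i]
    by simp
qed (use N g h X ring_mod_module[OF R] in \<open>auto simp: free_val_def\<close>)

lemma J_comp: "\<lbrakk>(u, x) \<in> J (Dom C w); w \<in> Arr C\<rbrakk> \<Longrightarrow> (Comp C w u, x) \<in> J (Cod C w)"
  using category.Comp_Hom[OF C, of u "Dom C u" "Dom C w" w "Cod C w"]
  by (auto simp: free_index_def Hom_def)

lemma FA_gen_carrier:
  "\<lbrakk>w \<in> Arr C; i \<in> J (Dom C w)\<rbrakk> \<Longrightarrow>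
    (\<lambda>(u, x). free_in R C P (Cod C w) (Comp C w u, x) \<one>\<^bsub>R\<^esub>) i \<in> carrier (F (Cod C w))"
  using gen_carrier[OF J_comp] by (cases i) simp

lemma FA_lin: "w \<in> Arr C \<Longrightarrow> FA w \<in> linear_maps R (F (Dom C w)) (F (Cod C w))"
  unfolding free_kmod_def using free_out_lin[OF F_mod FA_gen_carrier] by simp

lemma FA_in:
  assumes w: "w \<in> Arr C" and i: "(u, x) \<in> J (Dom C w)"
  shows "FA w (free_in R C P (Dom C w) (u, x) \<one>\<^bsub>R\<^esub>) = free_in R C P (Cod C w) (Comp C w u, x) \<one>\<^bsub>R\<^esub>"
  unfolding free_kmod_def using free_out_in[OF F_mod FA_gen_carrier[OF w] i] by simp

lemma free_kmodule: "kmodule R C (free_kmod R C P)"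
  unfolding kmodule_def
proof (intro conjI ballI impI)
  have V: "Val (free_kmod R C P) = F" by (simp add: free_kmod_def)
  show "module R (Val (free_kmod R C P) c)" for c unfolding V by (rule F_mod)
  show "FA w \<in> linear_maps R (Val (free_kmod R C P) (Dom C w)) (Val (free_kmod R C P) (Cod C w))"
    if "w \<in> Arr C" for w unfolding V by (rule FA_lin[OF that])
  { fix c X assume c: "c \<in> Obj C" and X: "X \<in> carrier (Val (free_kmod R C P) c)"
    have Id: "Id C c \<in> Arr C" "Dom C (Id C c) = c" "Cod C (Id C c) = c"
      using category.Id_Hom[OF C c] by (auto simp: Hom_def)
    show "FA (Id C c) X = X"
    proof (rule F_linear_eq[where h = "\<lambda>X. X", OF F_mod[of c] _ _ _ X[unfolded V]])
      show "FA (Id C c) \<in> linear_maps R (F c) (F c)" using FA_lin[OF Id(1)] Id by simp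
      show "(\<lambda>X. X) \<in> linear_maps R (F c) (F c)" by (rule linear_mapsI) simp_all
      fix i assume i: "i \<in> J c"
      obtain u x where ux: "i = (u, x)" by (cases i)
      have "Comp C (Id C c) u = u"
        using i category.Id_Comp[OF C, of u "Dom C u" c] by (simp add: ux free_index_def Hom_def)
      then show "FA (Id C c) (free_in R C P c i \<one>\<^bsub>R\<^esub>) = free_in R C P c i \<one>\<^bsub>R\<^esub>"
        using FA_in[OF Id(1), of u x] Id i by (simp add: ux)
    qed }
  fix w w' X assume w: "w \<in> Arr C" and w': "w' \<in> Arr C" and eq: "Cod C w = Dom C w'"
    and X: "X \<in> carrier (Val (free_kmod R C P) (Dom C w))"
  have "Comp C w' w \<in> Hom C (Dom C w) (Cod C w')"
    using category.Comp_Hom[OF C, of w "Dom C w" "Cod C w" w' "Cod C w'"] w w' eq by (simp add: Hom_def)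
  then have comp: "Comp C w' w \<in> Arr C" "Dom C (Comp C w' w) = Dom C w" "Cod C (Comp C w' w) = Cod C w'"
    by (auto simp: Hom_def)
  show "FA (Comp C w' w) X = FA w' (FA w X)"
  proof (rule F_linear_eq[where h = "\<lambda>X. FA w' (FA w X)", OF F_mod[of "Cod C w'"] _ _ _ X[unfolded V]])
    show "FA (Comp C w' w) \<in> linear_maps R (F (Dom C w)) (F (Cod C w'))" using FA_lin[OF comp(1)] comp by simp
    show "(\<lambda>X. FA w' (FA w X)) \<in> linear_maps R (F (Dom C w)) (F (Cod C w'))"
      using linear_comp[OF FA_lin[OF w]] FA_lin[OF w'] eq by simp
    fix i assume i: "i \<in> J (Dom C w)"
    obtain u x where ux: "i = (u, x)" by (cases i)
    have 1: "Comp C (Comp C w' w) u = Comp C w' (Comp C w u)"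
      using i category.Comp_assoc[OF C, of u "Dom C u" "Dom C w" w "Cod C w" w' "Cod C w'"] w w' eq
      by (simp add: ux free_index_def Hom_def)
    have 2: "(Comp C w u, x) \<in> J (Dom C w')" using J_comp[of u x w] i w eq by (simp add: ux)
    show "FA (Comp C w' w) (free_in R C P (Dom C w) i \<one>\<^bsub>R\<^esub>) = FA w' (FA w (free_in R C P (Dom C w) i \<one>\<^bsub>R\<^esub>))"
      using FA_in[OF comp(1), of u x] FA_in[OF w, of u x] FA_in[OF w' 2] comp i eq 1 by (simp add: ux)
  qed
qed

context
  fixes Y :: "('o, 'a, 'r, 'n) cmod" and \<phi> :: "'o \<Rightarrow> 'm \<Rightarrow> 'n"
  assumes Y: "kmodule R C Y"
    and \<phi>: "\<And>c x. \<lbrakk>c \<in> Obj C; x \<in> carrier (Val P c)\<rbrakk> \<Longrightarrow> \<phi> c x \<in> carrier (Val Y c)"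
begin

definition ext :: "'o \<Rightarrow> ('a \<times> 'm \<Rightarrow> 'r) \<Rightarrow> 'n" where
  "ext c = free_out R C P c (Val Y c) (\<lambda>(u, x). Act Y u (\<phi> (Dom C u) x))"

lemma ext_gen: "i \<in> J c \<Longrightarrow> (\<lambda>(u, x). Act Y u (\<phi> (Dom C u) x)) i \<in> carrier (Val Y c)"
  using linear_mapsD(1)[OF kmoduleD(2)[OF Y]] \<phi> category.Dom_Obj[OF C] by (auto simp: free_index_def)

lemma ext_lin: "c \<in> Obj C \<Longrightarrow> ext c \<in> linear_maps R (F c) (Val Y c)"
  unfolding ext_def by (rule free_out_lin[OF kmoduleD(1)[OF Y] ext_gen])

lemma ext_in: "\<lbrakk>c \<in> Obj C; (u, x) \<in> J c\<rbrakk> \<Longrightarrow> ext c (free_in R C P c (u, x) \<one>\<^bsub>R\<^esub>) = Act Y u (\<phi> (Dom C u) x)"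
  unfolding ext_def using free_out_in[OF kmoduleD(1)[OF Y] ext_gen] by simp

lemma ext_hom: "kmod_hom R C (free_kmod R C P) Y ext"
  unfolding kmod_hom_def
proof (intro conjI ballI)
  show "kmodule R C (free_kmod R C P)" by (rule free_kmodule)
  show "kmodule R C Y" by (rule Y)
  have V: "Val (free_kmod R C P) = F" by (simp add: free_kmod_def)
  show "ext c \<in> linear_maps R (Val (free_kmod R C P) c) (Val Y c)" if "c \<in> Obj C" for c
    unfolding V by (rule ext_lin[OF that])
  fix w X assume w: "w \<in> Arr C" and X: "X \<in> carrier (Val (free_kmod R C P) (Dom C w))"
  have dom: "Dom C w \<in> Obj C" and cod: "Cod C w \<in> Obj C"
    using category.Dom_Obj[OF C w] category.Cod_Obj[OF C w] .
  show "ext (Cod C w) (FA w X) = Act Y w (ext (Dom C w) X)"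
  proof (rule F_linear_eq[where g = "\<lambda>X. ext (Cod C w) (FA w X)" and h = "\<lambda>X. Act Y w (ext (Dom C w) X)",
        OF kmoduleD(1)[OF Y cod] _ _ _ X[unfolded V]])
    show "(\<lambda>X. ext (Cod C w) (FA w X)) \<in> linear_maps R (F (Dom C w)) (Val Y (Cod C w))"
      by (rule linear_comp[OF FA_lin[OF w] ext_lin[OF cod]])
    show "(\<lambda>X. Act Y w (ext (Dom C w) X)) \<in> linear_maps R (F (Dom C w)) (Val Y (Cod C w))"
      by (rule linear_comp[OF ext_lin[OF dom] kmoduleD(2)[OF Y w]])
    fix i assume i: "i \<in> J (Dom C w)"
    obtain u x where ux: "i = (u, x)" by (cases i)
    have iJ: "(u, x) \<in> J (Dom C w)" using i ux by simp
    then have u: "u \<in> Hom C (Dom C u) (Dom C w)" "x \<in> carrier (Val P (Dom C u))"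
      by (auto simp: free_index_def Hom_def)
    have wH: "w \<in> Hom C (Dom C w) (Cod C w)" using w by (simp add: Hom_def)
    have "Dom C (Comp C w u) = Dom C u" using category.Comp_Hom[OF C u(1) wH] by (simp add: Hom_def)
    moreover have "\<phi> (Dom C u) x \<in> carrier (Val Y (Dom C u))"
      by (rule \<phi>) (use u category.Dom_Obj[OF C] in \<open>auto simp: Hom_def\<close>)
    ultimately show "ext (Cod C w) (FA w (free_in R C P (Dom C w) i \<one>\<^bsub>R\<^esub>))
        = Act Y w (ext (Dom C w) (free_in R C P (Dom C w) i \<one>\<^bsub>R\<^esub>))"
      unfolding ux FA_in[OF w iJ] ext_in[OF cod J_comp[OF iJ w]] ext_in[OF dom iJ]
      using kmoduleD(4)[OF Y u(1) wH] by simp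
  qed
qed

end

end

theorem projective_any:
  fixes C :: "('o, 'a) cat" and R :: "'r ring" and P :: "('o, 'a, 'r, 'm) cmod"
  assumes R: "cring R" and C: "category C" and proj: "projective R C P"
    and g: "kmod_epi R C L K g" and h: "kmod_hom R C P K h"
  shows "\<exists>k. kmod_hom R C P L k \<and> (\<forall>c \<in> Obj C. \<forall>x \<in> carrier (Val P c). g c (k c x) = h c x)"
proof -
  have Pm: "kmodule R C P" using proj by (simp add: projective_def)
  interpret free_setting R C P by (rule free_setting.intro[OF R C Pm])
  have gh: "kmod_hom R C L K g" and gs: "\<And>c. c \<in> Obj C \<Longrightarrow> g c ` carrier (Val L c) = carrier (Val K c)"
    using g by (auto simp: kmod_epi_def)
  note Lm = kmod_homD(1)[OF gh] and Km = kmod_homD(2)[OF gh]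
  define ev where "ev = ext P (\<lambda>c x. x)"
  have ev: "kmod_hom R C (free_kmod R C P) P ev" unfolding ev_def by (rule ext_hom[OF Pm])
  have V: "Val (free_kmod R C P) = F" by (simp add: free_kmod_def)
  have "kmod_epi R C (free_kmod R C P) P ev"
    unfolding kmod_epi_def
  proof (intro conjI ballI ev subset_antisym subsetI)
    fix c x assume c: "c \<in> Obj C"
    { assume "x \<in> ev c ` carrier (Val (free_kmod R C P) c)"
      then show "x \<in> carrier (Val P c)" using linear_mapsD(1)[OF kmod_homD(3)[OF ev c]] by blast }
    assume x: "x \<in> carrier (Val P c)"
    have Id: "Id C c \<in> Arr C" "Dom C (Id C c) = c" "Cod C (Id C c) = c"
      using category.Id_Hom[OF C c] by (auto simp: Hom_def)
    have i: "(Id C c, x) \<in> J c" using Id x by (simp add: free_index_def)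
    have "ev c (free_in R C P c (Id C c, x) \<one>\<^bsub>R\<^esub>) = x"
      unfolding ev_def using ext_in[OF Pm _ c i, of "\<lambda>c x. x"] kmoduleD(3)[OF Pm c x] by simp
    then show "x \<in> ev c ` carrier (Val (free_kmod R C P) c)" using gen_carrier[OF i] V by (metis image_eqI)
  qed
  note epi = this
  have id: "kmod_hom R C P P (\<lambda>c x. x)"
    using Pm by (auto simp: kmod_hom_def intro!: linear_mapsI)
  have lift:  "\<exists>k. kmod_hom R C P L' k \<and> (\<forall>c \<in> Obj C. \<forall>x \<in> carrier (Val P c). g' c (k c x) = h' c x)"
    if "kmod_epi R C L' K' g'" "kmod_hom R C P K' h'"
    for L' :: "('o, 'a, 'r, 'a \<times> 'm \<Rightarrow> 'r) cmod" and K' :: "('o, 'a, 'r, 'm) cmod" and g' h'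
    using proj[unfolded projective_def, THEN conjunct2, rule_format, OF conjI[OF that]] .
  have "\<exists>k. kmod_hom R C P (free_kmod R C P) k \<and> (\<forall>c \<in> Obj C. \<forall>x \<in> carrier (Val P c). ev c (k c x) = x)"
    by (rule lift[OF epi id])
  then obtain s where s: "kmod_hom R C P (free_kmod R C P) s"
    and evs: "\<And>c x. \<lbrakk>c \<in> Obj C; x \<in> carrier (Val P c)\<rbrakk> \<Longrightarrow> ev c (s c x) = x"
    by blast
  define \<phi> where "\<phi> = (\<lambda>c x. SOME y. y \<in> carrier (Val L c) \<and> g c y = h c x)"
  have \<phi>: "\<phi> c x \<in> carrier (Val L c) \<and> g c (\<phi> c x) = h c x" if "c \<in> Obj C" "x \<in> carrier (Val P c)" for c x
    unfolding \<phi>_def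
  proof (rule someI_ex)
    have "h c x \<in> g c ` carrier (Val L c)"
      using gs[OF that(1)] linear_mapsD(1)[OF kmod_homD(3)[OF h that(1)] that(2)] by simp
    then show "\<exists>y. y \<in> carrier (Val L c) \<and> g c y = h c x" by auto
  qed
  note \<phi>c = \<phi>[THEN conjunct1] and g\<phi> = \<phi>[THEN conjunct2]
  define e where "e = ext L \<phi>"
  have e: "kmod_hom R C (free_kmod R C P) L e" unfolding e_def by (rule ext_hom[OF Lm \<phi>c])
  have ge: "g c (e c X) = h c (ev c X)" if c: "c \<in> Obj C" and X: "X \<in> carrier (F c)" for c X
  proof (rule F_linear_eq[where g = "\<lambda>X. g c (e c X)" and h = "\<lambda>X. h c (ev c X)", OF kmoduleD(1)[OF Km c] _ _ _ X])
    show "(\<lambda>X. g c (e c X)) \<in> linear_maps R (F c) (Val K c)"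
      using linear_comp[OF kmod_homD(3)[OF e c] kmod_homD(3)[OF gh c]] by (simp add: V)
    show "(\<lambda>X. h c (ev c X)) \<in> linear_maps R (F c) (Val K c)"
      using linear_comp[OF kmod_homD(3)[OF ev c] kmod_homD(3)[OF h c]] by (simp add: V)
    fix i assume i: "i \<in> J c"
    obtain u x where ux: "i = (u, x)" by (cases i)
    have u: "u \<in> Arr C" "Cod C u = c" "x \<in> carrier (Val P (Dom C u))" and iJ: "(u, x) \<in> J c"
      using i by (auto simp: ux free_index_def)
    have d: "Dom C u \<in> Obj C" by (rule category.Dom_Obj[OF C u(1)])
    have "g c (Act L u (\<phi> (Dom C u) x)) = Act K u (g (Dom C u) (\<phi> (Dom C u) x))"
      using kmod_homD(4)[OF gh u(1) \<phi>c[OF d u(3)]] u(2) by simp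
    also have "\<dots> = h c (Act P u x)"
      using g\<phi>[OF d u(3)] kmod_homD(4)[OF h u(1,3)] u(2) by simp
    finally show "g c (e c (free_in R C P c i \<one>\<^bsub>R\<^esub>)) = h c (ev c (free_in R C P c i \<one>\<^bsub>R\<^esub>))"
      unfolding ux e_def ev_def using ext_in[OF Lm \<phi>c c iJ] ext_in[OF Pm _ c iJ, of "\<lambda>c x. x"] by simp
  qed
  have "kmod_hom R C P L (hcomp e s)" by (rule kmod_hom_comp[OF C s e])
  moreover have "g c (hcomp e s c x) = h c x" if "c \<in> Obj C" "x \<in> carrier (Val P c)" for c x
    using ge[OF that(1), of "s c x"] evs[OF that] linear_mapsD(1)[OF kmod_homD(3)[OF s that(1)] that(2)]
    by (simp add: hcomp_def V)
  ultimately show ?thesis by blast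
qed

end

theory Submission
  imports Defs
begin

text \<open>The two halves of the statement are symmetric: both \<open>\<C>' \<rightarrow> \<C>\<close> and the composite
  \<open>\<C>' \<rightarrow> \<D>' \<rightarrow> \<D>\<close> are fully faithful functors \<open>F: \<B> \<rightarrow> \<E>\<close> into an EI category whose essential image
  contains the minimal support of a minimal resolution \<open>P\<^sub>\<bullet> \<rightarrow> M\<close>. The locale
  \<open>minimal_support_functor\<close> collects what follows for one such functor, and the theorem
  compares two instances of it over the same category \<open>\<C>'\<close>.

  A submodule of \<open>P\<^sub>0\<close> that maps onto \<open>M\<close> is all of \<open>P\<^sub>0\<close>; taking the elements of \<open>P\<^sub>0\<close> over
  \<open>\<up>supp(M)\<close> shows that \<open>P\<^sub>0\<close>, and inductively every \<open>P\<^sub>n\<close>, is supported there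
  (\<open>minimal_resolution_supp\<close>). As this set is Artinian, an argument in the style of Nakayama's
  lemma applies: \<open>P\<^sub>n\<close> is generated by its values on its minimal support, hence by those on the
  image of \<open>F\<close> (\<open>generated_along_minsupp\<close>). Everything else is a consequence of this.

  \<^item> The counit \<open>ind res P\<^sub>n \<rightarrow> P\<^sub>n\<close> is onto because its image contains the generating values. It
    splits because \<open>P\<^sub>n\<close> is projective, and the section is onto because the unit of a fully faithful
    functor is invertible and \<open>ind\<close> of anything is generated along \<open>F\<close> (\<open>counit_iso\<close>).
  \<^item> Lifting problems for \<open>res P\<^sub>n\<close> can therefore be solved after applying \<open>ind\<close>
    (\<open>res_lifting\<close>), so \<open>res P\<^sub>\<bullet> \<rightarrow> res M\<close> is again a resolution by projectives.
  \<^item> It is again minimal: a submodule of \<open>res P\<^sub>n\<close> extends to a submodule of \<open>P\<^sub>n\<close>, to which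
    superfluousness applies (\<open>essential_restrict\<close>).
  \<^item> The splitting of \<open>P\<^sub>n\<close> at \<open>F(b)\<close> vanishes exactly if that of \<open>res P\<^sub>n\<close> at \<open>b\<close> does
    (\<open>splitting_res_zero_iff\<close>).

  Over \<open>\<C>'\<close> there are then two minimal projective resolutions of isomorphic modules. Lifts of \<open>f\<close>
  exist, and minimality makes each of them an isomorphism (\<open>lifts_iso\<close>). Applying \<open>ind\<close> and the
  inverse of the counit yields the isomorphism of complexes. Comparing the splittings over \<open>\<C>'\<close>
  shows that \<open>\<alpha>\<close> matches the objects of the two Betti categories, and each of these categories is
  equivalent to its trace on the subcategory, because the Betti objects have representatives there.\<close>

section \<open>Isomorphisms and equivalences of categories\<close>

lemma HomD: "u \<in> Hom C a b \<Longrightarrow> u \<in> Arr C \<and> Dom C u = a \<and> Cod C u = b"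
  by (simp add: Hom_def)

lemma Arr_Hom: "u \<in> Arr C \<Longrightarrow> u \<in> Hom C (Dom C u) (Cod C u)"
  by (simp add: Hom_def)

lemma Hom_Obj:
  assumes "category C" "u \<in> Hom C a b"
  shows "a \<in> Obj C" "b \<in> Obj C"
  using assms category.Dom_Obj category.Cod_Obj by (fastforce simp: Hom_def)+

lemma iso_arrI:
  assumes "u \<in> Hom C a b" "v \<in> Hom C b a" "Comp C v u = Id C a" "Comp C u v = Id C b"
  shows "iso_arr C u"
  using assms by (auto simp: iso_arr_def Hom_def)

lemma iso_arrE:
  assumes "iso_arr C u" "u \<in> Hom C a b"
  obtains v where "v \<in> Hom C b a" "Comp C v u = Id C a" "Comp C u v = Id C b" "iso_arr C v"
proof -
  obtain v where v: "v \<in> Hom C b a" "Comp C v u = Id C a" "Comp C u v = Id C b"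
    using assms by (auto simp: iso_arr_def Hom_def)
  with that iso_arrI[OF v(1) assms(2)] show thesis by blast
qed

lemma iso_arr_Id: "\<lbrakk>category C; a \<in> Obj C\<rbrakk> \<Longrightarrow> iso_arr C (Id C a)"
  by (meson category.Comp_Id category.Id_Hom iso_arrI)

lemma Comp_cancel_left:
  assumes C: "category C" and u: "u \<in> Hom C a b" and v: "v \<in> Hom C b c" and w: "w \<in> Hom C c b"
    and wv: "Comp C w v = Id C b"
  shows "Comp C w (Comp C v u) = u"
  using category.Comp_assoc[OF C u v w] category.Id_Comp[OF C u] wv by simp

lemma Comp_cancel_right:
  assumes C: "category C" and u: "u \<in> Hom C b c" and v: "v \<in> Hom C a b" and w: "w \<in> Hom C b a"
    and vw: "Comp C v w = Id C b"
  shows "Comp C (Comp C u v) w = u"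
  using category.Comp_assoc[OF C w v u] category.Comp_Id[OF C u] vw by simp

lemma iso_arr_Comp:
  assumes C: "category C" and u: "u \<in> Hom C a b" "iso_arr C u" and v: "v \<in> Hom C b c" "iso_arr C v"
  shows "iso_arr C (Comp C v u)"
proof -
  obtain u' where u': "u' \<in> Hom C b a" "Comp C u' u = Id C a" "Comp C u u' = Id C b"
    using iso_arrE[OF u(2,1)] by metis
  obtain v' where v': "v' \<in> Hom C c b" "Comp C v' v = Id C b" "Comp C v v' = Id C c"
    using iso_arrE[OF v(2,1)] by metis
  note cmp = category.Comp_Hom[OF C]
  show ?thesis
  proof (rule iso_arrI[OF cmp[OF u(1) v(1)] cmp[OF v'(1) u'(1)]])
    have "Comp C (Comp C u' v') (Comp C v u) = Comp C u' (Comp C v' (Comp C v u))"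
      by (rule category.Comp_assoc[OF C cmp[OF u(1) v(1)] v'(1) u'(1), symmetric])
    then show "Comp C (Comp C u' v') (Comp C v u) = Id C a"
      using Comp_cancel_left[OF C u(1) v(1) v'(1,2)] u'(2) by simp
    have "Comp C (Comp C v u) (Comp C u' v') = Comp C v (Comp C u (Comp C u' v'))"
      by (rule category.Comp_assoc[OF C cmp[OF v'(1) u'(1)] u(1) v(1), symmetric])
    then show "Comp C (Comp C v u) (Comp C u' v') = Id C c"
      using Comp_cancel_left[OF C v'(1) u'(1) u(1) u'(3)] v'(3) by simp
  qed
qed

lemma cl_eq_iff:
  assumes C: "category C" and c: "c \<in> Obj C" and d: "d \<in> Obj C"
  shows "cl C c = cl C d \<longleftrightarrow> (\<exists>u \<in> Hom C c d. iso_arr C u)"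
proof
  assume "cl C c = cl C d"
  moreover have "d \<in> cl C d"
    using d category.Id_Hom[OF C d] iso_arr_Id[OF C d] by (auto simp: cl_def)
  ultimately have "d \<in> cl C c" by simp
  then show "\<exists>u \<in> Hom C c d. iso_arr C u" by (simp add: cl_def)
next
  have sub: "cl C d \<subseteq> cl C c" if "u \<in> Hom C c d" "iso_arr C u" for u c d
    unfolding cl_def using that category.Comp_Hom[OF C that(1)] iso_arr_Comp[OF C that] by blast
  assume "\<exists>u \<in> Hom C c d. iso_arr C u"
  then show "cl C c = cl C d" using sub iso_arrE by (metis subset_antisym)
qed

text \<open>Both composites with an arrow back are endomorphisms, hence invertible.\<close>

lemma EI_iso:
  assumes EI: "EI_category C" and u: "u \<in> Hom C a b" and w: "w \<in> Hom C b a"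
  shows "iso_arr C u"
proof -
  have C: "category C" using EI by (simp add: EI_category_def)
  note ab = Hom_Obj[OF C u] and cmp = category.Comp_Hom[OF C]
  have wu: "Comp C w u \<in> Hom C a a" and uw: "Comp C u w \<in> Hom C b b"
    using cmp[OF u w] cmp[OF w u] .
  have "iso_arr C (Comp C w u)" "iso_arr C (Comp C u w)"
    using EI ab wu uw by (auto simp: EI_category_def)
  then obtain p q where p: "p \<in> Hom C a a" "Comp C p (Comp C w u) = Id C a"
    and q: "q \<in> Hom C b b" "Comp C (Comp C u w) q = Id C b"
    using iso_arrE[OF _ wu] iso_arrE[OF _ uw] by metis
  let ?l = "Comp C p w" and ?r = "Comp C w q"
  have l: "?l \<in> Hom C b a" and r: "?r \<in> Hom C b a" using cmp[OF w p(1)] cmp[OF q(1) w] .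
  have lu: "Comp C ?l u = Id C a" using category.Comp_assoc[OF C u w p(1)] p(2) by simp
  have ur: "Comp C u ?r = Id C b" using category.Comp_assoc[OF C q(1) w u] q(2) by simp
  \<comment> \<open>a left and a right inverse of the same arrow agree\<close>
  have "?l = ?r"
    using category.Comp_assoc[OF C r u l] lu ur category.Id_Comp[OF C r] category.Comp_Id[OF C l] by simp
  then show ?thesis using iso_arrI[OF u l lu] ur by simp
qed

text \<open>If \<open>w \<circ> v\<close> has an inverse \<open>z\<close>, then \<open>v \<circ> z\<close> and \<open>z \<circ> w\<close> run back along \<open>w\<close> and \<open>v\<close>.\<close>

lemma EI_iso_factors:
  assumes EI: "EI_category C" and v: "v \<in> Hom C a b" and w: "w \<in> Hom C b c"
    and iso: "iso_arr C (Comp C w v)"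
  shows "iso_arr C w" "iso_arr C v"
proof -
  have C: "category C" using EI by (simp add: EI_category_def)
  note cmp = category.Comp_Hom[OF C]
  obtain z where z: "z \<in> Hom C c a" using iso_arrE[OF iso cmp[OF v w]] by metis
  show "iso_arr C w" by (rule EI_iso[OF EI w cmp[OF z v]])
  show "iso_arr C v" by (rule EI_iso[OF EI v cmp[OF w z]])
qed

definition fully_faithful :: "('o, 'a) cat \<Rightarrow> ('p, 'b) cat \<Rightarrow> ('o, 'a, 'p, 'b) catfun \<Rightarrow> bool" where
  "fully_faithful B D F \<longleftrightarrow> is_functor B D F \<and> (\<forall>a \<in> Obj B. \<forall>b \<in> Obj B.
     bij_betw (farr F) (Hom B a b) (Hom D (fobj F a) (fobj F b)))"

definition ess_surj :: "('o, 'a) cat \<Rightarrow> ('p, 'b) cat \<Rightarrow> ('o, 'a, 'p, 'b) catfun \<Rightarrow> bool" where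
  "ess_surj B D F \<longleftrightarrow> (\<forall>d \<in> Obj D. \<exists>b \<in> Obj B. \<exists>u \<in> Hom D (fobj F b) d. iso_arr D u)"

lemma functorD:
  assumes "is_functor B D F"
  shows "category B" "category D" "b \<in> Obj B \<Longrightarrow> fobj F b \<in> Obj D"
    and "u \<in> Hom B a b \<Longrightarrow> farr F u \<in> Hom D (fobj F a) (fobj F b)"
    and "b \<in> Obj B \<Longrightarrow> farr F (Id B b) = Id D (fobj F b)"
    and "\<lbrakk>u \<in> Hom B a b; v \<in> Hom B b c\<rbrakk> \<Longrightarrow> farr F (Comp B v u) = Comp D (farr F v) (farr F u)"
  using assms by (auto simp: is_functor_def Hom_def)

lemma functorI:
  assumes "category B" "category D" "\<And>b. b \<in> Obj B \<Longrightarrow> fobj F b \<in> Obj D"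
    and "\<And>u a b. u \<in> Hom B a b \<Longrightarrow> farr F u \<in> Hom D (fobj F a) (fobj F b)"
    and "\<And>b. b \<in> Obj B \<Longrightarrow> farr F (Id B b) = Id D (fobj F b)"
    and "\<And>u v a b c. \<lbrakk>u \<in> Hom B a b; v \<in> Hom B b c\<rbrakk> \<Longrightarrow> farr F (Comp B v u) = Comp D (farr F v) (farr F u)"
  shows "is_functor B D F"
  using assms by (auto simp: is_functor_def Hom_def)

lemma functor_fcomp:
  assumes "is_functor A B F" "is_functor B D G"
  shows "is_functor A D (G \<circ>\<^sub>F F)"
proof (rule functorI)
  show "farr (G \<circ>\<^sub>F F) (Comp A v u) = Comp D (farr (G \<circ>\<^sub>F F) v) (farr (G \<circ>\<^sub>F F) u)"
    if "u \<in> Hom A a b" "v \<in> Hom A b c" for u v a b c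
    using functorD(6)[OF assms(1) that]
      functorD(6)[OF assms(2) functorD(4)[OF assms(1) that(1)] functorD(4)[OF assms(1) that(2)]]
    by (simp add: fcomp_def)
qed (use functorD[OF assms(1)] functorD[OF assms(2)] in \<open>auto simp: fcomp_def\<close>)

lemma functor_iso:
  assumes F: "is_functor B D F" and u: "u \<in> Hom B a b" "iso_arr B u"
  shows "iso_arr D (farr F u)"
proof -
  obtain v where v: "v \<in> Hom B b a" "Comp B v u = Id B a" "Comp B u v = Id B b"
    using iso_arrE[OF u(2,1)] by metis
  note ab = Hom_Obj[OF functorD(1)[OF F] u(1)]
  show ?thesis
    by (rule iso_arrI[OF functorD(4)[OF F u(1)] functorD(4)[OF F v(1)]])
      (use functorD(5)[OF F ab(1)] functorD(5)[OF F ab(2)] functorD(6)[OF F u(1) v(1)]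
         functorD(6)[OF F v(1) u(1)] v in simp_all)
qed

lemma fully_faithfulD:
  assumes "fully_faithful B D F" "a \<in> Obj B" "b \<in> Obj B"
  shows "inj_on (farr F) (Hom B a b)"
    and "v \<in> Hom D (fobj F a) (fobj F b) \<Longrightarrow> \<exists>u \<in> Hom B a b. farr F u = v"
proof -
  have bij: "bij_betw (farr F) (Hom B a b) (Hom D (fobj F a) (fobj F b))"
    using assms by (simp add: fully_faithful_def)
  show "inj_on (farr F) (Hom B a b)" using bij by (rule bij_betw_imp_inj_on)
  show "\<exists>u \<in> Hom B a b. farr F u = v" if "v \<in> Hom D (fobj F a) (fobj F b)"
    using bij that by (metis bij_betw_imp_surj_on imageE)
qed

lemma fully_faithful_functor: "fully_faithful B D F \<Longrightarrow> is_functor B D F"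
  by (simp add: fully_faithful_def)

lemma fully_faithful_reflects_iso:
  assumes F: "fully_faithful B D F" and u: "u \<in> Hom B a b" and iso: "iso_arr D (farr F u)"
  shows "iso_arr B u"
proof -
  note fn = fully_faithful_functor[OF F]
  note B = functorD(1)[OF fn]
  note ab = Hom_Obj[OF B u]
  obtain v where v: "v \<in> Hom D (fobj F b) (fobj F a)"
    "Comp D v (farr F u) = Id D (fobj F a)" "Comp D (farr F u) v = Id D (fobj F b)"
    using iso_arrE[OF iso functorD(4)[OF fn u]] by metis
  obtain w where w: "w \<in> Hom B b a" "farr F w = v"
    using fully_faithfulD(2)[OF F ab(2,1) v(1)] by blast
  note cmp = category.Comp_Hom[OF B] and id = category.Id_Hom[OF B]
  show ?thesis
  proof (rule iso_arrI[OF u w(1)])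
    show "Comp B w u = Id B a"
      by (rule inj_onD[OF fully_faithfulD(1)[OF F ab(1,1)] _ cmp[OF u w(1)] id[OF ab(1)]])
        (use functorD(6)[OF fn u w(1)] functorD(5)[OF fn ab(1)] w v in simp)
    show "Comp B u w = Id B b"
      by (rule inj_onD[OF fully_faithfulD(1)[OF F ab(2,2)] _ cmp[OF w(1) u] id[OF ab(2)]])
        (use functorD(6)[OF fn w(1) u] functorD(5)[OF fn ab(2)] w v in simp)
  qed
qed

lemma fully_faithful_fcomp:
  assumes F: "fully_faithful A B F" and G: "fully_faithful B D G"
  shows "fully_faithful A D (G \<circ>\<^sub>F F)"
  unfolding fully_faithful_def
proof (intro conjI ballI)
  show "is_functor A D (G \<circ>\<^sub>F F)"
    by (rule functor_fcomp[OF fully_faithful_functor[OF F] fully_faithful_functor[OF G]])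
  fix a b assume ab: "a \<in> Obj A" "b \<in> Obj A"
  note Fab = functorD(3)[OF fully_faithful_functor[OF F] ab(1)] functorD(3)[OF fully_faithful_functor[OF F] ab(2)]
  have "bij_betw (farr F) (Hom A a b) (Hom B (fobj F a) (fobj F b))"
    "bij_betw (farr G) (Hom B (fobj F a) (fobj F b)) (Hom D (fobj G (fobj F a)) (fobj G (fobj F b)))"
    using F G ab Fab by (auto simp: fully_faithful_def)
  then show "bij_betw (farr (G \<circ>\<^sub>F F)) (Hom A a b) (Hom D (fobj (G \<circ>\<^sub>F F) a) (fobj (G \<circ>\<^sub>F F) b))"
    using bij_betw_trans by (fastforce simp: fcomp_def)
qed

lemma ess_surj_fcomp:
  assumes F: "ess_surj A B F" and G: "ess_surj B D G" and fG: "is_functor B D G"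
  shows "ess_surj A D (G \<circ>\<^sub>F F)"
  unfolding ess_surj_def
proof
  fix d assume "d \<in> Obj D"
  then obtain b u where b: "b \<in> Obj B" and u: "u \<in> Hom D (fobj G b) d" "iso_arr D u"
    using G by (auto simp: ess_surj_def)
  obtain a v where a: "a \<in> Obj A" and v: "v \<in> Hom B (fobj F a) b" "iso_arr B v"
    using F b by (auto simp: ess_surj_def)
  have Gv: "farr G v \<in> Hom D (fobj G (fobj F a)) (fobj G b)" "iso_arr D (farr G v)"
    using functorD(4)[OF fG v(1)] functor_iso[OF fG v] .
  show "\<exists>b \<in> Obj A. \<exists>u \<in> Hom D (fobj (G \<circ>\<^sub>F F) b) d. iso_arr D u"
    using a category.Comp_Hom[OF functorD(2)[OF fG] Gv(1) u(1)]
      iso_arr_Comp[OF functorD(2)[OF fG] Gv u] by (auto simp: fcomp_def)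
qed

lemma naturally_isomorphicE:
  assumes "naturally_isomorphic B D F G"
  obtains \<tau> where "\<And>b. b \<in> Obj B \<Longrightarrow> \<tau> b \<in> Hom D (fobj F b) (fobj G b)"
    "\<And>b. b \<in> Obj B \<Longrightarrow> iso_arr D (\<tau> b)"
    "\<And>u a b. u \<in> Hom B a b \<Longrightarrow> Comp D (\<tau> b) (farr F u) = Comp D (farr G u) (\<tau> a)"
  using assms by (auto simp: naturally_isomorphic_def Hom_def)

lemma naturally_isomorphicI:
  assumes "is_functor B D F" "is_functor B D G" "\<And>b. b \<in> Obj B \<Longrightarrow> \<tau> b \<in> Hom D (fobj F b) (fobj G b)"
    "\<And>b. b \<in> Obj B \<Longrightarrow> iso_arr D (\<tau> b)"
    "\<And>u a b. u \<in> Hom B a b \<Longrightarrow> Comp D (\<tau> b) (farr F u) = Comp D (farr G u) (\<tau> a)"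
  shows "naturally_isomorphic B D F G"
  unfolding naturally_isomorphic_def
proof (intro conjI exI[of _ \<tau>] ballI)
  show "Comp D (\<tau> (Cod B u)) (farr F u) = Comp D (farr G u) (\<tau> (Dom B u))" if "u \<in> Arr B" for u
    using assms(5)[OF Arr_Hom[OF that]] .
qed (use assms in auto)

lemma naturally_isomorphic_whisker:
  assumes H: "is_functor B D H" and FG: "naturally_isomorphic A B F G"
  shows "naturally_isomorphic A D (H \<circ>\<^sub>F F) (H \<circ>\<^sub>F G)"
proof -
  have F: "is_functor A B F" and G: "is_functor A B G" using FG by (auto simp: naturally_isomorphic_def)
  obtain \<tau> where t: "\<And>a. a \<in> Obj A \<Longrightarrow> \<tau> a \<in> Hom B (fobj F a) (fobj G a)"
    "\<And>a. a \<in> Obj A \<Longrightarrow> iso_arr B (\<tau> a)"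
    "\<And>u a b. u \<in> Hom A a b \<Longrightarrow> Comp B (\<tau> b) (farr F u) = Comp B (farr G u) (\<tau> a)"
    using naturally_isomorphicE[OF FG] by metis
  show ?thesis
  proof (rule naturally_isomorphicI[OF functor_fcomp[OF F H] functor_fcomp[OF G H], where \<tau> = "\<lambda>a. farr H (\<tau> a)"])
    fix u a b assume u: "u \<in> Hom A a b"
    note ab = Hom_Obj[OF functorD(1)[OF F] u]
    show "Comp D (farr H (\<tau> b)) (farr (H \<circ>\<^sub>F F) u) = Comp D (farr (H \<circ>\<^sub>F G) u) (farr H (\<tau> a))"
      using functorD(6)[OF H functorD(4)[OF F u] t(1)[OF ab(2)]] functorD(6)[OF H t(1)[OF ab(1)] functorD(4)[OF G u]] t(3)[OF u]
      by (simp add: fcomp_def)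
  qed (use functorD(4)[OF H t(1)] functor_iso[OF H t(1,2)] in \<open>auto simp: fcomp_def\<close>)
qed

lemma cat_equivalence_sym:
  assumes "cat_equivalence B D F"
  obtains G where "cat_equivalence D B G" "naturally_isomorphic B B (G \<circ>\<^sub>F F) incl"
  using assms unfolding cat_equivalence_def by metis

lemma nat_iso_incl_inj:
  assumes F: "is_functor B D F" and G: "is_functor D B G"
    and \<tau>: "naturally_isomorphic B B (G \<circ>\<^sub>F F) incl"
    and ab: "a \<in> Obj B" "b \<in> Obj B"
  shows "inj_on (farr F) (Hom B a b)"
proof (rule inj_onI)
  note B = functorD(1)[OF F]
  obtain \<tau> where t: "\<And>b. b \<in> Obj B \<Longrightarrow> \<tau> b \<in> Hom B (fobj G (fobj F b)) b"
    "\<And>b. b \<in> Obj B \<Longrightarrow> iso_arr B (\<tau> b)"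
    "\<And>u a b. u \<in> Hom B a b \<Longrightarrow> Comp B (\<tau> b) (farr G (farr F u)) = Comp B u (\<tau> a)"
    using naturally_isomorphicE[OF \<tau>] by (simp add: fcomp_def incl_def) metis
  obtain s where s: "s \<in> Hom B a (fobj G (fobj F a))" "Comp B (\<tau> a) s = Id B a"
    using iso_arrE[OF t(2,1)[OF ab(1)]] by metis
  fix u v assume u: "u \<in> Hom B a b" and v: "v \<in> Hom B a b" and eq: "farr F u = farr F v"
  have "Comp B (Comp B u (\<tau> a)) s = Comp B (Comp B v (\<tau> a)) s"
    using t(3)[OF u] t(3)[OF v] eq by simp
  then show "u = v"
    using Comp_cancel_right[OF B u t(1)[OF ab(1)] s] Comp_cancel_right[OF B v t(1)[OF ab(1)] s] by simp
qed

text \<open>A preimage of \<open>v\<close> is obtained by conjugating \<open>G(v)\<close> with the natural isomorphism from \<open>G F\<close> to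
  the identity; that it is mapped to \<open>v\<close> is seen after applying the faithful functor \<open>G\<close>.\<close>

lemma equivalence_imp_fully_faithful:
  assumes "cat_equivalence B D F"
  shows "fully_faithful B D F"
  unfolding fully_faithful_def
proof (intro conjI ballI)
  show F: "is_functor B D F" using assms by (simp add: cat_equivalence_def)
  obtain G where G: "is_functor D B G" and GF: "naturally_isomorphic B B (G \<circ>\<^sub>F F) incl"
    and FG: "naturally_isomorphic D D (F \<circ>\<^sub>F G) incl"
    using assms by (auto simp: cat_equivalence_def)
  note B = functorD(1)[OF F]
  obtain \<tau> where t: "\<And>b. b \<in> Obj B \<Longrightarrow> \<tau> b \<in> Hom B (fobj G (fobj F b)) b"
    "\<And>b. b \<in> Obj B \<Longrightarrow> iso_arr B (\<tau> b)"
    "\<And>u a b. u \<in> Hom B a b \<Longrightarrow> Comp B (\<tau> b) (farr G (farr F u)) = Comp B u (\<tau> a)"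
    using naturally_isomorphicE[OF GF] by (simp add: fcomp_def incl_def) metis
  fix a b assume ab: "a \<in> Obj B" "b \<in> Obj B"
  have inj: "inj_on (farr F) (Hom B a b)" by (rule nat_iso_incl_inj[OF F G GF ab])
  have "v \<in> farr F ` Hom B a b" if v: "v \<in> Hom D (fobj F a) (fobj F b)" for v
  proof -
    note Gv = functorD(4)[OF G v]
    obtain s where s: "s \<in> Hom B a (fobj G (fobj F a))" "Comp B (\<tau> a) s = Id B a" "Comp B s (\<tau> a) = Id B (fobj G (fobj F a))"
      using iso_arrE[OF t(2,1)[OF ab(1)]] by metis
    obtain s' where s': "s' \<in> Hom B b (fobj G (fobj F b))" "Comp B s' (\<tau> b) = Id B (fobj G (fobj F b))"
      using iso_arrE[OF t(2,1)[OF ab(2)]] by metis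
    note ta = t(1)[OF ab(1)] and tb = t(1)[OF ab(2)]
    have tG: "Comp B (\<tau> b) (farr G v) \<in> Hom B (fobj G (fobj F a)) b"
      by (rule category.Comp_Hom[OF B Gv tb])
    let ?u = "Comp B (Comp B (\<tau> b) (farr G v)) s"
    have u: "?u \<in> Hom B a b" by (rule category.Comp_Hom[OF B s(1) tG])
    have "Comp B (\<tau> b) (farr G (farr F ?u)) = Comp B ?u (\<tau> a)" by (rule t(3)[OF u])
    also have "\<dots> = Comp B (\<tau> b) (farr G v)"
      by (rule Comp_cancel_right[OF B tG s(1) ta s(3)])
    finally have "Comp B s' (Comp B (\<tau> b) (farr G (farr F ?u))) = Comp B s' (Comp B (\<tau> b) (farr G v))"
      by simp
    then have "farr G (farr F ?u) = farr G v"
      using Comp_cancel_left[OF B Gv tb s'] Comp_cancel_left[OF B _ tb s', of "farr G (farr F ?u)"]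
        functorD(4)[OF G functorD(4)[OF F u]] by metis
    then have "farr F ?u = v"
      using nat_iso_incl_inj[OF G F FG functorD(3)[OF F ab(1)] functorD(3)[OF F ab(2)]]
        functorD(4)[OF F u] v by (auto dest: inj_onD)
    then show ?thesis using u by (metis image_eqI)
  qed
  then show "bij_betw (farr F) (Hom B a b) (Hom D (fobj F a) (fobj F b))"
    using inj functorD(4)[OF F] by (auto simp: bij_betw_def)
qed

lemma equivalence_imp_ess_surj:
  assumes "cat_equivalence B D F"
  shows "ess_surj B D F"
  unfolding ess_surj_def
proof
  obtain G where G: "is_functor D B G" and FG: "naturally_isomorphic D D (F \<circ>\<^sub>F G) incl"
    using assms by (auto simp: cat_equivalence_def)
  obtain \<tau> where "\<And>b. b \<in> Obj D \<Longrightarrow> \<tau> b \<in> Hom D (fobj F (fobj G b)) b" "\<And>b. b \<in> Obj D \<Longrightarrow> iso_arr D (\<tau> b)"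
    using naturally_isomorphicE[OF FG] by (simp add: fcomp_def incl_def) metis
  then show "\<exists>b \<in> Obj B. \<exists>u \<in> Hom D (fobj F b) d. iso_arr D u" if "d \<in> Obj D" for d
    using that functorD(3)[OF G] by blast
qed

text \<open>The quasi-inverse chooses, for each \<open>d\<close>, an isomorphism \<open>i\<^sub>d: F(r\<^sub>d) \<rightarrow> d\<close>, and sends an arrow to
  the unique preimage of its conjugate by these isomorphisms.\<close>

lemma equivalenceI:
  assumes ff: "fully_faithful B D F" and es: "ess_surj B D F"
  shows "cat_equivalence B D F"
proof -
  note F = fully_faithful_functor[OF ff]
  note B = functorD(1)[OF F] and D = functorD(2)[OF F]
  obtain r where r: "\<And>d. d \<in> Obj D \<Longrightarrow> r d \<in> Obj B \<and> (\<exists>u \<in> Hom D (fobj F (r d)) d. iso_arr D u)"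
    using es unfolding ess_surj_def by metis
  then obtain i where i: "\<And>d. d \<in> Obj D \<Longrightarrow> i d \<in> Hom D (fobj F (r d)) d \<and> iso_arr D (i d)"
    by metis
  have "\<exists>v \<in> Hom D d (fobj F (r d)). Comp D v (i d) = Id D (fobj F (r d)) \<and> Comp D (i d) v = Id D d"
    if "d \<in> Obj D" for d using i[OF that] iso_arrE by metis
  then obtain j where j: "\<And>d. d \<in> Obj D \<Longrightarrow> j d \<in> Hom D d (fobj F (r d))"
    "\<And>d. d \<in> Obj D \<Longrightarrow> Comp D (j d) (i d) = Id D (fobj F (r d))"
    "\<And>d. d \<in> Obj D \<Longrightarrow> Comp D (i d) (j d) = Id D d" by metis
  note ro = r[THEN conjunct1] and iH = i[THEN conjunct1] and iI = i[THEN conjunct2]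
  note cmp = category.Comp_Hom[OF D]
  have conj: "Comp D (j e) (Comp D u (i d)) \<in> Hom D (fobj F (r d)) (fobj F (r e))"
    if "u \<in> Hom D d e" for u d e
    by (rule cmp[OF cmp[OF iH that] j(1)]) (use Hom_Obj[OF D that] in auto)
  have "\<exists>v. v \<in> Hom B (r (Dom D u)) (r (Cod D u)) \<and> farr F v = Comp D (j (Cod D u)) (Comp D u (i (Dom D u)))"
    if "u \<in> Arr D" for u
    using fully_faithfulD(2)[OF ff ro ro conj[OF Arr_Hom[OF that]]] Hom_Obj[OF D Arr_Hom[OF that]] by blast
  then obtain g where "\<And>u. u \<in> Arr D \<Longrightarrow> g u \<in> Hom B (r (Dom D u)) (r (Cod D u)) \<and>
      farr F (g u) = Comp D (j (Cod D u)) (Comp D u (i (Dom D u)))" by metis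
  then have g: "\<And>u d e. u \<in> Hom D d e \<Longrightarrow> g u \<in> Hom B (r d) (r e)"
    and Fg: "\<And>u d e. u \<in> Hom D d e \<Longrightarrow> farr F (g u) = Comp D (j e) (Comp D u (i d))"
    by (auto dest!: HomD)
  have eqI: "u = v" if "a \<in> Obj B" "b \<in> Obj B" "u \<in> Hom B a b" "v \<in> Hom B a b" "farr F u = farr F v" for u v a b
    using fully_faithfulD(1)[OF ff that(1,2)] that by (auto dest: inj_onD)
  have nat: "Comp D (i e) (farr F (g u)) = Comp D u (i d)" if u: "u \<in> Hom D d e" for u d e
  proof -
    note de = Hom_Obj[OF D u]
    show ?thesis unfolding Fg[OF u]
      by (rule Comp_cancel_left[OF D cmp[OF iH[OF de(1)] u] j(1)[OF de(2)] iH[OF de(2)] j(3)[OF de(2)]])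
  qed
  let ?G = "\<lparr>fobj = r, farr = g\<rparr>"
  have G: "is_functor D B ?G"
  proof (rule functorI[OF D B])
    show "fobj ?G d \<in> Obj B" if "d \<in> Obj D" for d using ro[OF that] by simp
    show "farr ?G u \<in> Hom B (fobj ?G d) (fobj ?G e)" if "u \<in> Hom D d e" for u d e
      using g[OF that] by simp
    show "farr ?G (Id D d) = Id B (fobj ?G d)" if d: "d \<in> Obj D" for d
    proof -
      note id = category.Id_Hom[OF D d]
      have "g (Id D d) = Id B (r d)"
        by (rule eqI[OF ro[OF d] ro[OF d] g[OF id] category.Id_Hom[OF B ro[OF d]]])
          (simp add: Fg[OF id] category.Id_Comp[OF D iH[OF d]] j(2)[OF d] functorD(5)[OF F ro[OF d]])
      then show ?thesis by simp
    qed
    fix u v a b c assume u: "u \<in> Hom D a b" and v: "v \<in> Hom D b c"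
    note a = Hom_Obj(1)[OF D u] and b = Hom_Obj[OF D v]
    note vu = cmp[OF u v]
    have "farr F (g (Comp D v u)) = farr F (Comp B (g v) (g u))"
    proof -
      have "Comp D (farr F (g v)) (farr F (g u)) = Comp D (j c) (Comp D (Comp D v (i b)) (farr F (g u)))"
        unfolding Fg[OF v]
        by (rule category.Comp_assoc[OF D functorD(4)[OF F g[OF u]] cmp[OF iH[OF b(1)] v] j(1)[OF b(2)], symmetric])
      also have "Comp D (Comp D v (i b)) (farr F (g u)) = Comp D v (Comp D (i b) (farr F (g u)))"
        by (rule category.Comp_assoc[OF D functorD(4)[OF F g[OF u]] iH[OF b(1)] v, symmetric])
      also have "\<dots> = Comp D (Comp D v u) (i a)"
        unfolding nat[OF u] by (rule category.Comp_assoc[OF D iH[OF a] u v])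
      finally show ?thesis by (simp add: Fg[OF vu] functorD(6)[OF F g[OF u] g[OF v]])
    qed
    then have "g (Comp D v u) = Comp B (g v) (g u)"
      by (rule eqI[OF ro[OF a] ro[OF b(2)] g[OF vu] category.Comp_Hom[OF B g[OF u] g[OF v]]])
    then show "farr ?G (Comp D v u) = Comp B (farr ?G v) (farr ?G u)" by simp
  qed
  have inclf: "is_functor A A incl" if "category A" for A :: "('x, 'y) cat"
    by (rule functorI) (use that in \<open>auto simp: incl_def\<close>)
  have FG: "naturally_isomorphic D D (F \<circ>\<^sub>F ?G) incl"
    by (rule naturally_isomorphicI[OF functor_fcomp[OF G F] inclf[OF D], where \<tau> = i])
      (use iH iI nat in \<open>auto simp: fcomp_def incl_def\<close>)
  have "\<exists>t. t \<in> Hom B (r (fobj F b)) b \<and> farr F t = i (fobj F b)" if b: "b \<in> Obj B" for b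
    using fully_faithfulD(2)[OF ff ro b iH] functorD(3)[OF F b] by blast
  then obtain t where t: "\<And>b. b \<in> Obj B \<Longrightarrow> t b \<in> Hom B (r (fobj F b)) b"
    and Ft: "\<And>b. b \<in> Obj B \<Longrightarrow> farr F (t b) = i (fobj F b)" by metis
  have GF: "naturally_isomorphic B B (?G \<circ>\<^sub>F F) incl"
  proof (rule naturally_isomorphicI[OF functor_fcomp[OF F G] inclf[OF B], where \<tau> = t])
    fix b assume b: "b \<in> Obj B"
    show "t b \<in> Hom B (fobj (?G \<circ>\<^sub>F F) b) (fobj incl b)" using t[OF b] by (simp add: fcomp_def incl_def)
    show "iso_arr B (t b)"
      by (rule fully_faithful_reflects_iso[OF ff t[OF b]]) (use Ft[OF b] iI[OF functorD(3)[OF F b]] in simp)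
  next
    fix u a b assume u: "u \<in> Hom B a b"
    note ab = Hom_Obj[OF B u] and Fu = functorD(4)[OF F u]
    note Fab = functorD(3)[OF F ab(1)] functorD(3)[OF F ab(2)]
    have "Comp B (t b) (g (farr F u)) = Comp B u (t a)"
    proof (rule eqI[OF ro[OF Fab(1)] ab(2) category.Comp_Hom[OF B g[OF Fu] t[OF ab(2)]] category.Comp_Hom[OF B t[OF ab(1)] u]])
      show "farr F (Comp B (t b) (g (farr F u))) = farr F (Comp B u (t a))"
        using functorD(6)[OF F g[OF Fu] t[OF ab(2)]] functorD(6)[OF F t[OF ab(1)] u] Ft ab nat[OF Fu] by simp
    qed
    then show "Comp B (t b) (farr (?G \<circ>\<^sub>F F) u) = Comp B (farr incl u) (t a)"
      by (simp add: fcomp_def incl_def)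
  qed
  show ?thesis unfolding cat_equivalence_def using F G GF FG by blast
qed

lemma cat_equivalence_fcomp:
  assumes "cat_equivalence A B F" "cat_equivalence B D G"
  shows "cat_equivalence A D (G \<circ>\<^sub>F F)"
proof (rule equivalenceI)
  note F = equivalence_imp_fully_faithful[OF assms(1)] equivalence_imp_ess_surj[OF assms(1)]
  note G = equivalence_imp_fully_faithful[OF assms(2)] equivalence_imp_ess_surj[OF assms(2)]
  show "fully_faithful A D (G \<circ>\<^sub>F F)" by (rule fully_faithful_fcomp[OF F(1) G(1)])
  show "ess_surj A D (G \<circ>\<^sub>F F)" by (rule ess_surj_fcomp[OF F(2) G(2) fully_faithful_functor[OF G(1)]])
qed

subsection \<open>Full subcategories\<close>

lemma full_subcat_simps:
  "Obj (full_subcat C S) = S" "Id (full_subcat C S) = Id C" "Comp (full_subcat C S) = Comp C"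
  by (simp_all add: full_subcat_def)

lemma Hom_full_subcat: "\<lbrakk>a \<in> S; b \<in> S\<rbrakk> \<Longrightarrow> Hom (full_subcat C S) a b = Hom C a b"
  by (auto simp: full_subcat_def Hom_def)

lemma Hom_full_subcatD: "u \<in> Hom (full_subcat C S) a b \<Longrightarrow> u \<in> Hom C a b \<and> a \<in> S \<and> b \<in> S"
  by (auto simp: full_subcat_def Hom_def)

lemma full_subcat_category:
  assumes C: "category C" and S: "S \<subseteq> Obj C"
  shows "category (full_subcat C S)"
proof
  show "Dom (full_subcat C S) u \<in> Obj (full_subcat C S)" "Cod (full_subcat C S) u \<in> Obj (full_subcat C S)"
    if "u \<in> Arr (full_subcat C S)" for u using that by (auto simp: full_subcat_def)
  show "Id (full_subcat C S) c \<in> Hom (full_subcat C S) c c" if "c \<in> Obj (full_subcat C S)" for c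
    using that category.Id_Hom[OF C] S by (auto simp: full_subcat_simps Hom_full_subcat)
qed (auto dest!: Hom_full_subcatD simp: full_subcat_simps Hom_full_subcat
      intro: category.Comp_Hom[OF C] category.Comp_Id[OF C] category.Id_Comp[OF C] category.Comp_assoc[OF C])

lemma fully_faithful_incl:
  assumes C: "category C" and S: "S \<subseteq> Obj C"
  shows "fully_faithful (full_subcat C S) C incl"
proof -
  have "is_functor (full_subcat C S) C incl"
    by (rule functorI[OF full_subcat_category[OF C S] C])
      (use S in \<open>auto dest!: Hom_full_subcatD simp: incl_def full_subcat_simps\<close>)
  then show ?thesis
    by (auto simp: fully_faithful_def full_subcat_simps Hom_full_subcat incl_def bij_betw_def)
qed

lemma incl_equivalence:
  assumes C: "category C" and S: "S \<subseteq> Obj C"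
    and es: "\<And>c. c \<in> Obj C \<Longrightarrow> \<exists>s \<in> S. \<exists>u \<in> Hom C s c. iso_arr C u"
  shows "cat_equivalence (full_subcat C S) C incl"
  by (rule equivalenceI[OF fully_faithful_incl[OF C S]])
    (use es in \<open>auto simp: ess_surj_def full_subcat_simps incl_def\<close>)

lemma iso_arr_full_subcat:
  assumes "u \<in> Hom (full_subcat C S) a b"
  shows "iso_arr (full_subcat C S) u \<longleftrightarrow> iso_arr C u"
proof -
  have ab: "a \<in> S" "b \<in> S" and u: "u \<in> Hom C a b" using Hom_full_subcatD[OF assms] by auto
  then show ?thesis
    using assms Hom_full_subcat[OF ab(2,1), of C] HomD[OF assms] HomD[OF u]
    by (auto simp: iso_arr_def full_subcat_simps)
qed

lemma fully_faithful_restrict_equivalence: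
  assumes F: "fully_faithful B D F" and S: "S \<subseteq> Obj B" and T: "T \<subseteq> Obj D"
    and ST: "\<And>b. b \<in> S \<Longrightarrow> fobj F b \<in> T"
    and es: "\<And>d. d \<in> T \<Longrightarrow> \<exists>b \<in> S. \<exists>u \<in> Hom D (fobj F b) d. iso_arr D u"
  shows "cat_equivalence (full_subcat B S) (full_subcat D T) F"
proof (rule equivalenceI)
  note fn = fully_faithful_functor[OF F]
  note B = functorD(1)[OF fn] and D = functorD(2)[OF fn]
  have "is_functor (full_subcat B S) (full_subcat D T) F"
  proof (rule functorI[OF full_subcat_category[OF B S] full_subcat_category[OF D T]])
    show "farr F u \<in> Hom (full_subcat D T) (fobj F a) (fobj F b)" if "u \<in> Hom (full_subcat B S) a b" for u a b
      using Hom_full_subcatD[OF that] functorD(4)[OF fn, of u a b] ST by (simp add: Hom_full_subcat)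
    show "farr F (Comp (full_subcat B S) v u) = Comp (full_subcat D T) (farr F v) (farr F u)"
      if "u \<in> Hom (full_subcat B S) a b" "v \<in> Hom (full_subcat B S) b c" for u v a b c
      using Hom_full_subcatD[OF that(1)] Hom_full_subcatD[OF that(2)] functorD(6)[OF fn, of u a b v c]
      by (simp add: full_subcat_simps)
  qed (use ST S functorD(5)[OF fn] in \<open>auto simp: full_subcat_simps\<close>)
  then show "fully_faithful (full_subcat B S) (full_subcat D T) F"
    using F S ST by (auto simp: fully_faithful_def full_subcat_simps Hom_full_subcat)
  show "ess_surj (full_subcat B S) (full_subcat D T) F"
    unfolding ess_surj_def full_subcat_simps
  proof
    fix d assume d: "d \<in> T"
    then obtain b u where b: "b \<in> S" and u: "u \<in> Hom D (fobj F b) d" "iso_arr D u" using es by blast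
    have uT: "u \<in> Hom (full_subcat D T) (fobj F b) d" using u(1) d ST[OF b] by (simp add: Hom_full_subcat)
    show "\<exists>b \<in> S. \<exists>u \<in> Hom (full_subcat D T) (fobj F b) d. iso_arr (full_subcat D T) u"
      using b uT u(2) iso_arr_full_subcat[OF uT] by (intro bexI[of _ b] bexI[of _ u]) simp_all
  qed
qed

lemma full_subcat_full_subcat: "T \<subseteq> S \<Longrightarrow> full_subcat (full_subcat C S) T = full_subcat C T"
  by (rule cat.equality) (auto simp: full_subcat_def)

section \<open>Submodules of modules over a category\<close>

lemma module_zero_closed: "module R M \<Longrightarrow> \<zero>\<^bsub>M\<^esub> \<in> carrier M"
  by (meson abelian_group.axioms(1) abelian_monoid.zero_closed module_ag)

lemma submoduleD:
  assumes "module R M" "submodule H R M"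
  shows "H \<subseteq> carrier M" "\<zero>\<^bsub>M\<^esub> \<in> H" "x \<in> H \<Longrightarrow> \<ominus>\<^bsub>M\<^esub> x \<in> H"
    "\<lbrakk>x \<in> H; y \<in> H\<rbrakk> \<Longrightarrow> x \<oplus>\<^bsub>M\<^esub> y \<in> H" "\<lbrakk>a \<in> carrier R; x \<in> H\<rbrakk> \<Longrightarrow> a \<odot>\<^bsub>M\<^esub> x \<in> H"
proof -
  interpret M: module R M by fact
  show "H \<subseteq> carrier M" "x \<in> H \<Longrightarrow> \<ominus>\<^bsub>M\<^esub> x \<in> H" "\<lbrakk>x \<in> H; y \<in> H\<rbrakk> \<Longrightarrow> x \<oplus>\<^bsub>M\<^esub> y \<in> H"
    "\<lbrakk>a \<in> carrier R; x \<in> H\<rbrakk> \<Longrightarrow> a \<odot>\<^bsub>M\<^esub> x \<in> H"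
    using M.submoduleE[OF assms(2)] by blast+
  show "\<zero>\<^bsub>M\<^esub> \<in> H" using assms(2) subgroup.one_closed[of H "add_monoid M"] by (simp add: submodule_def)
qed

lemma zero_submodule: "module R M \<Longrightarrow> submodule {\<zero>\<^bsub>M\<^esub>} R M"
proof -
  assume "module R M"
  then interpret M: module R M .
  show ?thesis by (rule M.submoduleI) auto
qed

text \<open>The form with a family of maps covers the submodules of elements that all arrows of a certain
  kind send into prescribed submodules.\<close>

lemma preimage_submodule:
  assumes M: "module R M" and N: "\<And>i. i \<in> J \<Longrightarrow> module R (N i)"
    and h: "\<And>i. i \<in> J \<Longrightarrow> h i \<in> linear_maps R M (N i)" and H: "\<And>i. i \<in> J \<Longrightarrow> submodule (H i) R (N i)"
  shows "submodule {x \<in> carrier M. \<forall>i \<in> J. h i x \<in> H i} R M"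
proof -
  interpret M: module R M by fact
  note HD = submoduleD[OF N H]
  show ?thesis
  proof (rule M.submoduleI)
    show "\<zero>\<^bsub>M\<^esub> \<in> {x \<in> carrier M. \<forall>i \<in> J. h i x \<in> H i}"
      using linear_zero[OF M N h] HD(2) by simp
    show "\<ominus>\<^bsub>M\<^esub> a \<in> {x \<in> carrier M. \<forall>i \<in> J. h i x \<in> H i}" if "a \<in> {x \<in> carrier M. \<forall>i \<in> J. h i x \<in> H i}" for a
      using that linear_neg[OF M N h] HD(3) by simp
  qed (use linear_mapsD(2,3)[OF h] HD(4,5) in auto)
qed

lemma linear_image_submodule:
  assumes M: "module R M" and N: "module R N" and h: "h \<in> linear_maps R M N" and H: "submodule H R M"
  shows "submodule (h ` H) R N"
proof -
  have "h \<in> linear_maps R (M\<lparr>carrier := H\<rparr>) N"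
    using submoduleD(1)[OF M H] linear_mapsD[OF h] by (intro linear_mapsI) (simp_all add: subset_iff)
  from image_submodule[OF submodule.submodule_is_module[OF H M] N this] show ?thesis by simp
qed

lemma not_nonzero_iff: "\<not> nonzero M \<longleftrightarrow> carrier M = {\<zero>\<^bsub>M\<^esub>}"
  by (simp add: nonzero_def)

definition kmod_sub :: "'r ring \<Rightarrow> ('o, 'a) cat \<Rightarrow> ('o, 'a, 'r, 'm) cmod \<Rightarrow> ('o \<Rightarrow> 'm set) \<Rightarrow> bool" where
  "kmod_sub R C L K \<longleftrightarrow> (\<forall>c \<in> Obj C. submodule (K c) R (Val L c)) \<and>
     (\<forall>u \<in> Arr C. \<forall>x \<in> K (Dom C u). Act L u x \<in> K (Cod C u))"

lemma kmod_subI: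
  assumes "\<And>c. c \<in> Obj C \<Longrightarrow> submodule (K c) R (Val L c)"
    and "\<And>u a b x. \<lbrakk>u \<in> Hom C a b; x \<in> K a\<rbrakk> \<Longrightarrow> Act L u x \<in> K b"
  shows "kmod_sub R C L K"
  using assms by (auto simp: kmod_sub_def Hom_def)

lemma kmod_subD:
  assumes "kmodule R C L" "kmod_sub R C L K"
  shows "c \<in> Obj C \<Longrightarrow> submodule (K c) R (Val L c)"
    "c \<in> Obj C \<Longrightarrow> K c \<subseteq> carrier (Val L c)"
    "\<lbrakk>u \<in> Hom C a b; x \<in> K a\<rbrakk> \<Longrightarrow> Act L u x \<in> K b"
  using assms submoduleD(1)[OF kmoduleD(1)[OF assms(1)]] by (auto simp: kmod_sub_def Hom_def)

lemma kmodule_Act: "\<lbrakk>kmodule R C L; u \<in> Hom C a b\<rbrakk> \<Longrightarrow> Act L u \<in> linear_maps R (Val L a) (Val L b)"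
  using kmoduleD(2) by (fastforce simp: Hom_def)

lemma kmodule_Act_closed:
  "\<lbrakk>kmodule R C L; u \<in> Hom C a b; x \<in> carrier (Val L a)\<rbrakk> \<Longrightarrow> Act L u x \<in> carrier (Val L b)"
  using linear_mapsD(1)[OF kmodule_Act] by metis

lemma kmod_hom_closed:
  "\<lbrakk>kmod_hom R C L M g; c \<in> Obj C; x \<in> carrier (Val L c)\<rbrakk> \<Longrightarrow> g c x \<in> carrier (Val M c)"
  using linear_mapsD(1)[OF kmod_homD(3)] by metis

lemma kmod_hom_nat:
  "\<lbrakk>kmod_hom R C L M g; u \<in> Hom C a b; x \<in> carrier (Val L a)\<rbrakk> \<Longrightarrow> g b (Act L u x) = Act M u (g a x)"
  using kmod_homD(4) by (fastforce simp: Hom_def)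

lemma kmod_homI:
  assumes "kmodule R C L" "kmodule R C M" "\<And>c. c \<in> Obj C \<Longrightarrow> g c \<in> linear_maps R (Val L c) (Val M c)"
    "\<And>u a b x. \<lbrakk>u \<in> Hom C a b; x \<in> carrier (Val L a)\<rbrakk> \<Longrightarrow> g b (Act L u x) = Act M u (g a x)"
  shows "kmod_hom R C L M g"
  using assms by (auto simp: kmod_hom_def Hom_def)

lemma kmod_sub_image:
  assumes g: "kmod_hom R C L M g" and C: "category C" and K: "kmod_sub R C L K"
  shows "kmod_sub R C M (\<lambda>c. g c ` K c)"
proof (rule kmod_subI)
  note L = kmod_homD(1)[OF g] and M = kmod_homD(2)[OF g]
  show "submodule (g c ` K c) R (Val M c)" if "c \<in> Obj C" for c
    by (rule linear_image_submodule[OF kmoduleD(1)[OF L that] kmoduleD(1)[OF M that] kmod_homD(3)[OF g that]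
          kmod_subD(1)[OF L K that]])
  fix u a b y assume u: "u \<in> Hom C a b" and "y \<in> g a ` K a"
  then obtain x where x: "x \<in> K a" "y = g a x" by blast
  have "x \<in> carrier (Val L a)" using kmod_subD(2)[OF L K Hom_Obj(1)[OF C u]] x by blast
  then show "Act M u y \<in> g b ` K b"
    using kmod_hom_nat[OF g u] kmod_subD(3)[OF L K u x(1)] x(2) by (metis image_eqI)
qed

lemma kmod_sub_carrier: "kmodule R C L \<Longrightarrow> kmod_sub R C L (\<lambda>c. carrier (Val L c))"
  by (rule kmod_subI) (auto intro: kmodule_Act_closed module.carrier_is_submodule kmoduleD(1))

lemma kmod_sub_hom_range:
  assumes "kmod_hom R C L M g" "category C"
  shows "kmod_sub R C M (\<lambda>c. g c ` carrier (Val L c))"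
  by (rule kmod_sub_image[OF assms kmod_sub_carrier[OF kmod_homD(1)[OF assms(1)]]])

lemma kmod_sub_preimage:
  assumes g: "kmod_hom R C L M g" and C: "category C" and K: "kmod_sub R C M K"
  shows "kmod_sub R C L (\<lambda>c. {x \<in> carrier (Val L c). g c x \<in> K c})"
proof (rule kmod_subI)
  note L = kmod_homD(1)[OF g] and M = kmod_homD(2)[OF g]
  show "submodule {x \<in> carrier (Val L c). g c x \<in> K c} R (Val L c)" if "c \<in> Obj C" for c
    using preimage_submodule[of R "Val L c" "{()}" "\<lambda>_. Val M c" "\<lambda>_. g c" "\<lambda>_. K c"]
      kmoduleD(1)[OF L that] kmoduleD(1)[OF M that] kmod_homD(3)[OF g that] kmod_subD(1)[OF M K that] by simp
  show "Act L u x \<in> {x \<in> carrier (Val L b). g b x \<in> K b}"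
    if "u \<in> Hom C a b" "x \<in> {x \<in> carrier (Val L a). g a x \<in> K a}" for u a b x
    using that kmodule_Act_closed[OF L that(1)] kmod_hom_nat[OF g that(1)] kmod_subD(3)[OF M K that(1)] by simp
qed

lemma kmod_sub_kmodule:
  assumes C: "category C" and L: "kmodule R C L" and K: "kmod_sub R C L K"
  defines "S \<equiv> L\<lparr>Val := \<lambda>c. (Val L c)\<lparr>carrier := K c\<rparr>\<rparr>"
  shows "kmodule R C S" "kmod_hom R C S L (\<lambda>c x. x)"
proof -
  note KD = kmod_subD[OF L K] and Lin = linear_mapsD[OF kmodule_Act[OF L]]
  show S: "kmodule R C S"
    unfolding kmodule_def S_def
  proof (simp, intro conjI ballI impI)
    show "module R (Val L c\<lparr>carrier := K c\<rparr>)" if "c \<in> Obj C" for c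
      by (rule submodule.submodule_is_module[OF KD(1)[OF that] kmoduleD(1)[OF L that]])
    show "Act L u \<in> linear_maps R (Val L (Dom C u)\<lparr>carrier := K (Dom C u)\<rparr>) (Val L (Cod C u)\<lparr>carrier := K (Cod C u)\<rparr>)"
      if "u \<in> Arr C" for u
    proof (rule linear_mapsI)
      note u = Arr_Hom[OF that]
      note sub = KD(2)[OF Hom_Obj(1)[OF C u]]
      show "Act L u x \<in> carrier (Val L (Cod C u)\<lparr>carrier := K (Cod C u)\<rparr>)"
        if "x \<in> carrier (Val L (Dom C u)\<lparr>carrier := K (Dom C u)\<rparr>)" for x
        using KD(3)[OF u] that by simp
    qed (use Lin(2,3)[OF Arr_Hom[OF that]] KD(2)[OF Hom_Obj(1)[OF C Arr_Hom[OF that]]] in \<open>auto simp: subset_iff\<close>)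
    show "Act L (Id C c) x = x" if "c \<in> Obj C" "x \<in> K c" for c x
      using kmoduleD(3)[OF L that(1)] KD(2)[OF that(1)] that(2) by blast
    show "Act L (Comp C v u) x = Act L v (Act L u x)"
      if "u \<in> Arr C" "v \<in> Arr C" "Cod C u = Dom C v" "x \<in> K (Dom C u)" for u v x
      by (rule kmoduleD(4)[OF L Arr_Hom[OF that(1)]])
        (use that KD(2)[OF category.Dom_Obj[OF C that(1)]] in \<open>auto simp: Hom_def\<close>)
  qed
  show "kmod_hom R C S L (\<lambda>c x. x)"
    by (rule kmod_homI[OF S L]) (use KD(2)[THEN subsetD] in \<open>auto simp: S_def intro!: linear_mapsI\<close>)
qed

lemma inv_into_linear:
  assumes M: "module R M" and h: "h \<in> linear_maps R M N" and bij: "bij_betw h (carrier M) (carrier N)"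
  shows "inv_into (carrier M) h \<in> linear_maps R N M"
proof -
  interpret M: module R M by fact
  let ?k = "inv_into (carrier M) h"
  have k: "?k y \<in> carrier M" "h (?k y) = y" if "y \<in> carrier N" for y
    using bij that by (auto simp: bij_betw_def inv_into_into f_inv_into_f)
  have kh: "?k (h x) = x" if "x \<in> carrier M" for x using bij that by (simp add: bij_betw_def)
  show ?thesis
  proof (rule linear_mapsI)
    show "?k (x \<oplus>\<^bsub>N\<^esub> y) = ?k x \<oplus>\<^bsub>M\<^esub> ?k y" if "x \<in> carrier N" "y \<in> carrier N" for x y
      using linear_mapsD(2)[OF h k(1)[OF that(1)] k(1)[OF that(2)]] k[OF that(1)] k[OF that(2)]
        kh[of "?k x \<oplus>\<^bsub>M\<^esub> ?k y"] by simp
    show "?k (a \<odot>\<^bsub>N\<^esub> x) = a \<odot>\<^bsub>M\<^esub> ?k x" if "a \<in> carrier R" "x \<in> carrier N" for a x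
      using linear_mapsD(3)[OF h that(1) k(1)[OF that(2)]] k[OF that(2)]
        kh[of "a \<odot>\<^bsub>M\<^esub> ?k x"] that by simp
  qed (rule k)
qed

definition kinv :: "('o, 'a, 'r, 'm) cmod \<Rightarrow> ('o \<Rightarrow> 'm \<Rightarrow> 'n) \<Rightarrow> 'o \<Rightarrow> 'n \<Rightarrow> 'm" where
  "kinv L g c = inv_into (carrier (Val L c)) (g c)"

lemma kinv:
  assumes "kmod_iso R C L M g" "c \<in> Obj C"
  shows "x \<in> carrier (Val L c) \<Longrightarrow> kinv L g c (g c x) = x"
    and "y \<in> carrier (Val M c) \<Longrightarrow> kinv L g c y \<in> carrier (Val L c)"
    and "y \<in> carrier (Val M c) \<Longrightarrow> g c (kinv L g c y) = y"
  using assms by (auto simp: kmod_iso_def bij_betw_def kinv_def inv_into_into f_inv_into_f)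

lemma kmod_isoD: "kmod_iso R C L M g \<Longrightarrow> kmod_hom R C L M g"
  by (simp add: kmod_iso_def)

lemma kinv_iso:
  assumes C: "category C" and g: "kmod_iso R C L M g"
  shows "kmod_iso R C M L (kinv L g)"
proof -
  note gh = kmod_isoD[OF g]
  note L = kmod_homD(1)[OF gh] and M = kmod_homD(2)[OF gh]
  have bij: "bij_betw (g c) (carrier (Val L c)) (carrier (Val M c))" if "c \<in> Obj C" for c
    using g that by (simp add: kmod_iso_def)
  have "kmod_hom R C M L (kinv L g)"
  proof (rule kmod_homI[OF M L])
    show "kinv L g c \<in> linear_maps R (Val M c) (Val L c)" if "c \<in> Obj C" for c
      using inv_into_linear[OF kmoduleD(1)[OF L that] kmod_homD(3)[OF gh that] bij[OF that]]
      by (simp add: kinv_def[abs_def])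
    fix u a b y assume u: "u \<in> Hom C a b" and y: "y \<in> carrier (Val M a)"
    note ab = Hom_Obj[OF C u]
    note kin = kinv[OF g ab(1)] 
    have "g b (Act L u (kinv L g a y)) = Act M u y"
      using kmod_hom_nat[OF gh u kin(2)[OF y]] kin(3)[OF y] by simp
    then show "kinv L g b (Act M u y) = Act L u (kinv L g a y)"
      using kinv(1)[OF g ab(2) kmodule_Act_closed[OF L u kin(2)[OF y]]] by simp
  qed
  then show ?thesis
    using bij_betw_inv_into[OF bij] by (simp add: kmod_iso_def kinv_def)
qed

lemma kmod_iso_comp:
  assumes C: "category C" and g: "kmod_iso R C K L g" and f: "kmod_iso R C L M f"
  shows "kmod_iso R C K M (hcomp f g)"
  using kmod_hom_comp[OF C kmod_isoD[OF g] kmod_isoD[OF f]] g f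
  by (auto simp: kmod_iso_def hcomp_def intro: bij_betw_trans[unfolded comp_def])

lemma kmod_isoI:
  assumes "kmod_hom R C L M g"
    and "\<And>c x y. \<lbrakk>c \<in> Obj C; x \<in> carrier (Val L c); y \<in> carrier (Val L c); g c x = g c y\<rbrakk> \<Longrightarrow> x = y"
    and "\<And>c y. \<lbrakk>c \<in> Obj C; y \<in> carrier (Val M c)\<rbrakk> \<Longrightarrow> \<exists>x \<in> carrier (Val L c). g c x = y"
  shows "kmod_iso R C L M g"
  unfolding kmod_iso_def bij_betw_def inj_on_def
  using assms kmod_hom_closed[OF assms(1)] by fast

section \<open>Essential maps\<close>

text \<open>Superfluous epimorphisms enter only through this property. It mentions no target module, so
  \<open>d\<^sub>n\<close> can be treated as a map to \<open>P\<^sub>n\<^sub>-\<^sub>1\<close> rather than onto its image.\<close>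

definition essential :: "'r ring \<Rightarrow> ('o, 'a) cat \<Rightarrow> ('o, 'a, 'r, 'm) cmod \<Rightarrow> ('o \<Rightarrow> 'm \<Rightarrow> 'n) \<Rightarrow> bool" where
  "essential R C L f \<longleftrightarrow> (\<forall>K. kmod_sub R C L K
     \<and> (\<forall>c \<in> Obj C. f c ` K c = f c ` carrier (Val L c)) \<longrightarrow> (\<forall>c \<in> Obj C. K c = carrier (Val L c)))"

lemma essentialD:
  assumes "essential R C L f" "kmod_sub R C L K"
    and "\<And>c x. \<lbrakk>c \<in> Obj C; x \<in> carrier (Val L c)\<rbrakk> \<Longrightarrow> \<exists>y \<in> K c. f c y = f c x"
    and "kmodule R C L" "c \<in> Obj C"
  shows "K c = carrier (Val L c)"
proof -
  have "f c ` K c = f c ` carrier (Val L c)" if "c \<in> Obj C" for c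
    using assms(3)[OF that] kmod_subD(2)[OF assms(4,2) that] by (auto simp: image_iff) metis
  then show ?thesis using assms(1,2,5) by (simp add: essential_def)
qed

lemma superfluous_imp_essential:
  assumes C: "category C" and f: "superfluous_epi R C L M f"
  shows "essential R C L f"
  unfolding essential_def
proof (intro allI impI)
  fix K assume K: "kmod_sub R C L K \<and> (\<forall>c \<in> Obj C. f c ` K c = f c ` carrier (Val L c))"
  have fe: "kmod_epi R C L M f" using f by (simp add: superfluous_epi_def)
  then have fh: "kmod_hom R C L M f" by (simp add: kmod_epi_def)
  let ?S = "L\<lparr>Val := \<lambda>c. (Val L c)\<lparr>carrier := K c\<rparr>\<rparr>"
  have S: "kmod_hom R C ?S L (\<lambda>c x. x)"
    using kmod_sub_kmodule(2)[OF C kmod_homD(1)[OF fh]] K by blast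
  have "kmod_epi R C ?S M (hcomp f (\<lambda>c x. x))"
    using kmod_hom_comp[OF C S fh] K fe by (auto simp: kmod_epi_def hcomp_def)
  then have "kmod_epi R C ?S L (\<lambda>c x. x)" using superfluous_epi_any[OF C f S] by simp
  then show "\<forall>c \<in> Obj C. K c = carrier (Val L c)" by (simp add: kmod_epi_def)
qed

text \<open>Let \<open>\<phi>\<close> induce an isomorphism from the image of \<open>p\<close> to that of \<open>q\<close>. Then \<open>q\<close> maps the range of
  \<open>\<phi>\<close> onto the image of \<open>q\<close>, so \<open>\<phi>\<close> is onto. If this makes it split, then \<open>p\<close> maps the range of the
  section onto the image of \<open>p\<close>, so the section is onto as well.\<close>

lemma essential_map_iso:
  assumes C: "category C" and \<phi>: "kmod_hom R C A B \<phi>"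
    and p: "essential R C A p" and q: "essential R C B q"
    and inj: "\<And>c x y. \<lbrakk>c \<in> Obj C; x \<in> carrier (Val A c); y \<in> carrier (Val A c); q c (\<phi> c x) = q c (\<phi> c y)\<rbrakk>
      \<Longrightarrow> p c x = p c y"
    and im: "\<And>c y. \<lbrakk>c \<in> Obj C; y \<in> carrier (Val B c)\<rbrakk> \<Longrightarrow> \<exists>x \<in> carrier (Val A c). q c (\<phi> c x) = q c y"
    and split: "kmod_epi R C A B \<phi> \<Longrightarrow>
      \<exists>s. kmod_hom R C B A s \<and> (\<forall>c \<in> Obj C. \<forall>y \<in> carrier (Val B c). \<phi> c (s c y) = y)"
  shows "kmod_iso R C A B \<phi>"
proof (rule kmod_isoI[OF \<phi>])
  note A = kmod_homD(1)[OF \<phi>] and B = kmod_homD(2)[OF \<phi>]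
  have "\<phi> c ` carrier (Val A c) = carrier (Val B c)" if "c \<in> Obj C" for c
    by (rule essentialD[OF q kmod_sub_hom_range[OF \<phi> C] _ B that]) (use im in blast)
  then have "kmod_epi R C A B \<phi>" using \<phi> by (simp add: kmod_epi_def)
  then obtain s where s: "kmod_hom R C B A s"
    and \<phi>s: "\<And>c y. \<lbrakk>c \<in> Obj C; y \<in> carrier (Val B c)\<rbrakk> \<Longrightarrow> \<phi> c (s c y) = y" using split by blast
  have onto: "s c ` carrier (Val B c) = carrier (Val A c)" if "c \<in> Obj C" for c
  proof (rule essentialD[OF p kmod_sub_hom_range[OF s C] _ A that])
    fix c x assume c: "c \<in> Obj C" and x: "x \<in> carrier (Val A c)"
    note \<phi>x = kmod_hom_closed[OF \<phi> c x]
    have "p c (s c (\<phi> c x)) = p c x"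
      by (rule inj[OF c kmod_hom_closed[OF s c \<phi>x] x]) (simp add: \<phi>s[OF c \<phi>x])
    then show "\<exists>y \<in> s c ` carrier (Val B c). p c y = p c x" using \<phi>x by blast
  qed
  show "x = y" if "c \<in> Obj C" "x \<in> carrier (Val A c)" "y \<in> carrier (Val A c)" "\<phi> c x = \<phi> c y" for c x y
    using that onto[OF that(1)] \<phi>s[OF that(1)] by (metis imageE)
  show "\<exists>x \<in> carrier (Val A c). \<phi> c x = y" if "c \<in> Obj C" "y \<in> carrier (Val B c)" for c y
    using \<phi>s[OF that] kmod_hom_closed[OF s that] by blast
qed

text \<open>The elements of \<open>L\<close> over an upward closed set \<open>U\<close> of objects form a submodule. If \<open>M\<close> vanishes
  outside \<open>U\<close>, this submodule has the same image in \<open>M\<close> as \<open>L\<close>, hence is all of \<open>L\<close>.\<close>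

lemma essential_supp:
  assumes C: "category C" and f: "kmod_hom R C L M f" and ess: "essential R C L f"
    and up: "\<And>a b u. \<lbrakk>a \<in> U; u \<in> Hom C a b\<rbrakk> \<Longrightarrow> b \<in> U"
    and M0: "\<And>c. \<lbrakk>c \<in> Obj C; c \<notin> U\<rbrakk> \<Longrightarrow> \<not> nonzero (Val M c)"
    and c: "c \<in> Obj C" "c \<notin> U"
  shows "\<not> nonzero (Val L c)"
proof -
  note L = kmod_homD(1)[OF f] and M = kmod_homD(2)[OF f]
  let ?K = "\<lambda>c. if c \<in> U then carrier (Val L c) else {\<zero>\<^bsub>Val L c\<^esub>}"
  have K: "kmod_sub R C L ?K"
  proof (rule kmod_subI)
    show "submodule (?K c) R (Val L c)" if "c \<in> Obj C" for c
      using kmoduleD(1)[OF L that] module.carrier_is_submodule zero_submodule by auto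
    show "Act L u x \<in> ?K b" if "u \<in> Hom C a b" "x \<in> ?K a" for u a b x
    proof -
      note ab = Hom_Obj[OF C that(1)]
      note ma = kmoduleD(1)[OF L ab(1)] and mb = kmoduleD(1)[OF L ab(2)]
      have "Act L u \<zero>\<^bsub>Val L a\<^esub> = \<zero>\<^bsub>Val L b\<^esub>" by (rule linear_zero[OF ma mb kmodule_Act[OF L that(1)]])
      then show ?thesis
        using that up[OF _ that(1)] kmodule_Act_closed[OF L that(1)] module_zero_closed[OF mb]
        by (auto split: if_splits)
    qed
  qed
  have "?K c = carrier (Val L c)"
  proof (rule essentialD[OF ess K _ L c(1)])
    fix c x assume c: "c \<in> Obj C" and x: "x \<in> carrier (Val L c)"
    show "\<exists>y \<in> ?K c. f c y = f c x"
    proof (cases "c \<in> U")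
      case False
      then have "f c x = \<zero>\<^bsub>Val M c\<^esub>"
        using M0[OF c] kmod_hom_closed[OF f c x] by (simp add: not_nonzero_iff)
      then show ?thesis
        using False linear_zero[OF kmoduleD(1)[OF L c] kmoduleD(1)[OF M c] kmod_homD(3)[OF f c]] by simp
    qed (use x in auto)
  qed
  then show ?thesis using c(2) by (simp add: not_nonzero_iff)
qed

section \<open>Generation along a functor\<close>

text \<open>\<open>L\<close> is generated by its values on the image of \<open>F\<close>. Asking this of all submodules, rather
  than of the one spanned by these values, avoids any computation with spans.\<close>

definition generated_along :: "'r ring \<Rightarrow> ('o, 'a) cat \<Rightarrow> ('p, 'b) cat \<Rightarrow> ('o, 'a, 'p, 'b) catfun \<Rightarrow>
    ('p, 'b, 'r, 'm) cmod \<Rightarrow> bool" where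
  "generated_along R B D F L \<longleftrightarrow> (\<forall>K. kmod_sub R D L K
     \<and> (\<forall>b \<in> Obj B. carrier (Val L (fobj F b)) \<subseteq> K (fobj F b)) \<longrightarrow> (\<forall>d \<in> Obj D. carrier (Val L d) \<subseteq> K d))"

lemma generated_alongD:
  assumes "generated_along R B D F L" "kmod_sub R D L K"
    "\<And>b x. \<lbrakk>b \<in> Obj B; x \<in> carrier (Val L (fobj F b))\<rbrakk> \<Longrightarrow> x \<in> K (fobj F b)"
    "d \<in> Obj D" "x \<in> carrier (Val L d)"
  shows "x \<in> K d"
  using assms unfolding generated_along_def by blast

text \<open>For a submodule \<open>K\<close> of the restriction, the elements of \<open>L(d)\<close> that every arrow into the image
  of \<open>F\<close> sends to \<open>K\<close> form a submodule of \<open>L\<close>, and fullness of \<open>F\<close> makes it extend \<open>K\<close>.\<close>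

lemma essential_restrict:
  assumes F: "fully_faithful B D F" and f: "kmod_hom R D L M f" and ess: "essential R D L f"
    and gen: "generated_along R B D F L"
  shows "essential R B (res F L) (res_hom F f)"
  unfolding essential_def
proof (intro allI impI ballI)
  note Ff = fully_faithful_functor[OF F]
  note D = functorD(2)[OF Ff]
  note L = kmod_homD(1)[OF f]
  fix K b assume K: "kmod_sub R B (res F L) K \<and>
    (\<forall>c \<in> Obj B. res_hom F f c ` K c = res_hom F f c ` carrier (Val (res F L) c))" and b: "b \<in> Obj B"
  have Ksub: "submodule (K b) R (Val L (fobj F b))" if "b \<in> Obj B" for b
    using K that by (simp add: kmod_sub_def res_def)
  have Kact: "Act L (farr F u) x \<in> K b" if "u \<in> Hom B a b" "x \<in> K a" for u a b x
    using K that by (auto simp: kmod_sub_def res_def Hom_def)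
  have fK: "f (fobj F b) ` K b = f (fobj F b) ` carrier (Val L (fobj F b))" if "b \<in> Obj B" for b
    using K that by (simp add: res_def res_hom_def)
  define J where "J d = {(b, v). b \<in> Obj B \<and> v \<in> Hom D d (fobj F b)}" for d
  define E where "E d = {x \<in> carrier (Val L d). \<forall>i \<in> J d. Act L (snd i) x \<in> K (fst i)}" for d
  have E: "kmod_sub R D L E"
  proof (rule kmod_subI)
    show "submodule (E d) R (Val L d)" if d: "d \<in> Obj D" for d
      unfolding E_def
      by (rule preimage_submodule[where N = "\<lambda>i. Val L (fobj F (fst i))"])
        (use kmoduleD(1)[OF L] d Ksub functorD(3)[OF Ff] kmodule_Act[OF L] in \<open>auto simp: J_def\<close>)
    fix w a d x assume w: "w \<in> Hom D a d" and x: "x \<in> E a"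
    have xc: "x \<in> carrier (Val L a)" using x by (simp add: E_def)
    have "Act L v (Act L w x) \<in> K b" if "b \<in> Obj B" "v \<in> Hom D d (fobj F b)" for b v
      using x that category.Comp_Hom[OF D w that(2)] kmoduleD(4)[OF L w that(2) xc, symmetric]
      by (auto simp: E_def J_def)
    then show "Act L w x \<in> E d" using kmodule_Act_closed[OF L w xc] by (auto simp: E_def J_def)
  qed
  have EF: "E (fobj F b) = K b" if b: "b \<in> Obj B" for b
  proof
    have "x \<in> K b" if x: "x \<in> E (fobj F b)" for x
    proof -
      note Fb = functorD(3)[OF Ff b]
      have "(b, Id D (fobj F b)) \<in> J (fobj F b)" using b category.Id_Hom[OF D Fb] by (simp add: J_def)
      then have "Act L (Id D (fobj F b)) x \<in> K b" using x by (auto simp: E_def)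
      then show ?thesis using kmoduleD(3)[OF L Fb] x by (simp add: E_def)
    qed
    then show "E (fobj F b) \<subseteq> K b" by blast
    have "Act L v x \<in> K b'" if x: "x \<in> K b" and b': "b' \<in> Obj B" and v: "v \<in> Hom D (fobj F b) (fobj F b')" for x b' v
      using fully_faithfulD(2)[OF F b b' v] Kact[OF _ x] by blast
    then show "K b \<subseteq> E (fobj F b)"
      using submoduleD(1)[OF kmoduleD(1)[OF L functorD(3)[OF Ff b]] Ksub[OF b]] by (auto simp: E_def J_def)
  qed
  have "E d = carrier (Val L d)" if "d \<in> Obj D" for d
  proof (rule essentialD[OF ess E _ L that])
    fix d x assume d: "d \<in> Obj D" and x: "x \<in> carrier (Val L d)"
    have "x \<in> {x \<in> carrier (Val L d). f d x \<in> f d ` E d}"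
    proof (rule generated_alongD[OF gen kmod_sub_preimage[OF f D kmod_sub_image[OF f D E]] _ d x])
      show "x \<in> {x \<in> carrier (Val L (fobj F b)). f (fobj F b) x \<in> f (fobj F b) ` E (fobj F b)}"
        if "b \<in> Obj B" "x \<in> carrier (Val L (fobj F b))" for b x
        using fK[OF that(1)] that EF[OF that(1)] by simp
    qed
    then show "\<exists>y \<in> E d. f d y = f d x" by auto
  qed
  then show "K b = carrier (Val (res F L) b)"
    using EF[OF b] functorD(3)[OF Ff b] by (simp add: res_def)
qed

section \<open>Minimal supports\<close>

text \<open>Vanishing of the splitting, without quotients and spans: no proper submodule contains the images of
  all non-isomorphisms.\<close>

lemma splitting_zero_iff:
  assumes C: "category C" and L: "kmodule R C L" and c: "c \<in> Obj C"
  shows "\<not> nonzero (splitting R C L c) \<longleftrightarrow> (\<forall>H. submodule H R (Val L c) \<and>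
    (\<forall>b u x. u \<in> Hom C b c \<and> \<not> iso_arr C u \<and> x \<in> carrier (Val L b) \<longrightarrow> Act L u x \<in> H) \<longrightarrow>
      carrier (Val L c) \<subseteq> H)"
proof -
  let ?S = "\<Union>u \<in> {u \<in> Arr C. Cod C u = c \<and> \<not> iso_arr C u}. Act L u ` carrier (Val L (Dom C u))"
  let ?H = "span R (Val L c) ?S"
  note m = kmoduleD(1)[OF L c]
  have S: "?S \<subseteq> carrier (Val L c)"
    using kmodule_Act_closed[OF L Arr_Hom] by blast
  note H = span_submodule[OF m S]
  have S_sub: "?S \<subseteq> H \<longleftrightarrow>
    (\<forall>b u x. u \<in> Hom C b c \<and> \<not> iso_arr C u \<and> x \<in> carrier (Val L b) \<longrightarrow> Act L u x \<in> H)" for H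
    by (auto simp: Hom_def)
  interpret Q: module R "quot_module (Val L c) ?H" by (rule quot_module_module(1)[OF m H(1)])
  have "\<not> nonzero (splitting R C L c) \<longleftrightarrow> carrier (Val L c) \<subseteq> ?H"
    unfolding splitting_def not_nonzero_iff
  proof
    assume *: "carrier (quot_module (Val L c) ?H) = {\<zero>\<^bsub>quot_module (Val L c) ?H\<^esub>}"
    show "carrier (Val L c) \<subseteq> ?H"
    proof
      fix x assume x: "x \<in> carrier (Val L c)"
      then have "?H +>\<^bsub>Val L c\<^esub> x \<in> carrier (quot_module (Val L c) ?H)" using quot_carrier by blast
      then have "?H +>\<^bsub>Val L c\<^esub> x = ?H" unfolding * by (simp add: quot_module_def)
      then show "x \<in> ?H" using coset_self[OF m H(1) x] by simp
    qed
  next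
    assume sub: "carrier (Val L c) \<subseteq> ?H"
    interpret m: module R "Val L c" by (rule m)
    have "X = Y" if XY: "X \<in> carrier (quot_module (Val L c) ?H)" "Y \<in> carrier (quot_module (Val L c) ?H)" for X Y
    proof -
      obtain x y where x: "x \<in> carrier (Val L c)" "X = ?H +>\<^bsub>Val L c\<^esub> x"
        and y: "y \<in> carrier (Val L c)" "Y = ?H +>\<^bsub>Val L c\<^esub> y"
        using XY unfolding quot_carrier by blast
      have "x \<ominus>\<^bsub>Val L c\<^esub> y \<in> ?H" by (rule subsetD[OF sub m.M.minus_closed[OF x(1) y(1)]])
      then show "X = Y" unfolding x(2) y(2) using coset_eq_iff[OF m H(1) x(1) y(1)] by blast
    qed
    then show "carrier (quot_module (Val L c) ?H) = {\<zero>\<^bsub>quot_module (Val L c) ?H\<^esub>}"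
      using Q.M.zero_closed by blast
  qed
  also have "\<dots> \<longleftrightarrow> (\<forall>H. submodule H R (Val L c) \<and> ?S \<subseteq> H \<longrightarrow> carrier (Val L c) \<subseteq> H)"
  proof
    assume sub: "carrier (Val L c) \<subseteq> ?H"
    show "\<forall>H. submodule H R (Val L c) \<and> ?S \<subseteq> H \<longrightarrow> carrier (Val L c) \<subseteq> H"
    proof (intro allI impI)
      fix H assume "submodule H R (Val L c) \<and> ?S \<subseteq> H"
      then have "?H \<subseteq> H" unfolding span_def by (intro hull_minimal) auto
      with sub show "carrier (Val L c) \<subseteq> H" by (rule subset_trans)
    qed
  next
    assume "\<forall>H. submodule H R (Val L c) \<and> ?S \<subseteq> H \<longrightarrow> carrier (Val L c) \<subseteq> H"
    then show "carrier (Val L c) \<subseteq> ?H" using H by (elim allE[of _ ?H]) blast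
  qed
  finally show ?thesis unfolding S_sub .
qed

lemma splitting_zeroD:
  assumes "\<not> nonzero (splitting R C L c)" "category C" "kmodule R C L" "c \<in> Obj C" "submodule H R (Val L c)"
    and "\<And>b u x. \<lbrakk>u \<in> Hom C b c; \<not> iso_arr C u; x \<in> carrier (Val L b)\<rbrakk> \<Longrightarrow> Act L u x \<in> H"
    and "x \<in> carrier (Val L c)"
  shows "x \<in> H"
  using assms(1)[unfolded splitting_zero_iff[OF assms(2-4)]] assms(5-7) by blast

lemma splitting_zeroI:
  assumes "category C" "kmodule R C L" "c \<in> Obj C"
    and "\<And>H x. \<lbrakk>submodule H R (Val L c);
      \<And>b u x. \<lbrakk>u \<in> Hom C b c; \<not> iso_arr C u; x \<in> carrier (Val L b)\<rbrakk> \<Longrightarrow> Act L u x \<in> H;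
      x \<in> carrier (Val L c)\<rbrakk> \<Longrightarrow> x \<in> H"
  shows "\<not> nonzero (splitting R C L c)"
  unfolding splitting_zero_iff[OF assms(1-3)] using assms(4) by blast

lemma preimage_submodule1:
  assumes "module R M" "module R N" "h \<in> linear_maps R M N" "submodule H R N"
  shows "submodule {x \<in> carrier M. h x \<in> H} R M"
  using preimage_submodule[of R M "{()}" "\<lambda>_. N" "\<lambda>_. h" "\<lambda>_. H"] assms by simp

text \<open>Composing a non-isomorphism into \<open>c\<close> with \<open>i\<close> gives a non-isomorphism into \<open>d\<close>, so the
  preimage along \<open>i\<close> of a submodule that tests the splitting at \<open>d\<close> tests the splitting at \<open>c\<close>.\<close>

lemma splitting_zero_iso_arr:
  assumes EI: "EI_category C" and L: "kmodule R C L" and i: "i \<in> Hom C c d" "iso_arr C i"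
    and z: "\<not> nonzero (splitting R C L c)"
  shows "\<not> nonzero (splitting R C L d)"
proof -
  have C: "category C" using EI by (simp add: EI_category_def)
  note cd = Hom_Obj[OF C i(1)]
  obtain j where j: "j \<in> Hom C d c" "Comp C i j = Id C d" using iso_arrE[OF i(2,1)] by metis
  show ?thesis
  proof (rule splitting_zeroI[OF C L cd(2)])
    fix H y assume H: "submodule H R (Val L d)" and y: "y \<in> carrier (Val L d)"
      and im: "\<And>b u x. \<lbrakk>u \<in> Hom C b d; \<not> iso_arr C u; x \<in> carrier (Val L b)\<rbrakk> \<Longrightarrow> Act L u x \<in> H"
    have "Act L j y \<in> {x \<in> carrier (Val L c). Act L i x \<in> H}"
    proof (rule splitting_zeroD[OF z C L cd(1)])
      show "submodule {x \<in> carrier (Val L c). Act L i x \<in> H} R (Val L c)"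
        by (rule preimage_submodule1[OF kmoduleD(1)[OF L cd(1)] kmoduleD(1)[OF L cd(2)] kmodule_Act[OF L i(1)] H])
      show "Act L u x \<in> {x \<in> carrier (Val L c). Act L i x \<in> H}"
        if u: "u \<in> Hom C b c" "\<not> iso_arr C u" and x: "x \<in> carrier (Val L b)" for b u x
        using im[OF category.Comp_Hom[OF C u(1) i(1)] _ x] EI_iso_factors(2)[OF EI u(1) i(1)] u(2)
          kmoduleD(4)[OF L u(1) i(1) x] kmodule_Act_closed[OF L u(1) x] by auto
      show "Act L j y \<in> carrier (Val L c)" by (rule kmodule_Act_closed[OF L j(1) y])
    qed
    then have "Act L (Comp C i j) y \<in> H" using kmoduleD(4)[OF L j(1) i(1) y] by simp
    then show "y \<in> H" using j(2) kmoduleD(3)[OF L cd(2) y] by simp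
  qed
qed

lemma cl_in_minsupp_iff:
  assumes EI: "EI_category C" and L: "kmodule R C L" and c: "c \<in> Obj C"
  shows "cl C c \<in> minsupp R C L \<longleftrightarrow> nonzero (splitting R C L c)"
proof
  have C: "category C" using EI by (simp add: EI_category_def)
  assume "cl C c \<in> minsupp R C L"
  then obtain d where d: "d \<in> Obj C" "cl C c = cl C d" "nonzero (splitting R C L d)"
    by (auto simp: minsupp_def)
  then obtain u where "u \<in> Hom C c d" "iso_arr C u" using cl_eq_iff[OF C c d(1)] by blast
  then show "nonzero (splitting R C L c)" using splitting_zero_iso_arr[OF EI L] d(3) by blast
qed (use c in \<open>auto simp: minsupp_def\<close>)

lemma splitting_zero_kmod_iso:
  assumes C: "category C" and g: "kmod_iso R C L M g" and c: "c \<in> Obj C"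
    and z: "\<not> nonzero (splitting R C L c)"
  shows "\<not> nonzero (splitting R C M c)"
proof (rule splitting_zeroI[OF C _ c])
  note gh = kmod_isoD[OF g]
  note L = kmod_homD(1)[OF gh]
  show M: "kmodule R C M" by (rule kmod_homD(2)[OF gh])
  fix H y assume H: "submodule H R (Val M c)" and y: "y \<in> carrier (Val M c)"
    and im: "\<And>b u x. \<lbrakk>u \<in> Hom C b c; \<not> iso_arr C u; x \<in> carrier (Val M b)\<rbrakk> \<Longrightarrow> Act M u x \<in> H"
  have "kinv L g c y \<in> {x \<in> carrier (Val L c). g c x \<in> H}"
  proof (rule splitting_zeroD[OF z C L c])
    show "submodule {x \<in> carrier (Val L c). g c x \<in> H} R (Val L c)"
      by (rule preimage_submodule1[OF kmoduleD(1)[OF L c] kmoduleD(1)[OF M c] kmod_homD(3)[OF gh c] H])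
    show "Act L u x \<in> {x \<in> carrier (Val L c). g c x \<in> H}"
      if u: "u \<in> Hom C b c" "\<not> iso_arr C u" and x: "x \<in> carrier (Val L b)" for b u x
      using im[OF u kmod_hom_closed[OF gh Hom_Obj(1)[OF C u(1)] x]] kmod_hom_nat[OF gh u(1) x]
        kmodule_Act_closed[OF L u(1) x] by simp
    show "kinv L g c y \<in> carrier (Val L c)" by (rule kinv(2)[OF g c y])
  qed
  then show "y \<in> H" using kinv(3)[OF g c y] by simp
qed

text \<open>A non-isomorphism into \<open>F(b)\<close> factors, on a module generated along \<open>F\<close>, through
  non-isomorphisms of \<open>B\<close>: precomposing it with an arrow out of the image of \<open>F\<close> never gives an
  isomorphism, since in an EI category both factors of an isomorphism are invertible.\<close>

lemma splitting_res_zero_iff: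
  assumes EI: "EI_category D" and F: "fully_faithful B D F" and L: "kmodule R D L"
    and rL: "kmodule R B (res F L)" and gen: "generated_along R B D F L" and b: "b \<in> Obj B"
  shows "\<not> nonzero (splitting R B (res F L) b) \<longleftrightarrow> \<not> nonzero (splitting R D L (fobj F b))"
proof
  note Ff = fully_faithful_functor[OF F]
  note B = functorD(1)[OF Ff] and D = functorD(2)[OF Ff]
  note Fb = functorD(3)[OF Ff b]
  have V: "Val (res F L) a = Val L (fobj F a)" "Act (res F L) u = Act L (farr F u)" for a u
    by (simp_all add: res_def)
  { assume z: "\<not> nonzero (splitting R B (res F L) b)"
    show "\<not> nonzero (splitting R D L (fobj F b))"
    proof (rule splitting_zeroI[OF D L Fb])
      fix H x assume H: "submodule H R (Val L (fobj F b))" and x: "x \<in> carrier (Val L (fobj F b))"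
        and im: "\<And>a u x. \<lbrakk>u \<in> Hom D a (fobj F b); \<not> iso_arr D u; x \<in> carrier (Val L a)\<rbrakk> \<Longrightarrow> Act L u x \<in> H"
      show "x \<in> H"
      proof (rule splitting_zeroD[OF z B rL b, unfolded V, OF H _ x])
        show "Act L (farr F u) x \<in> H"
          if u: "u \<in> Hom B a b" "\<not> iso_arr B u" and x: "x \<in> carrier (Val L (fobj F a))" for a u x
          by (rule im[OF functorD(4)[OF Ff u(1)] _ x]) (use fully_faithful_reflects_iso[OF F u(1)] u(2) in blast)
      qed
    qed }
  assume z: "\<not> nonzero (splitting R D L (fobj F b))"
  show "\<not> nonzero (splitting R B (res F L) b)"
  proof (rule splitting_zeroI[OF B rL b], unfold V)
    fix H x assume H: "submodule H R (Val L (fobj F b))" and x: "x \<in> carrier (Val L (fobj F b))"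
      and im: "\<And>a u x. \<lbrakk>u \<in> Hom B a b; \<not> iso_arr B u; x \<in> carrier (Val L (fobj F a))\<rbrakk> \<Longrightarrow> Act L (farr F u) x \<in> H"
    define J where "J d = {w \<in> Hom D d (fobj F b). \<not> iso_arr D w}" for d
    define E where "E d = {x \<in> carrier (Val L d). \<forall>w \<in> J d. Act L w x \<in> H}" for d
    have E: "kmod_sub R D L E"
    proof (rule kmod_subI)
      show "submodule (E d) R (Val L d)" if d: "d \<in> Obj D" for d
        unfolding E_def
        by (rule preimage_submodule[where N = "\<lambda>i. Val L (fobj F b)"])
          (use kmoduleD(1)[OF L] d Fb H kmodule_Act[OF L] in \<open>auto simp: J_def\<close>)
      fix v a d x assume v: "v \<in> Hom D a d" and x: "x \<in> E a"
      have xc: "x \<in> carrier (Val L a)" using x by (simp add: E_def)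
      have "Act L w (Act L v x) \<in> H" if w: "w \<in> Hom D d (fobj F b)" "\<not> iso_arr D w" for w
      proof -
        have "Comp D w v \<in> J a"
          using category.Comp_Hom[OF D v w(1)] EI_iso_factors(1)[OF EI v w(1)] w(2) by (auto simp: J_def)
        then show ?thesis using x kmoduleD(4)[OF L v w(1) xc, symmetric] by (auto simp: E_def)
      qed
      then show "Act L v x \<in> E d" using kmodule_Act_closed[OF L v xc] by (simp add: E_def J_def)
    qed
    have EF: "x \<in> E (fobj F a)" if a: "a \<in> Obj B" and x: "x \<in> carrier (Val L (fobj F a))" for a x
    proof -
      have "Act L w x \<in> H" if w: "w \<in> Hom D (fobj F a) (fobj F b)" "\<not> iso_arr D w" for w
      proof -
        obtain u where u: "u \<in> Hom B a b" "farr F u = w" using fully_faithfulD(2)[OF F a b w(1)] by blast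
        then show ?thesis using im[OF u(1) _ x] functor_iso[OF Ff u(1)] w(2) by blast
      qed
      then show ?thesis using x by (simp add: E_def J_def)
    qed
    show "x \<in> H"
    proof (rule splitting_zeroD[OF z D L Fb H _ x])
      show "Act L u x \<in> H"
        if u: "u \<in> Hom D a (fobj F b)" "\<not> iso_arr D u" and x: "x \<in> carrier (Val L a)" for a u x
        using generated_alongD[OF gen E EF Hom_Obj(1)[OF D u(1)] x] u by (simp add: E_def J_def)
    qed
  qed
qed

section \<open>Artinian supports\<close>

text \<open>A descending sequence of non-isomorphisms strictly decreases the isomorphism classes.\<close>

lemma Artinian_wf:
  assumes EI: "EI_category C" and art: "Artinian C S"
  shows "wf {(b, c). cl C b \<in> S \<and> cl C c \<in> S \<and> (\<exists>u \<in> Hom C b c. \<not> iso_arr C u)}"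
  unfolding wf_iff_no_infinite_down_chain
proof
  have C: "category C" using EI by (simp add: EI_category_def)
  assume "\<exists>f. \<forall>i. (f (Suc i), f i) \<in> {(b, c). cl C b \<in> S \<and> cl C c \<in> S \<and> (\<exists>u \<in> Hom C b c. \<not> iso_arr C u)}"
  then obtain f where S: "\<And>i. cl C (f i) \<in> S" and u: "\<And>i. \<exists>u \<in> Hom C (f (Suc i)) (f i). \<not> iso_arr C u"
    by blast
  have obj: "f i \<in> Obj C" for i using u[of i] Hom_Obj[OF C] by blast
  have "cl_le C (cl C (f (Suc i))) (cl C (f i))" for i using u[of i] obj by (auto simp: cl_le_def)
  then obtain N where N: "\<forall>n \<ge> N. cl C (f n) = cl C (f N)"
    using art[unfolded Artinian_def, rule_format, of "\<lambda>i. cl C (f i)"] S by blast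
  have "cl C (f N) = cl C (f (Suc N))" using N by (metis le_SucI le_refl)
  then obtain w where "w \<in> Hom C (f N) (f (Suc N))" using cl_eq_iff[OF C obj obj] by blast
  with u[of N] EI_iso[OF EI] show False by blast
qed

lemma up_upper_set:
  assumes C: "category C" and S: "S \<subseteq> cl C ` Obj C"
  shows "upper_set C (up C S)" "S \<subseteq> up C S"
proof -
  have all: "upper_set C (cl C ` Obj C)" by (auto simp: upper_set_def cl_le_def)
  have eq: "up C S = \<Inter>{U. upper_set C U \<and> S \<subseteq> U}" by (simp add: up_def hull_def)
  show "upper_set C (up C S)"
    unfolding eq upper_set_def[of C "\<Inter>_"]
  proof (intro conjI ballI allI impI)
    show "\<Inter>{U. upper_set C U \<and> S \<subseteq> U} \<subseteq> cl C ` Obj C" using all S by blast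
    show "Y \<in> \<Inter>{U. upper_set C U \<and> S \<subseteq> U}" if "X \<in> \<Inter>{U. upper_set C U \<and> S \<subseteq> U}" "cl_le C X Y" for X Y
      using that unfolding upper_set_def by blast
  qed
  show "S \<subseteq> up C S" unfolding up_def by (rule hull_subset)
qed

text \<open>The analogue of Nakayama's lemma: where the splitting vanishes, the value of \<open>L\<close> comes from
  objects that lie strictly below, so well-founded induction applies.\<close>

lemma generated_along_minsupp:
  assumes EI: "EI_category D" and L: "kmodule R D L" and art: "Artinian D S"
    and supp: "\<And>d. \<lbrakk>d \<in> Obj D; cl D d \<notin> S\<rbrakk> \<Longrightarrow> \<not> nonzero (Val L d)"
    and F: "is_functor B D F"
    and min: "\<And>d. \<lbrakk>d \<in> Obj D; nonzero (splitting R D L d)\<rbrakk> \<Longrightarrow> \<exists>b \<in> Obj B. \<exists>u \<in> Hom D (fobj F b) d. iso_arr D u"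
  shows "generated_along R B D F L"
  unfolding generated_along_def
proof (intro allI impI ballI)
  have D: "category D" using EI by (simp add: EI_category_def)
  fix K d assume "kmod_sub R D L K \<and> (\<forall>b \<in> Obj B. carrier (Val L (fobj F b)) \<subseteq> K (fobj F b))" and d: "d \<in> Obj D"
  then have K: "kmod_sub R D L K" and KF: "\<And>b. b \<in> Obj B \<Longrightarrow> carrier (Val L (fobj F b)) \<subseteq> K (fobj F b)" by auto
  show "carrier (Val L d) \<subseteq> K d" using d
  proof (induction d rule: wf_induct_rule[OF Artinian_wf[OF EI art]])
    case (1 d)
    note d = \<open>d \<in> Obj D\<close>
    note Ksub = kmod_subD(1)[OF L K d]
    have zero: "Act L u x \<in> K d" if u: "u \<in> Hom D a d" and a: "a \<in> Obj D" and x: "x = \<zero>\<^bsub>Val L a\<^esub>" for u a x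
      unfolding x linear_zero[OF kmoduleD(1)[OF L a] kmoduleD(1)[OF L d] kmodule_Act[OF L u]]
      by (rule submoduleD(2)[OF kmoduleD(1)[OF L d] Ksub])
    show ?case
    proof (cases "cl D d \<in> S")
      case False
      then show ?thesis
        using supp[OF d] submoduleD(2)[OF kmoduleD(1)[OF L d] Ksub] by (simp add: not_nonzero_iff)
    next
      case dS: True
      show ?thesis
      proof (cases "nonzero (splitting R D L d)")
        case True
        then obtain b u where b: "b \<in> Obj B" and u: "u \<in> Hom D (fobj F b) d" "iso_arr D u"
          using min[OF d] by blast
        obtain v where v: "v \<in> Hom D d (fobj F b)" "Comp D u v = Id D d" using iso_arrE[OF u(2,1)] by metis
        show ?thesis
        proof
          fix x assume x: "x \<in> carrier (Val L d)"
          have "Act L v x \<in> K (fobj F b)" using kmodule_Act_closed[OF L v(1) x] KF[OF b] by blast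
          then have "Act L u (Act L v x) \<in> K d" by (rule kmod_subD(3)[OF L K u(1)])
          then show "x \<in> K d" using kmoduleD(4)[OF L v(1) u(1) x] v(2) kmoduleD(3)[OF L d x] by simp
        qed
      next
        case False
        show ?thesis
        proof
          fix x assume x: "x \<in> carrier (Val L d)"
          show "x \<in> K d"
          proof (rule splitting_zeroD[OF False D L d Ksub _ x])
            fix a u x assume u: "u \<in> Hom D a d" "\<not> iso_arr D u" and x: "x \<in> carrier (Val L a)"
            note a = Hom_Obj(1)[OF D u(1)]
            show "Act L u x \<in> K d"
            proof (cases "cl D a \<in> S")
              case True
              then have "x \<in> K a" using 1(1)[of a] a dS u x by blast
              then show ?thesis by (rule kmod_subD(3)[OF L K u(1)])
            next
              case False
              then show ?thesis using zero[OF u(1) a] supp[OF a] x by (simp add: not_nonzero_iff)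
            qed
          qed
        qed
      qed
    qed
  qed
qed

section \<open>Induction along a fully faithful functor\<close>

lemma kmodule_res_functor:
  assumes F: "is_functor B D F" and Y: "kmodule R D Y"
  shows "kmodule R B (res F Y)"
  unfolding kmodule_def
proof (intro conjI ballI impI)
  have V: "Val (res F Y) b = Val Y (fobj F b)" "Act (res F Y) u = Act Y (farr F u)" for b u
    by (simp_all add: res_def)
  show "module R (Val (res F Y) b)" if "b \<in> Obj B" for b
    using kmoduleD(1)[OF Y functorD(3)[OF F that]] by (simp add: V)
  show "Act (res F Y) u \<in> linear_maps R (Val (res F Y) (Dom B u)) (Val (res F Y) (Cod B u))" if "u \<in> Arr B" for u
    using kmodule_Act[OF Y functorD(4)[OF F Arr_Hom[OF that]]] by (simp add: V)
  show "Act (res F Y) (Id B b) x = x" if "b \<in> Obj B" "x \<in> carrier (Val (res F Y) b)" for b x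
    using kmoduleD(3)[OF Y functorD(3)[OF F that(1)]] functorD(5)[OF F that(1)] that(2) by (simp add: V)
  show "Act (res F Y) (Comp B v u) x = Act (res F Y) v (Act (res F Y) u x)"
    if "u \<in> Arr B" "v \<in> Arr B" "Cod B u = Dom B v" "x \<in> carrier (Val (res F Y) (Dom B u))" for u v x
  proof -
    have u: "u \<in> Hom B (Dom B u) (Cod B u)" and v: "v \<in> Hom B (Cod B u) (Cod B v)"
      using that by (auto simp: Hom_def)
    show ?thesis
      using kmoduleD(4)[OF Y functorD(4)[OF F u] functorD(4)[OF F v]] functorD(6)[OF F u v] that(4)
      by (simp add: V)
  qed
qed

lemma kmod_hom_id: "kmodule R C L \<Longrightarrow> kmod_hom R C L L (\<lambda>c x. x)"
  by (rule kmod_homI) (auto intro: linear_mapsI)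

lemma kmod_hom_res:
  assumes F: "is_functor B D F" and g: "kmod_hom R D L M g"
  shows "kmod_hom R B (res F L) (res F M) (res_hom F g)"
proof (rule kmod_homI[OF kmodule_res_functor[OF F kmod_homD(1)[OF g]] kmodule_res_functor[OF F kmod_homD(2)[OF g]]])
  show "res_hom F g c \<in> linear_maps R (Val (res F L) c) (Val (res F M) c)" if "c \<in> Obj B" for c
    using kmod_homD(3)[OF g functorD(3)[OF F that]] by (simp add: res_def res_hom_def)
  show "res_hom F g b (Act (res F L) u x) = Act (res F M) u (res_hom F g a x)"
    if "u \<in> Hom B a b" "x \<in> carrier (Val (res F L) a)" for u a b x
    using kmod_hom_nat[OF g functorD(4)[OF F that(1)]] that(2) by (simp add: res_def res_hom_def)
qed

lemma res_chain_complex: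
  assumes F: "is_functor B D F" and P: "chain_complex R D P"
  shows "chain_complex R B (res_cplx F P)"
  unfolding chain_complex_def
proof (intro conjI allI ballI)
  show "kmodule R B (Ch (res_cplx F P) n)" for n
    using kmodule_res_functor[OF F, of R "Ch P n"] P by (simp add: res_cplx_def chain_complex_def)
  show "kmod_hom R B (Ch (res_cplx F P) (Suc n)) (Ch (res_cplx F P) n) (Diff (res_cplx F P) (Suc n))" for n
    using kmod_hom_res[OF F, of R "Ch P (Suc n)" "Ch P n" "Diff P (Suc n)"] P
    by (simp add: res_cplx_def chain_complex_def)
  show "Diff (res_cplx F P) (Suc n) c (Diff (res_cplx F P) (Suc (Suc n)) c x) = \<zero>\<^bsub>Val (Ch (res_cplx F P) n) c\<^esub>"
    if "c \<in> Obj B" "x \<in> carrier (Val (Ch (res_cplx F P) (Suc (Suc n))) c)" for n c x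
    using P functorD(3)[OF F that(1)] that(2) by (simp add: res_cplx_def res_def res_hom_def chain_complex_def)
qed

text \<open>The class of \<open>x\<close> in the summand indexed by \<open>(c, u)\<close>; under the description of the induced
  module as a tensor product with the representable functors this is \<open>u \<otimes> x\<close>.\<close>

definition ind_gen :: "'r ring \<Rightarrow> ('o, 'a) cat \<Rightarrow> ('p, 'b) cat \<Rightarrow> ('o, 'a, 'p, 'b) catfun \<Rightarrow>
    ('o, 'a, 'r, 'm) cmod \<Rightarrow> 'p \<Rightarrow> 'o \<Rightarrow> 'b \<Rightarrow> 'm \<Rightarrow> ('o \<times> 'b \<Rightarrow> 'm) set" where
  "ind_gen R C D F L d c u x = ind_class R C D F L d (ind_in C D F L d (c, u) x)"

context ind_setting
begin

lemma gen_linear: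
  assumes "c \<in> Obj C" "u \<in> Hom D (fobj \<alpha> c) d"
  shows "ind_gen R C D \<alpha> L d c u \<in> linear_maps R (Val L c) (V d)"
  using linear_comp[OF inn_lin[of "(c, u)" d] cls_lin] assms by (simp add: ind_gen_def[abs_def] I_iff)

lemma gen_closed:
  "\<lbrakk>c \<in> Obj C; u \<in> Hom D (fobj \<alpha> c) d; x \<in> carrier (Val L c)\<rbrakk> \<Longrightarrow> ind_gen R C D \<alpha> L d c u x \<in> carrier (V d)"
  using linear_mapsD(1)[OF gen_linear] by metis

lemma gen_compat:
  assumes "v \<in> Hom C a b" "u \<in> Hom D (fobj \<alpha> b) d" "x \<in> carrier (Val L a)"
  shows "ind_gen R C D \<alpha> L d a (Comp D u (farr \<alpha> v)) x = ind_gen R C D \<alpha> L d b u (Act L v x)"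
  using cls_rel[of v u d x] assms by (auto simp: ind_gen_def Hom_def)

lemma Act_gen:
  assumes "c \<in> Obj C" "u \<in> Hom D (fobj \<alpha> c) d" "w \<in> Hom D d e" "x \<in> carrier (Val L c)"
  shows "A w (ind_gen R C D \<alpha> L d c u x) = ind_gen R C D \<alpha> L e c (Comp D w u) x"
  using A_inn[of w c u x] assms by (auto simp: ind_gen_def I_iff Hom_def)

lemma unit_gen: "unit c = ind_gen R C D \<alpha> L (fobj \<alpha> c) c (Id D (fobj \<alpha> c))"
  by (auto simp: ind_unit_def ind_gen_def)

lemma Act_unit:
  assumes "c \<in> Obj C" "u \<in> Hom D (fobj \<alpha> c) d" "x \<in> carrier (Val L c)"
  shows "A u (unit c x) = ind_gen R C D \<alpha> L d c u x"
  using Act_gen[OF assms(1) category.Id_Hom[OF D f_obj[OF assms(1)]] assms(2,3)]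
    category.Comp_Id[OF D assms(2)] by (simp add: unit_gen)

lemma eq_on_gen:
  assumes "module R N" "g \<in> linear_maps R (V d) N" "h \<in> linear_maps R (V d) N"
    and "\<And>c u x. \<lbrakk>c \<in> Obj C; u \<in> Hom D (fobj \<alpha> c) d; x \<in> carrier (Val L c)\<rbrakk>
      \<Longrightarrow> g (ind_gen R C D \<alpha> L d c u x) = h (ind_gen R C D \<alpha> L d c u x)"
    and "X \<in> carrier (V d)"
  shows "g X = h X"
  by (rule V_linear_eq[OF assms(1-3) _ assms(5)])
    (use assms(4) in \<open>auto simp: ind_gen_def ind_index_def\<close>)

text \<open>Linear maps out of an induced module are determined on the \<open>ind_gen\<close>, so the projection
  modulo a submodule that contains these vanishes.\<close>

lemma submodule_gen:
  assumes H: "submodule K R (V d)" and X: "X \<in> carrier (V d)"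
    and gen: "\<And>c u x. \<lbrakk>c \<in> Obj C; u \<in> Hom D (fobj \<alpha> c) d; x \<in> carrier (Val L c)\<rbrakk>
      \<Longrightarrow> ind_gen R C D \<alpha> L d c u x \<in> K"
  shows "X \<in> K"
proof -
  interpret V: module R "V d" by (rule V_mod)
  let ?Q = "quot_module (V d) K"
  note Q = quot_module_module[OF V_mod H]
  interpret Q: module R ?Q by (rule Q(1))
  have z: "\<zero>\<^bsub>?Q\<^esub> = K +>\<^bsub>V d\<^esub> \<zero>\<^bsub>V d\<^esub>" using linear_zero[OF V_mod Q(1,2)] by simp
  have n0: "\<ominus>\<^bsub>V d\<^esub> \<zero>\<^bsub>V d\<^esub> = \<zero>\<^bsub>V d\<^esub>" by (rule V.M.minus_equality) simp_all
  have kz: "K +>\<^bsub>V d\<^esub> y = \<zero>\<^bsub>?Q\<^esub> \<longleftrightarrow> y \<in> K" if "y \<in> carrier (V d)" for y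
    unfolding z using coset_eq_iff[OF V_mod H that V.M.zero_closed] that n0
    by (simp add: a_minus_def)
  have "K +>\<^bsub>V d\<^esub> X = \<zero>\<^bsub>?Q\<^esub>"
  proof (rule eq_on_gen[OF Q(1,2) _ _ X])
    show "(\<lambda>_. \<zero>\<^bsub>?Q\<^esub>) \<in> linear_maps R (V d) ?Q" by (rule linear_mapsI) simp_all
    show "K +>\<^bsub>V d\<^esub> ind_gen R C D \<alpha> L d c u x = \<zero>\<^bsub>?Q\<^esub>"
      if "c \<in> Obj C" "u \<in> Hom D (fobj \<alpha> c) d" "x \<in> carrier (Val L c)" for c u x
      using kz[OF gen_closed[OF that]] gen[OF that] by simp
  qed
  then show ?thesis using kz[OF X] by simp
qed

text \<open>Every \<open>u \<otimes> x\<close> is the image under \<open>u\<close> of the value of the unit at \<open>x\<close>.\<close>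

lemma ind_generated: "generated_along R C D \<alpha> (ind R C D \<alpha> L)"
  unfolding generated_along_def
proof (intro allI impI ballI subsetI)
  fix K d X assume "kmod_sub R D (ind R C D \<alpha> L) K \<and> (\<forall>b \<in> Obj C. carrier (V (fobj \<alpha> b)) \<subseteq> K (fobj \<alpha> b))"
    and d: "d \<in> Obj D" and X: "X \<in> carrier (V d)"
  then have K: "kmod_sub R D (ind R C D \<alpha> L) K"
    and KF: "\<And>c. c \<in> Obj C \<Longrightarrow> carrier (V (fobj \<alpha> c)) \<subseteq> K (fobj \<alpha> c)" by auto
  note KD = kmod_subD[OF ind_kmodule K]
  show "X \<in> K d"
  proof (rule submodule_gen[OF KD(1)[OF d] X])
    fix c u x assume cux: "c \<in> Obj C" "u \<in> Hom D (fobj \<alpha> c) d" "x \<in> carrier (Val L c)"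
    have "unit c x \<in> K (fobj \<alpha> c)"
      using KF[OF cux(1)] gen_closed[OF cux(1) category.Id_Hom[OF D f_obj[OF cux(1)]] cux(3)]
      by (auto simp: unit_gen)
    then show "ind_gen R C D \<alpha> L d c u x \<in> K d" using KD(3)[OF cux(2)] Act_unit[OF cux] by metis
  qed
qed

text \<open>By fullness, \<open>u \<otimes> x\<close> with \<open>u = \<alpha>(t)\<close> equals \<open>1 \<otimes> L(t)(x)\<close>.\<close>

lemma unit_onto:
  assumes ff: "fully_faithful C D \<alpha>" and c: "c \<in> Obj C" and X: "X \<in> carrier (V (fobj \<alpha> c))"
  shows "X \<in> unit c ` carrier (Val L c)"
proof (rule submodule_gen[OF _ X])
  note id = category.Id_Hom[OF D f_obj[OF c]]
  show "submodule (unit c ` carrier (Val L c)) R (V (fobj \<alpha> c))"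
    unfolding unit_gen by (rule image_submodule[OF L_mod[OF c] V_mod gen_linear[OF c id]])
  fix a u x assume a: "a \<in> Obj C" and u: "u \<in> Hom D (fobj \<alpha> a) (fobj \<alpha> c)" and x: "x \<in> carrier (Val L a)"
  obtain t where t: "t \<in> Hom C a c" "farr \<alpha> t = u" using fully_faithfulD(2)[OF ff a c u] by blast
  have "ind_gen R C D \<alpha> L (fobj \<alpha> c) a u x = unit c (Act L t x)"
    using gen_compat[OF t(1) id x] category.Id_Comp[OF D u] t(2) by (simp add: unit_gen)
  then show "ind_gen R C D \<alpha> L (fobj \<alpha> c) a u x \<in> unit c ` carrier (Val L c)"
    using kmodule_Act_closed[OF L t(1) x] by blast
qed

text \<open>The unit has a retraction at \<open>c\<close>, given by \<open>\<alpha>(t) \<otimes> x \<mapsto> L(t)(x)\<close>; it is well defined because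
  \<open>\<alpha>\<close> is full and faithful.\<close>

lemma unit_inj:
  assumes ff: "fully_faithful C D \<alpha>" and c: "c \<in> Obj C"
  shows "inj_on (unit c) (carrier (Val L c))"
proof -
  define t where "t a u = inv_into (Hom C a c) (farr \<alpha>) u" for a u
  have t: "t a u \<in> Hom C a c" "farr \<alpha> (t a u) = u" if "a \<in> Obj C" "u \<in> Hom D (fobj \<alpha> a) (fobj \<alpha> c)" for a u
    using fully_faithfulD(2)[OF ff that(1) c that(2)]
    unfolding t_def by (auto intro: inv_into_into f_inv_into_f)
  have tF: "t a (farr \<alpha> v) = v" if "a \<in> Obj C" "v \<in> Hom C a c" for a v
    unfolding t_def using fully_faithfulD(1)[OF ff that(1) c] that(2) by simp
  let ?h = "\<lambda>(a, u). Act L (t a u)"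
  have lin: "?h i \<in> linear_maps R (Val L (fst i)) (Val L c)" if "i \<in> I (fobj \<alpha> c)" for i
    using that kmodule_Act[OF L t(1)] by (auto simp: ind_index_def)
  have compat: "?h (Dom C v, Comp D u (farr \<alpha> v)) x = ?h (Cod C v, u) (Act L v x)"
    if "v \<in> Arr C" "u \<in> Hom D (fobj \<alpha> (Cod C v)) (fobj \<alpha> c)" "x \<in> carrier (Val L (Dom C v))" for v u x
  proof -
    note v = Arr_Hom[OF that(1)] and tu = t[OF Cod_C[OF that(1)] that(2)]
    have "Comp D u (farr \<alpha> v) = farr \<alpha> (Comp C (t (Cod C v) u) v)"
      using functorD(6)[OF \<alpha> v tu(1)] tu(2) by simp
    then have "t (Dom C v) (Comp D u (farr \<alpha> v)) = Comp C (t (Cod C v) u) v"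
      using tF[OF Dom_C[OF that(1)] category.Comp_Hom[OF C v tu(1)]] by simp
    then show ?thesis using kmoduleD(4)[OF L v tu(1) that(3)] by simp
  qed
  note id = category.Id_Hom[OF C c]
  have "the_elem (out (Val L c) ?h (fobj \<alpha> c) ` unit c x) = x" if x: "x \<in> carrier (Val L c)" for x
  proof -
    note iI = unit_I[OF c]
    have x': "x \<in> carrier (Val L (fst (c, Id D (fobj \<alpha> c))))" using x by simp
    have "the_elem (out (Val L c) ?h (fobj \<alpha> c) ` unit c x) = ?h (c, Id D (fobj \<alpha> c)) x"
      unfolding ind_unit_def
      using descend_the_elem[OF L_mod[OF c] lin compat inn_carrier[OF iI x']]
        out_inn[OF L_mod[OF c] lin compat iI x'] by simp
    also have "\<dots> = x" using tF[OF c id] f_id[OF c] kmoduleD(3)[OF L c x] by simp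
    finally show ?thesis .
  qed
  then show ?thesis by (rule inj_on_inverseI[where g = "\<lambda>X. the_elem (out (Val L c) ?h (fobj \<alpha> c) ` X)"])
qed

lemma adj_gen:
  assumes "kmodule R D Y" "kmod_hom R C L (res \<alpha> Y) g" "c \<in> Obj C" "u \<in> Hom D (fobj \<alpha> c) d" "x \<in> carrier (Val L c)"
  shows "ind_adj C D \<alpha> L Y g d (ind_gen R C D \<alpha> L d c u x) = Act Y u (g c x)"
  unfolding ind_gen_def
  by (rule adj_inn[OF assms(1,2) _ _ assms(5)]) (use assms(3,4) Hom_Obj(2)[OF D] in \<open>auto simp: I_iff\<close>)

end

lemma ind_setting_res:
  assumes "cring R" "is_functor C D F" "kmodule R D Y"
  shows "ind_setting R C D F (res F Y)"
  using assms kmodule_res_functor by (simp add: ind_setting_def)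

text \<open>Properties of the induced homomorphism follow from its values on the \<open>ind_gen\<close>.\<close>

lemma
  assumes R: "cring R" and F: "is_functor C D F" and g: "kmod_hom R C L L' g"
  shows ind_hom_hom: "kmod_hom R D (ind R C D F L) (ind R C D F L') (ind_hom R C D F L L' g)"
    and ind_hom_gen: "\<lbrakk>c \<in> Obj C; u \<in> Hom D (fobj F c) d; x \<in> carrier (Val L c)\<rbrakk> \<Longrightarrow>
      ind_hom R C D F L L' g d (ind_gen R C D F L d c u x) = ind_gen R C D F L' d c u (g c x)"
proof -
  interpret L: ind_setting R C D F L using R F kmod_homD(1)[OF g] by (rule ind_setting.intro)
  interpret L': ind_setting R C D F L' using R F kmod_homD(2)[OF g] by (rule ind_setting.intro)
  have ug: "kmod_hom R C L (res F (ind R C D F L')) (hcomp (ind_unit R C D F L') g)"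
    by (rule kmod_hom_comp[OF L.C g L'.unit_hom])
  show "kmod_hom R D (ind R C D F L) (ind R C D F L') (ind_hom R C D F L L' g)"
    unfolding ind_hom_def by (rule L.adj_hom[OF L'.ind_kmodule ug])
  show "ind_hom R C D F L L' g d (ind_gen R C D F L d c u x) = ind_gen R C D F L' d c u (g c x)"
    if "c \<in> Obj C" "u \<in> Hom D (fobj F c) d" "x \<in> carrier (Val L c)"
    using L.adj_gen[OF L'.ind_kmodule ug that] L'.Act_unit[OF that(1,2) kmod_hom_closed[OF g that(1,3)]]
    by (simp add: ind_hom_def hcomp_def)
qed

lemma ind_hom_unit:
  assumes R: "cring R" and F: "is_functor C D F" and g: "kmod_hom R C L L' g"
    and c: "c \<in> Obj C" and x: "x \<in> carrier (Val L c)"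
  shows "ind_hom R C D F L L' g (fobj F c) (ind_unit R C D F L c x) = ind_unit R C D F L' c (g c x)"
proof -
  interpret L: ind_setting R C D F L using R F kmod_homD(1)[OF g] by (rule ind_setting.intro)
  interpret L': ind_setting R C D F L' using R F kmod_homD(2)[OF g] by (rule ind_setting.intro)
  show ?thesis
    unfolding L.unit_gen L'.unit_gen
    by (rule ind_hom_gen[OF R F g c category.Id_Hom[OF L.D L.f_obj[OF c]] x])
qed

lemma kmod_homs_eq_on_gen:
  assumes R: "cring R" and F: "is_functor C D F" and L: "kmodule R C L"
    and g: "kmod_hom R D (ind R C D F L) Y g" and h: "kmod_hom R D (ind R C D F L) Y h"
    and eq: "\<And>c u x. \<lbrakk>c \<in> Obj C; u \<in> Hom D (fobj F c) d; x \<in> carrier (Val L c)\<rbrakk>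
      \<Longrightarrow> g d (ind_gen R C D F L d c u x) = h d (ind_gen R C D F L d c u x)"
    and d: "d \<in> Obj D" and X: "X \<in> carrier (Val (ind R C D F L) d)"
  shows "g d X = h d X"
proof -
  interpret ind_setting R C D F L using R F L by (rule ind_setting.intro)
  show ?thesis
    by (rule eq_on_gen[OF kmoduleD(1)[OF kmod_homD(2)[OF g] d] kmod_homD(3)[OF g d] kmod_homD(3)[OF h d] eq X])
qed

lemma ind_hom_iso:
  assumes R: "cring R" and F: "is_functor C D F" and g: "kmod_iso R C L L' g"
  shows "kmod_iso R D (ind R C D F L) (ind R C D F L') (ind_hom R C D F L L' g)"
proof (rule kmod_isoI)
  note C = functorD(1)[OF F] and D = functorD(2)[OF F]
  note gh = kmod_isoD[OF g]
  note L = kmod_homD(1)[OF gh] and L' = kmod_homD(2)[OF gh]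
  note kh = kmod_isoD[OF kinv_iso[OF C g]]
  let ?g = "ind_hom R C D F L L' g" and ?k = "ind_hom R C D F L' L (kinv L g)"
  note G = ind_hom_hom[OF R F gh] and K = ind_hom_hom[OF R F kh]
  note Gg = ind_hom_gen[OF R F gh] and Kg = ind_hom_gen[OF R F kh]
  show "kmod_hom R D (ind R C D F L) (ind R C D F L') ?g" by (rule G)
  have kg: "?k d (?g d X) = X" if "d \<in> Obj D" "X \<in> carrier (Val (ind R C D F L) d)" for d X
    using kmod_homs_eq_on_gen[OF R F L kmod_hom_comp[OF D G K] kmod_hom_id[OF kmod_homD(1)[OF G]] _ that]
      Gg Kg[OF _ _ kmod_hom_closed[OF gh]] kinv(1)[OF g] by (simp add: hcomp_def)
  have gk: "?g d (?k d X) = X" if "d \<in> Obj D" "X \<in> carrier (Val (ind R C D F L') d)" for d X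
    using kmod_homs_eq_on_gen[OF R F L' kmod_hom_comp[OF D K G] kmod_hom_id[OF kmod_homD(1)[OF K]] _ that]
      Kg Gg[OF _ _ kmod_hom_closed[OF kh]] kinv(3)[OF g] by (simp add: hcomp_def)
  show "X = Y" if "d \<in> Obj D" "X \<in> carrier (Val (ind R C D F L) d)" "Y \<in> carrier (Val (ind R C D F L) d)"
    "?g d X = ?g d Y" for d X Y
    using kg[OF that(1,2)] kg[OF that(1,3)] that(4) by metis
  show "\<exists>X \<in> carrier (Val (ind R C D F L) d). ?g d X = Y" if "d \<in> Obj D" "Y \<in> carrier (Val (ind R C D F L') d)" for d Y
    by (rule bexI[of _ "?k d Y"]) (rule gk[OF that], rule kmod_hom_closed[OF K that])
qed

lemma chain_complexD:
  assumes "chain_complex R C P"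
  shows "kmodule R C (Ch P n)" "kmod_hom R C (Ch P (Suc n)) (Ch P n) (Diff P (Suc n))"
    "\<lbrakk>c \<in> Obj C; x \<in> carrier (Val (Ch P (Suc (Suc n))) c)\<rbrakk> \<Longrightarrow>
      Diff P (Suc n) c (Diff P (Suc (Suc n)) c x) = \<zero>\<^bsub>Val (Ch P n) c\<^esub>"
  using assms by (auto simp: chain_complex_def)

lemma ind_cplx_simps:
  "Ch (ind_cplx R C D F P) n = ind R C D F (Ch P n)"
  "Diff (ind_cplx R C D F P) (Suc n) = ind_hom R C D F (Ch P (Suc n)) (Ch P n) (Diff P (Suc n))"
  by (simp_all add: ind_cplx_def)

lemma ind_chain_complex:
  assumes R: "cring R" and F: "is_functor C D F" and P: "chain_complex R C P"
  shows "chain_complex R D (ind_cplx R C D F P)"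
  unfolding chain_complex_def ind_cplx_simps
proof (intro conjI allI ballI)
  note PD = chain_complexD[OF P]
  note dh = ind_hom_hom[OF R F PD(2)] and dg = ind_hom_gen[OF R F PD(2)]
  show "kmodule R D (ind R C D F (Ch P n))" for n
    using ind_setting.ind_kmodule[OF ind_setting.intro[OF R F PD(1)]] .
  show "kmod_hom R D (ind R C D F (Ch P (Suc n))) (ind R C D F (Ch P n))
      (ind_hom R C D F (Ch P (Suc n)) (Ch P n) (Diff P (Suc n)))" for n by (rule dh)
  fix n d X assume d: "d \<in> Obj D" and X: "X \<in> carrier (Val (ind R C D F (Ch P (Suc (Suc n)))) d)"
  let ?V = "\<lambda>n. Val (ind R C D F (Ch P n)) d"
  interpret I2: ind_setting R C D F "Ch P (Suc (Suc n))" by (rule ind_setting.intro[OF R F PD(1)])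
  interpret I: ind_setting R C D F "Ch P n" by (rule ind_setting.intro[OF R F PD(1)])
  interpret N: module R "?V n" by (rule I.V_mod)
  show "ind_hom R C D F (Ch P (Suc n)) (Ch P n) (Diff P (Suc n)) d
      (ind_hom R C D F (Ch P (Suc (Suc n))) (Ch P (Suc n)) (Diff P (Suc (Suc n))) d X) = \<zero>\<^bsub>?V n\<^esub>"
  proof (rule I2.eq_on_gen[OF N.module_axioms _ _ _ X])
    show "(\<lambda>X. ind_hom R C D F (Ch P (Suc n)) (Ch P n) (Diff P (Suc n)) d
      (ind_hom R C D F (Ch P (Suc (Suc n))) (Ch P (Suc n)) (Diff P (Suc (Suc n))) d X)) \<in> linear_maps R (?V (Suc (Suc n))) (?V n)"
      by (rule linear_comp[OF kmod_homD(3)[OF dh d] kmod_homD(3)[OF dh d]])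
    show "(\<lambda>_. \<zero>\<^bsub>?V n\<^esub>) \<in> linear_maps R (?V (Suc (Suc n))) (?V n)" by (rule linear_mapsI) simp_all
    fix c u x assume c: "c \<in> Obj C" and u: "u \<in> Hom D (fobj F c) d" and x: "x \<in> carrier (Val (Ch P (Suc (Suc n))) c)"
    show "ind_hom R C D F (Ch P (Suc n)) (Ch P n) (Diff P (Suc n)) d
      (ind_hom R C D F (Ch P (Suc (Suc n))) (Ch P (Suc n)) (Diff P (Suc (Suc n))) d
        (ind_gen R C D F (Ch P (Suc (Suc n))) d c u x)) = \<zero>\<^bsub>?V n\<^esub>"
      using dg[OF c u x] dg[OF c u kmod_hom_closed[OF PD(2) c x]] PD(3)[OF c x]
        linear_zero[OF I.L_mod[OF c] N.module_axioms I.gen_linear[OF c u]] by simp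
  qed
qed

lemma chain_mapD:
  assumes "chain_map R C P Q \<phi>"
  shows "chain_complex R C P" "chain_complex R C Q" "kmod_hom R C (Ch P n) (Ch Q n) (\<phi> n)"
    "\<lbrakk>c \<in> Obj C; x \<in> carrier (Val (Ch P (Suc n)) c)\<rbrakk> \<Longrightarrow> \<phi> n c (Diff P (Suc n) c x) = Diff Q (Suc n) c (\<phi> (Suc n) c x)"
  using assms by (auto simp: chain_map_def)

lemma ind_chain_map:
  assumes R: "cring R" and F: "is_functor C D F" and \<phi>: "chain_map R C P Q \<phi>"
  shows "chain_map R D (ind_cplx R C D F P) (ind_cplx R C D F Q) (\<lambda>n. ind_hom R C D F (Ch P n) (Ch Q n) (\<phi> n))"
  unfolding chain_map_def ind_cplx_simps
proof (intro conjI allI ballI)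
  note \<phi>D = chain_mapD[OF \<phi>] and D = functorD(2)[OF F]
  note PD = chain_complexD[OF \<phi>D(1)] and QD = chain_complexD[OF \<phi>D(2)]
  show "chain_complex R D (ind_cplx R C D F P)" "chain_complex R D (ind_cplx R C D F Q)"
    using ind_chain_complex[OF R F \<phi>D(1)] ind_chain_complex[OF R F \<phi>D(2)] .
  note \<phi>h = ind_hom_hom[OF R F \<phi>D(3)] and Ph = ind_hom_hom[OF R F PD(2)] and Qh = ind_hom_hom[OF R F QD(2)]
  note \<phi>g = ind_hom_gen[OF R F \<phi>D(3)] and Pg = ind_hom_gen[OF R F PD(2)] and Qg = ind_hom_gen[OF R F QD(2)]
  show "kmod_hom R D (ind R C D F (Ch P n)) (ind R C D F (Ch Q n)) (ind_hom R C D F (Ch P n) (Ch Q n) (\<phi> n))" for n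
    by (rule \<phi>h)
  fix n d X assume d: "d \<in> Obj D" and X: "X \<in> carrier (Val (ind R C D F (Ch P (Suc n))) d)"
  show "ind_hom R C D F (Ch P n) (Ch Q n) (\<phi> n) d (ind_hom R C D F (Ch P (Suc n)) (Ch P n) (Diff P (Suc n)) d X) =
    ind_hom R C D F (Ch Q (Suc n)) (Ch Q n) (Diff Q (Suc n)) d (ind_hom R C D F (Ch P (Suc n)) (Ch Q (Suc n)) (\<phi> (Suc n)) d X)"
    using kmod_homs_eq_on_gen[OF R F PD(1) kmod_hom_comp[OF D Ph \<phi>h] kmod_hom_comp[OF D \<phi>h Qh] _ d X]
      \<phi>g Pg Qg kmod_hom_closed[OF \<phi>D(3)] kmod_hom_closed[OF PD(2)] \<phi>D(4) by (simp add: hcomp_def)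
qed

lemma
  assumes R: "cring R" and F: "is_functor C D F" and Y: "kmodule R D Y"
  shows counit_hom: "kmod_hom R D (ind R C D F (res F Y)) Y (ind_counit C D F Y)"
    and counit_gen: "\<lbrakk>c \<in> Obj C; u \<in> Hom D (fobj F c) d; x \<in> carrier (Val Y (fobj F c))\<rbrakk> \<Longrightarrow>
      ind_counit C D F Y d (ind_gen R C D F (res F Y) d c u x) = Act Y u x"
    and counit_unit: "\<lbrakk>c \<in> Obj C; x \<in> carrier (Val Y (fobj F c))\<rbrakk> \<Longrightarrow>
      ind_counit C D F Y (fobj F c) (ind_unit R C D F (res F Y) c x) = x"
proof -
  interpret ind_setting R C D F "res F Y" by (rule ind_setting_res[OF R F Y])
  have id: "kmod_hom R C (res F Y) (res F Y) (\<lambda>c x. x)" by (rule kmod_hom_id[OF L])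
  show "kmod_hom R D (ind R C D F (res F Y)) Y (ind_counit C D F Y)"
    unfolding ind_counit_def by (rule adj_hom[OF Y id])
  show "ind_counit C D F Y d (ind_gen R C D F (res F Y) d c u x) = Act Y u x"
    if "c \<in> Obj C" "u \<in> Hom D (fobj F c) d" "x \<in> carrier (Val Y (fobj F c))"
    unfolding ind_counit_def using adj_gen[OF Y id that(1,2)] that(3) by (simp add: res_def)
  show "ind_counit C D F Y (fobj F c) (ind_unit R C D F (res F Y) c x) = x"
    if "c \<in> Obj C" "x \<in> carrier (Val Y (fobj F c))"
    unfolding ind_counit_def using adj_unit[OF Y id that(1)] that(2) by (simp add: res_def)
qed

lemma counit_chain_map:
  assumes R: "cring R" and F: "is_functor C D F" and P: "chain_complex R D P"
  shows "chain_map R D (ind_cplx R C D F (res_cplx F P)) P (\<lambda>n. ind_counit C D F (Ch P n))"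
  unfolding chain_map_def
proof (intro conjI allI ballI)
  note D = functorD(2)[OF F] and PD = chain_complexD[OF P]
  have Chr: "Ch (res_cplx F P) n = res F (Ch P n)" "Diff (res_cplx F P) n = res_hom F (Diff P n)" for n
    by (simp_all add: res_cplx_def)
  show "chain_complex R D P" by (rule P)
  show "chain_complex R D (ind_cplx R C D F (res_cplx F P))"
    by (rule ind_chain_complex[OF R F res_chain_complex[OF F P]])
  note rP = chain_complexD[OF res_chain_complex[OF F P], unfolded Chr]
  show "kmod_hom R D (Ch (ind_cplx R C D F (res_cplx F P)) n) (Ch P n) (ind_counit C D F (Ch P n))" for n
    unfolding ind_cplx_simps Chr by (rule counit_hom[OF R F PD(1)])
  fix n d X assume d: "d \<in> Obj D" and X: "X \<in> carrier (Val (Ch (ind_cplx R C D F (res_cplx F P)) (Suc n)) d)"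
  note h1 = counit_hom[OF R F PD(1)] and h2 = ind_hom_hom[OF R F rP(2)]
  have "hcomp (ind_counit C D F (Ch P n)) (ind_hom R C D F (res F (Ch P (Suc n))) (res F (Ch P n)) (res_hom F (Diff P (Suc n)))) d X
      = hcomp (Diff P (Suc n)) (ind_counit C D F (Ch P (Suc n))) d X"
  proof (rule kmod_homs_eq_on_gen[OF R F rP(1) kmod_hom_comp[OF D h2 h1] kmod_hom_comp[OF D h1 PD(2)] _ d])
    show "X \<in> carrier (Val (ind R C D F (res F (Ch P (Suc n)))) d)" using X unfolding ind_cplx_simps Chr .
    fix c u x assume c: "c \<in> Obj C" and u: "u \<in> Hom D (fobj F c) d" and x: "x \<in> carrier (Val (res F (Ch P (Suc n))) c)"
    have x': "x \<in> carrier (Val (Ch P (Suc n)) (fobj F c))" using x by (simp add: res_def)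
    show "hcomp (ind_counit C D F (Ch P n)) (ind_hom R C D F (res F (Ch P (Suc n))) (res F (Ch P n)) (res_hom F (Diff P (Suc n)))) d
        (ind_gen R C D F (res F (Ch P (Suc n))) d c u x)
      = hcomp (Diff P (Suc n)) (ind_counit C D F (Ch P (Suc n))) d (ind_gen R C D F (res F (Ch P (Suc n))) d c u x)"
      unfolding hcomp_def ind_hom_gen[OF R F rP(2) c u x] counit_gen[OF R F PD(1) c u x']
      using counit_gen[OF R F PD(1) c u kmod_hom_closed[OF PD(2) functorD(3)[OF F c] x']]
        kmod_hom_nat[OF PD(2) u x'] by (simp add: res_hom_def)
  qed
  then show "ind_counit C D F (Ch P n) d (Diff (ind_cplx R C D F (res_cplx F P)) (Suc n) d X) =
      Diff P (Suc n) d (ind_counit C D F (Ch P (Suc n)) d X)"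
    unfolding ind_cplx_simps Chr hcomp_def .
qed

section \<open>Projective modules generated along a functor\<close>

text \<open>The counit is onto since \<open>Y\<close> is generated along \<open>F\<close>, hence it splits. On the image of \<open>F\<close> it is
  inverse to the unit, so the section is onto there, and therefore everywhere because the induced
  module is generated along \<open>F\<close>.\<close>

lemma counit_iso:
  assumes R: "cring R" and F: "fully_faithful B D F" and Y: "projective R D Y"
    and gen: "generated_along R B D F Y"
  shows "kmod_iso R D (ind R B D F (res F Y)) Y (ind_counit B D F Y)"
proof -
  note Ff = fully_faithful_functor[OF F]
  note D = functorD(2)[OF Ff]
  have Ym: "kmodule R D Y" using Y by (simp add: projective_def)
  interpret ind_setting R B D F "res F Y" by (rule ind_setting_res[OF R Ff Ym])
  let ?I = "ind R B D F (res F Y)" and ?e = "ind_counit B D F Y"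
  note e = counit_hom[OF R Ff Ym]
  have rV: "Val (res F Y) b = Val Y (fobj F b)" for b by (simp add: res_def)
  have onto: "y \<in> ?e d ` carrier (Val ?I d)" if d: "d \<in> Obj D" and y: "y \<in> carrier (Val Y d)" for d y
  proof (rule generated_alongD[OF gen kmod_sub_hom_range[OF e D] _ d y])
    fix b x assume b: "b \<in> Obj B" and x: "x \<in> carrier (Val Y (fobj F b))"
    show "x \<in> ?e (fobj F b) ` carrier (Val ?I (fobj F b))"
      using counit_unit[OF R Ff Ym b x] kmod_hom_closed[OF unit_hom b, of x] x
      by (intro image_eqI[where x = "unit b x"]) (simp_all add: res_def)
  qed
  have "kmod_epi R D ?I Y ?e"
    using e onto kmod_hom_closed[OF e] by (auto simp: kmod_epi_def)
  moreover have "kmod_hom R D Y Y (\<lambda>c x. x)" by (rule kmod_hom_id[OF Ym])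
  ultimately obtain s where s: "kmod_hom R D Y ?I s"
    and es: "\<And>d y. \<lbrakk>d \<in> Obj D; y \<in> carrier (Val Y d)\<rbrakk> \<Longrightarrow> ?e d (s d y) = y"
    using projective_any[OF R D Y] by blast
  have s_onto: "X \<in> s d ` carrier (Val Y d)" if d: "d \<in> Obj D" and X: "X \<in> carrier (Val ?I d)" for d X
  proof (rule generated_alongD[OF ind_generated kmod_sub_hom_range[OF s D] _ d X])
    fix b X assume b: "b \<in> Obj B" and X: "X \<in> carrier (Val ?I (fobj F b))"
    note Fb = functorD(3)[OF Ff b]
    obtain x where x: "x \<in> carrier (Val Y (fobj F b))" "X = unit b x"
      using unit_onto[OF F b X] by (auto simp: rV)
    obtain y where y: "y \<in> carrier (Val Y (fobj F b))" "s (fobj F b) x = unit b y"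
      using unit_onto[OF F b kmod_hom_closed[OF s Fb x(1)]] by (auto simp: rV)
    have "x = y" using es[OF Fb x(1)] y(2) counit_unit[OF R Ff Ym b y(1)] by simp
    then show "X \<in> s (fobj F b) ` carrier (Val Y (fobj F b))" using x y by (metis image_eqI)
  qed
  show ?thesis
  proof (rule kmod_isoI[OF e])
    show "X = X'" if "d \<in> Obj D" "X \<in> carrier (Val ?I d)" "X' \<in> carrier (Val ?I d)" "?e d X = ?e d X'" for d X X'
      using s_onto[OF that(1,2)] s_onto[OF that(1,3)] es[OF that(1)] that(4) by auto
    show "\<exists>X \<in> carrier (Val ?I d). ?e d X = y" if "d \<in> Obj D" "y \<in> carrier (Val Y d)" for d y
      using onto[OF that] by blast
  qed
qed

text \<open>A lifting problem for the restriction of \<open>Y\<close> is transported along induction to one for \<open>Y\<close>, by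
  the counit, and a solution is transported back by the unit.\<close>

lemma res_lifting:
  assumes R: "cring R" and F: "fully_faithful B D F" and Y: "projective R D Y"
    and gen: "generated_along R B D F Y"
    and g: "kmod_epi R B L K g" and h: "kmod_hom R B (res F Y) K h"
  shows "\<exists>k. kmod_hom R B (res F Y) L k \<and> (\<forall>b \<in> Obj B. \<forall>x \<in> carrier (Val (res F Y) b). g b (k b x) = h b x)"
proof -
  note Ff = fully_faithful_functor[OF F]
  note B = functorD(1)[OF Ff] and D = functorD(2)[OF Ff]
  have gh: "kmod_hom R B L K g" and go: "\<And>b. b \<in> Obj B \<Longrightarrow> g b ` carrier (Val L b) = carrier (Val K b)"
    using g by (auto simp: kmod_epi_def)
  note Lm = kmod_homD(1)[OF gh] and Km = kmod_homD(2)[OF gh]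
  have Ym: "kmodule R D Y" using Y by (simp add: projective_def)
  interpret L: ind_setting R B D F L by (rule ind_setting.intro[OF R Ff Lm])
  interpret K: ind_setting R B D F K by (rule ind_setting.intro[OF R Ff Km])
  let ?iL = "ind R B D F L" and ?iK = "ind R B D F K" and ?rY = "res F Y"
  let ?g = "ind_hom R B D F L K g" and ?h = "ind_hom R B D F ?rY K h"
  let ?e = "kinv (ind R B D F ?rY) (ind_counit B D F Y)"
  note iso = counit_iso[OF R F Y gen]
  note ih = ind_hom_hom[OF R Ff gh] and hh = ind_hom_hom[OF R Ff h]
  note unit_hom = ind_hom_unit[OF R Ff]
  have "y \<in> ?g d ` carrier (Val ?iL d)" if d: "d \<in> Obj D" and y: "y \<in> carrier (Val ?iK d)" for d y
  proof (rule generated_alongD[OF K.ind_generated kmod_sub_hom_range[OF ih D] _ d y])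
    fix b X assume b: "b \<in> Obj B" and X: "X \<in> carrier (Val ?iK (fobj F b))"
    obtain z where z: "z \<in> carrier (Val K b)" "X = K.unit b z" using K.unit_onto[OF F b X] by blast
    obtain x where x: "x \<in> carrier (Val L b)" "g b x = z" using z(1) unfolding go[OF b, symmetric] by blast
    show "X \<in> ?g (fobj F b) ` carrier (Val ?iL (fobj F b))"
      using unit_hom[OF gh b x(1)] kmod_hom_closed[OF L.unit_hom b x(1)] x(2) z(2)
      by (intro image_eqI[where x = "L.unit b x"]) (simp_all add: res_def)
  qed
  then have "kmod_epi R D ?iL ?iK ?g" using ih kmod_hom_closed[OF ih] by (auto simp: kmod_epi_def)
  moreover have "kmod_hom R D Y ?iK (hcomp ?h ?e)"
    by (rule kmod_hom_comp[OF D kmod_isoD[OF kinv_iso[OF D iso]] hh])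
  ultimately obtain k where k: "kmod_hom R D Y ?iL k"
    and gk: "\<And>d y. \<lbrakk>d \<in> Obj D; y \<in> carrier (Val Y d)\<rbrakk> \<Longrightarrow> ?g d (k d y) = ?h d (?e d y)"
    using projective_any[OF R D Y] unfolding hcomp_def by blast
  have uL: "kmod_iso R B L (res F ?iL) L.unit"
  proof (rule kmod_isoI[OF L.unit_hom])
    show "x = y" if "b \<in> Obj B" "x \<in> carrier (Val L b)" "y \<in> carrier (Val L b)" "L.unit b x = L.unit b y" for b x y
      using L.unit_inj[OF F that(1)] that by (auto dest: inj_onD)
    show "\<exists>x \<in> carrier (Val L b). L.unit b x = y" if "b \<in> Obj B" "y \<in> carrier (Val (res F ?iL) b)" for b y
      using L.unit_onto[OF F that(1), of y] that(2) by (auto simp: res_def)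
  qed
  let ?k = "hcomp (kinv L L.unit) (res_hom F k)"
  have "kmod_hom R B ?rY L ?k"
    by (rule kmod_hom_comp[OF B kmod_hom_res[OF Ff k] kmod_isoD[OF kinv_iso[OF B uL]]])
  moreover have "g b (?k b x) = h b x" if b: "b \<in> Obj B" and x: "x \<in> carrier (Val ?rY b)" for b x
  proof -
    note Fb = functorD(3)[OF Ff b]
    have xY: "x \<in> carrier (Val Y (fobj F b))" using x by (simp add: res_def)
    note kx = kmod_hom_closed[OF k Fb xY]
    define z where "z = ?k b x"
    have z: "z \<in> carrier (Val L b)" "L.unit b z = k (fobj F b) x"
      using kinv(2,3)[OF uL b, of "k (fobj F b) x"] kx by (simp_all add: z_def hcomp_def res_hom_def res_def)
    have ux: "ind_unit R B D F ?rY b x \<in> carrier (Val (ind R B D F ?rY) (fobj F b))"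
      using kmod_hom_closed[OF ind_setting.unit_hom[OF ind_setting_res[OF R Ff Ym]] b x] by (simp add: res_def)
    have ex: "?e (fobj F b) x = ind_unit R B D F ?rY b x"
      using kinv(1)[OF iso Fb ux] counit_unit[OF R Ff Ym b xY] by simp
    have "K.unit b (g b z) = ?g (fobj F b) (k (fobj F b) x)" using unit_hom[OF gh b z(1)] z(2) by simp
    also have "\<dots> = K.unit b (h b x)" using gk[OF Fb xY] ex unit_hom[OF h b x] by simp
    finally show "g b (?k b x) = h b x"
      using K.unit_inj[OF F b] kmod_hom_closed[OF gh b z(1)] kmod_hom_closed[OF h b x]
      by (auto simp: z_def dest: inj_onD)
  qed
  ultimately show ?thesis by blast
qed

section \<open>Comparison of resolutions\<close>

text \<open>Exactness of the augmented complex, with kernels and images compared elementwise.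
  In contrast to projectivity and minimality this is clearly inherited by restrictions.\<close>

definition resolution :: "'r ring \<Rightarrow> ('o, 'a) cat \<Rightarrow> ('o, 'a, 'r, 'm) cplx \<Rightarrow>
    ('o \<Rightarrow> 'm \<Rightarrow> 'n) \<Rightarrow> ('o, 'a, 'r, 'n) cmod \<Rightarrow> bool" where
  "resolution R C P \<epsilon> M \<longleftrightarrow> chain_complex R C P \<and> kmod_epi R C (Ch P 0) M \<epsilon>
     \<and> (\<forall>c \<in> Obj C. \<forall>x \<in> carrier (Val (Ch P 0) c).
          \<epsilon> c x = \<zero>\<^bsub>Val M c\<^esub> \<longleftrightarrow> x \<in> Diff P (Suc 0) c ` carrier (Val (Ch P (Suc 0)) c))
     \<and> (\<forall>n. \<forall>c \<in> Obj C. \<forall>x \<in> carrier (Val (Ch P (Suc n)) c).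
          Diff P (Suc n) c x = \<zero>\<^bsub>Val (Ch P n) c\<^esub> \<longleftrightarrow>
          x \<in> Diff P (Suc (Suc n)) c ` carrier (Val (Ch P (Suc (Suc n))) c))"

lemma resolutionD:
  assumes "resolution R C P \<epsilon> M"
  shows "chain_complex R C P" "kmod_epi R C (Ch P 0) M \<epsilon>" "kmod_hom R C (Ch P 0) M \<epsilon>"
    "\<lbrakk>c \<in> Obj C; x \<in> carrier (Val (Ch P 0) c)\<rbrakk> \<Longrightarrow>
       \<epsilon> c x = \<zero>\<^bsub>Val M c\<^esub> \<longleftrightarrow> x \<in> Diff P (Suc 0) c ` carrier (Val (Ch P (Suc 0)) c)"
    "\<lbrakk>c \<in> Obj C; x \<in> carrier (Val (Ch P (Suc n)) c)\<rbrakk> \<Longrightarrow>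
       Diff P (Suc n) c x = \<zero>\<^bsub>Val (Ch P n) c\<^esub> \<longleftrightarrow>
       x \<in> Diff P (Suc (Suc n)) c ` carrier (Val (Ch P (Suc (Suc n))) c)"
  using assms by (auto simp: resolution_def kmod_epi_def)

lemma projective_resolution_imp_resolution:
  assumes "projective_resolution R C P \<epsilon> M"
  shows "resolution R C P \<epsilon> M"
  using assms unfolding projective_resolution_def resolution_def a_kernel_def' by simp

lemma res_resolution:
  assumes F: "is_functor B D F" and P: "resolution R D P \<epsilon> M"
  shows "resolution R B (res_cplx F P) (res_hom F \<epsilon>) (res F M)"
  unfolding resolution_def
proof (intro conjI allI ballI)
  show "chain_complex R B (res_cplx F P)" by (rule res_chain_complex[OF F resolutionD(1)[OF P]])
  show "kmod_epi R B (Ch (res_cplx F P) 0) (res F M) (res_hom F \<epsilon>)"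
    using kmod_hom_res[OF F resolutionD(3)[OF P]] resolutionD(2)[OF P] functorD(3)[OF F]
    by (simp add: kmod_epi_def res_cplx_def res_def res_hom_def)
qed (use resolutionD(4,5)[OF P] functorD(3)[OF F] in \<open>simp_all add: res_cplx_def res_def res_hom_def\<close>)

lemma corestrict_hom:
  assumes C: "category C" and d: "kmod_hom R C K M d" and g: "kmod_hom R C L M g"
    and im: "\<And>c x. \<lbrakk>c \<in> Obj C; x \<in> carrier (Val L c)\<rbrakk> \<Longrightarrow> g c x \<in> d c ` carrier (Val K c)"
  shows "kmod_hom R C L (image_kmod K M d) g"
proof (rule kmod_homI[OF kmod_homD(1)[OF g] image_kmod_kmodule(1)[OF C d]])
  show "g c \<in> linear_maps R (Val L c) (Val (image_kmod K M d) c)" if c: "c \<in> Obj C" for c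
    by (rule linear_mapsI) (use im[OF c] linear_mapsD(2,3)[OF kmod_homD(3)[OF g c]] in \<open>auto simp: image_kmod_def\<close>)
  show "g b (Act L u x) = Act (image_kmod K M d) u (g a x)" if "u \<in> Hom C a b" "x \<in> carrier (Val L a)" for u a b x
    using kmod_hom_nat[OF g that] by (simp add: image_kmod_def)
qed

lemma image_epi:
  assumes C: "category C" and d: "kmod_hom R C K M d"
  shows "kmod_epi R C K (image_kmod K M d) d"
  using corestrict_hom[OF C d d] by (auto simp: kmod_epi_def image_kmod_def)

text \<open>The usual comparison theorem, with the lifting property assumed only of the epimorphisms that
  occur: the augmentation and the differentials onto their images.\<close>

lemma lifts_exist:
  assumes C: "category C" and P: "resolution R C P \<epsilon> M" and Q: "resolution R C Q \<delta> N"
    and f: "kmod_hom R C M N f"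
    and lift0: "\<And>h. kmod_hom R C (Ch P 0) N h \<Longrightarrow> \<exists>k. kmod_hom R C (Ch P 0) (Ch Q 0) k \<and>
      (\<forall>c \<in> Obj C. \<forall>x \<in> carrier (Val (Ch P 0) c). \<delta> c (k c x) = h c x)"
    and lift: "\<And>n h. kmod_hom R C (Ch P (Suc n)) (image_kmod (Ch Q (Suc n)) (Ch Q n) (Diff Q (Suc n))) h \<Longrightarrow>
      \<exists>k. kmod_hom R C (Ch P (Suc n)) (Ch Q (Suc n)) k \<and>
      (\<forall>c \<in> Obj C. \<forall>x \<in> carrier (Val (Ch P (Suc n)) c). Diff Q (Suc n) c (k c x) = h c x)"
  shows "\<exists>\<phi>. lifts R C P \<epsilon> Q \<delta> f \<phi>"
proof -
  note PD = resolutionD[OF P] and QD = resolutionD[OF Q]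
  note Pc = chain_complexD[OF PD(1)] and Qc = chain_complexD[OF QD(1)]
  \<comment> \<open>\<open>good\<close> includes that boundaries go to boundaries: then the next lifting problem has the image of
    the differential as its target, and this image is covered by the next module\<close>
  define good where "good n k \<longleftrightarrow> kmod_hom R C (Ch P n) (Ch Q n) k
    \<and> (n = 0 \<longrightarrow> (\<forall>c \<in> Obj C. \<forall>x \<in> carrier (Val (Ch P 0) c). \<delta> c (k c x) = f c (\<epsilon> c x)))
    \<and> (\<forall>c \<in> Obj C. \<forall>x \<in> carrier (Val (Ch P (Suc n)) c).
         k c (Diff P (Suc n) c x) \<in> Diff Q (Suc n) c ` carrier (Val (Ch Q (Suc n)) c))" for n k
  define comm where "comm n k k' \<longleftrightarrow> (\<forall>c \<in> Obj C. \<forall>x \<in> carrier (Val (Ch P (Suc n)) c).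
     k c (Diff P (Suc n) c x) = Diff Q (Suc n) c (k' c x))" for n k k'
  have "\<exists>\<phi>. \<forall>n. good n (\<phi> n) \<and> comm n (\<phi> n) (\<phi> (Suc n))"
  proof (rule dependent_nat_choice)
    obtain k where k: "kmod_hom R C (Ch P 0) (Ch Q 0) k"
      and \<delta>k: "\<And>c x. \<lbrakk>c \<in> Obj C; x \<in> carrier (Val (Ch P 0) c)\<rbrakk> \<Longrightarrow> \<delta> c (k c x) = f c (\<epsilon> c x)"
      using lift0[OF kmod_hom_comp[OF C PD(3) f]] unfolding hcomp_def by blast
    have "k c (Diff P (Suc 0) c x) \<in> Diff Q (Suc 0) c ` carrier (Val (Ch Q (Suc 0)) c)"
      if c: "c \<in> Obj C" and x: "x \<in> carrier (Val (Ch P (Suc 0)) c)" for c x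
    proof -
      note dx = kmod_hom_closed[OF Pc(2) c x]
      have "\<epsilon> c (Diff P (Suc 0) c x) = \<zero>\<^bsub>Val M c\<^esub>" using PD(4)[OF c dx] x by blast
      then have "\<delta> c (k c (Diff P (Suc 0) c x)) = \<zero>\<^bsub>Val N c\<^esub>"
        using \<delta>k[OF c dx] linear_zero[OF kmoduleD(1)[OF kmod_homD(1)[OF f] c]
          kmoduleD(1)[OF kmod_homD(2)[OF f] c] kmod_homD(3)[OF f c]] by simp
      then show ?thesis using QD(4)[OF c kmod_hom_closed[OF k c dx]] by simp
    qed
    then show "\<exists>k. good 0 k" using k \<delta>k unfolding good_def by blast
  next
    fix k n assume "good n k"
    then have k: "kmod_hom R C (Ch P n) (Ch Q n) k"
      and kd: "\<And>c x. \<lbrakk>c \<in> Obj C; x \<in> carrier (Val (Ch P (Suc n)) c)\<rbrakk> \<Longrightarrow>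
        k c (Diff P (Suc n) c x) \<in> Diff Q (Suc n) c ` carrier (Val (Ch Q (Suc n)) c)"
      by (auto simp: good_def)
    have "kmod_hom R C (Ch P (Suc n)) (image_kmod (Ch Q (Suc n)) (Ch Q n) (Diff Q (Suc n))) (hcomp k (Diff P (Suc n)))"
      by (rule corestrict_hom[OF C Qc(2) kmod_hom_comp[OF C Pc(2) k]]) (simp add: hcomp_def kd)
    from lift[OF this] obtain k' where k': "kmod_hom R C (Ch P (Suc n)) (Ch Q (Suc n)) k'"
      and dk: "\<And>c x. \<lbrakk>c \<in> Obj C; x \<in> carrier (Val (Ch P (Suc n)) c)\<rbrakk> \<Longrightarrow>
        Diff Q (Suc n) c (k' c x) = k c (Diff P (Suc n) c x)"
      unfolding hcomp_def by blast
    have "k' c (Diff P (Suc (Suc n)) c x) \<in> Diff Q (Suc (Suc n)) c ` carrier (Val (Ch Q (Suc (Suc n))) c)"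
      if c: "c \<in> Obj C" and x: "x \<in> carrier (Val (Ch P (Suc (Suc n))) c)" for c x
    proof -
      note dx = kmod_hom_closed[OF Pc(2) c x]
      have "Diff Q (Suc n) c (k' c (Diff P (Suc (Suc n)) c x)) = \<zero>\<^bsub>Val (Ch Q n) c\<^esub>"
        using dk[OF c dx] Pc(3)[OF c x] linear_zero[OF kmoduleD(1)[OF Pc(1) c]
          kmoduleD(1)[OF Qc(1) c] kmod_homD(3)[OF k c]] by simp
      then show ?thesis using QD(5)[OF c kmod_hom_closed[OF k' c dx]] by simp
    qed
    then show "\<exists>k'. good (Suc n) k' \<and> comm n k k'" using k' dk by (auto simp: good_def comm_def)
  qed
  then obtain \<phi> where "\<And>n. good n (\<phi> n)" "\<And>n. comm n (\<phi> n) (\<phi> (Suc n))" by blast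
  then have "lifts R C P \<epsilon> Q \<delta> f \<phi>"
    using PD(1) QD(1) by (simp add: lifts_def chain_map_def good_def comm_def)
  then show ?thesis by blast
qed

text \<open>By induction on the degree, through \<open>essential_map_iso\<close>. If \<open>\<phi>\<^sub>n\<close> is an isomorphism, it maps
  the image of \<open>d\<^sub>n\<^sub>+\<^sub>1\<close> injectively to the corresponding image, and onto it because both images are
  kernels. So the induction also carries that only boundaries are mapped to boundaries.\<close>

lemma lifts_iso:
  assumes C: "category C" and P: "resolution R C P \<epsilon> M" and Q: "resolution R C Q \<delta> N"
    and f: "kmod_iso R C M N f" and \<phi>: "lifts R C P \<epsilon> Q \<delta> f \<phi>"
    and P_ess: "essential R C (Ch P 0) \<epsilon>" "\<And>n. essential R C (Ch P (Suc n)) (Diff P (Suc n))"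
    and Q_ess: "essential R C (Ch Q 0) \<delta>" "\<And>n. essential R C (Ch Q (Suc n)) (Diff Q (Suc n))"
    and split: "\<And>n g. kmod_epi R C (Ch P n) (Ch Q n) g \<Longrightarrow> \<exists>s. kmod_hom R C (Ch Q n) (Ch P n) s \<and>
      (\<forall>c \<in> Obj C. \<forall>y \<in> carrier (Val (Ch Q n) c). g c (s c y) = y)"
  shows "kmod_iso R C (Ch P n) (Ch Q n) (\<phi> n)"
proof -
  note PD = resolutionD[OF P] and QD = resolutionD[OF Q]
  note Pc = chain_complexD[OF PD(1)] and Qc = chain_complexD[OF QD(1)]
  have "chain_map R C P Q \<phi>" using \<phi> by (simp add: lifts_def)
  note \<phi>D = chain_mapD[OF this]
  have \<delta>\<phi>: "\<delta> c (\<phi> 0 c x) = f c (\<epsilon> c x)" if "c \<in> Obj C" "x \<in> carrier (Val (Ch P 0) c)" for c x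
    using \<phi> that by (simp add: lifts_def)
  have "kmod_iso R C (Ch P n) (Ch Q n) (\<phi> n) \<and> (\<forall>c \<in> Obj C. \<forall>x \<in> carrier (Val (Ch P n) c).
    \<phi> n c x \<in> Diff Q (Suc n) c ` carrier (Val (Ch Q (Suc n)) c) \<longrightarrow>
    x \<in> Diff P (Suc n) c ` carrier (Val (Ch P (Suc n)) c))"
  proof (induction n)
    case 0
    note fh = kmod_isoD[OF f]
    have f_inj: "x = y" if "c \<in> Obj C" "x \<in> carrier (Val M c)" "y \<in> carrier (Val M c)" "f c x = f c y" for c x y
      using kinv(1)[OF f that(1,2)] kinv(1)[OF f that(1,3)] that(4) by metis
    have "kmod_iso R C (Ch P 0) (Ch Q 0) (\<phi> 0)"
    proof (rule essential_map_iso[OF C \<phi>D(3) P_ess(1) Q_ess(1) _ _ split])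
      show "\<epsilon> c x = \<epsilon> c y" if "c \<in> Obj C" "x \<in> carrier (Val (Ch P 0) c)" "y \<in> carrier (Val (Ch P 0) c)"
        "\<delta> c (\<phi> 0 c x) = \<delta> c (\<phi> 0 c y)" for c x y
        by (rule f_inj[OF that(1) kmod_hom_closed[OF PD(3) that(1,2)] kmod_hom_closed[OF PD(3) that(1,3)]])
          (use \<delta>\<phi>[OF that(1,2)] \<delta>\<phi>[OF that(1,3)] that(4) in simp)
      fix c y assume c: "c \<in> Obj C" and y: "y \<in> carrier (Val (Ch Q 0) c)"
      note \<delta>y = kmod_hom_closed[OF QD(3) c y]
      have "kinv M f c (\<delta> c y) \<in> \<epsilon> c ` carrier (Val (Ch P 0) c)"
        using PD(2) kinv(2)[OF f c \<delta>y] c by (simp add: kmod_epi_def)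
      then obtain x where x: "x \<in> carrier (Val (Ch P 0) c)" "\<epsilon> c x = kinv M f c (\<delta> c y)" by auto
      then show "\<exists>x \<in> carrier (Val (Ch P 0) c). \<delta> c (\<phi> 0 c x) = \<delta> c y"
        using \<delta>\<phi>[OF c x(1)] kinv(3)[OF f c \<delta>y] by auto
    qed
    moreover have "x \<in> Diff P (Suc 0) c ` carrier (Val (Ch P (Suc 0)) c)"
      if c: "c \<in> Obj C" and x: "x \<in> carrier (Val (Ch P 0) c)"
        and im: "\<phi> 0 c x \<in> Diff Q (Suc 0) c ` carrier (Val (Ch Q (Suc 0)) c)" for c x
    proof -
      note M = kmoduleD(1)[OF kmod_homD(1)[OF fh] c] and N = kmoduleD(1)[OF kmod_homD(2)[OF fh] c]
      have "f c (\<epsilon> c x) = \<zero>\<^bsub>Val N c\<^esub>"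
        using QD(4)[OF c kmod_hom_closed[OF \<phi>D(3) c x]] im \<delta>\<phi>[OF c x] by simp
      then have "\<epsilon> c x = \<zero>\<^bsub>Val M c\<^esub>"
        using f_inj[OF c kmod_hom_closed[OF PD(3) c x] module_zero_closed[OF M]]
          linear_zero[OF M N kmod_homD(3)[OF fh c]] by simp
      then show ?thesis using PD(4)[OF c x] by simp
    qed
    ultimately show ?case by blast
  next
    case (Suc n)
    then have \<phi>n: "kmod_iso R C (Ch P n) (Ch Q n) (\<phi> n)"
      and ker: "\<And>c x. \<lbrakk>c \<in> Obj C; x \<in> carrier (Val (Ch P n) c);
        \<phi> n c x \<in> Diff Q (Suc n) c ` carrier (Val (Ch Q (Suc n)) c)\<rbrakk> \<Longrightarrow>
        x \<in> Diff P (Suc n) c ` carrier (Val (Ch P (Suc n)) c)" by auto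
    have inj: "x = y" if "c \<in> Obj C" "x \<in> carrier (Val (Ch P n) c)" "y \<in> carrier (Val (Ch P n) c)" "\<phi> n c x = \<phi> n c y" for c x y
      using kinv(1)[OF \<phi>n that(1,2)] kinv(1)[OF \<phi>n that(1,3)] that(4) by metis
    have "kmod_iso R C (Ch P (Suc n)) (Ch Q (Suc n)) (\<phi> (Suc n))"
    proof (rule essential_map_iso[OF C \<phi>D(3) P_ess(2) Q_ess(2) _ _ split])
      show "Diff P (Suc n) c x = Diff P (Suc n) c y"
        if "c \<in> Obj C" "x \<in> carrier (Val (Ch P (Suc n)) c)" "y \<in> carrier (Val (Ch P (Suc n)) c)"
          "Diff Q (Suc n) c (\<phi> (Suc n) c x) = Diff Q (Suc n) c (\<phi> (Suc n) c y)" for c x y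
        by (rule inj[OF that(1) kmod_hom_closed[OF Pc(2) that(1,2)] kmod_hom_closed[OF Pc(2) that(1,3)]])
          (use \<phi>D(4)[OF that(1,2)] \<phi>D(4)[OF that(1,3)] that(4) in simp)
      fix c y assume c: "c \<in> Obj C" and y: "y \<in> carrier (Val (Ch Q (Suc n)) c)"
      note dy = kmod_hom_closed[OF Qc(2) c y]
      have "kinv (Ch P n) (\<phi> n) c (Diff Q (Suc n) c y) \<in> Diff P (Suc n) c ` carrier (Val (Ch P (Suc n)) c)"
        by (rule ker[OF c kinv(2)[OF \<phi>n c dy]]) (use kinv(3)[OF \<phi>n c dy] y in simp)
      then obtain x where x: "x \<in> carrier (Val (Ch P (Suc n)) c)"
        "Diff P (Suc n) c x = kinv (Ch P n) (\<phi> n) c (Diff Q (Suc n) c y)" by auto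
      then show "\<exists>x \<in> carrier (Val (Ch P (Suc n)) c). Diff Q (Suc n) c (\<phi> (Suc n) c x) = Diff Q (Suc n) c y"
        using \<phi>D(4)[OF c x(1)] kinv(3)[OF \<phi>n c dy] by auto
    qed
    moreover have "x \<in> Diff P (Suc (Suc n)) c ` carrier (Val (Ch P (Suc (Suc n))) c)"
      if c: "c \<in> Obj C" and x: "x \<in> carrier (Val (Ch P (Suc n)) c)"
        and im: "\<phi> (Suc n) c x \<in> Diff Q (Suc (Suc n)) c ` carrier (Val (Ch Q (Suc (Suc n))) c)" for c x
    proof -
      note Pm = kmoduleD(1)[OF Pc(1) c] and Qm = kmoduleD(1)[OF Qc(1) c]
      have "\<phi> n c (Diff P (Suc n) c x) = \<zero>\<^bsub>Val (Ch Q n) c\<^esub>"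
        using QD(5)[OF c kmod_hom_closed[OF \<phi>D(3) c x]] im \<phi>D(4)[OF c x] by simp
      then have "Diff P (Suc n) c x = \<zero>\<^bsub>Val (Ch P n) c\<^esub>"
        using inj[OF c kmod_hom_closed[OF Pc(2) c x] module_zero_closed[OF Pm]]
          linear_zero[OF Pm Qm kmod_homD(3)[OF \<phi>D(3) c]] by simp
      then show ?thesis using PD(5)[OF c x] by simp
    qed
    ultimately show ?case by blast
  qed
  then show ?thesis by blast
qed

lemma chain_iso_inverse:
  assumes C: "category C" and \<phi>: "chain_iso R C P Q \<phi>"
  shows "chain_iso R C Q P (\<lambda>n. kinv (Ch P n) (\<phi> n))"
proof -
  have iso: "kmod_iso R C (Ch P n) (Ch Q n) (\<phi> n)" for n using \<phi> by (simp add: chain_iso_def)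
  have "chain_map R C P Q \<phi>" using \<phi> by (simp add: chain_iso_def)
  note \<phi>D = chain_mapD[OF this]
  have "kinv (Ch P n) (\<phi> n) c (Diff Q (Suc n) c y) = Diff P (Suc n) c (kinv (Ch P (Suc n)) (\<phi> (Suc n)) c y)"
    if c: "c \<in> Obj C" and y: "y \<in> carrier (Val (Ch Q (Suc n)) c)" for n c y
  proof -
    let ?x = "kinv (Ch P (Suc n)) (\<phi> (Suc n)) c y"
    note x = kinv(2,3)[OF iso c y]
    have "\<phi> n c (Diff P (Suc n) c ?x) = Diff Q (Suc n) c y" using \<phi>D(4)[OF c x(1)] x(2) by simp
    then show ?thesis
      using kinv(1)[OF iso c kmod_hom_closed[OF chain_complexD(2)[OF \<phi>D(1)] c x(1)]] by simp
  qed
  then show ?thesis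
    using kinv_iso[OF C iso] kmod_isoD[OF kinv_iso[OF C iso]] \<phi>D(1,2) by (auto simp: chain_iso_def chain_map_def)
qed

lemma chain_iso_comp:
  assumes C: "category C" and \<phi>: "chain_iso R C P Q \<phi>" and \<psi>: "chain_iso R C Q T \<psi>"
  shows "chain_iso R C P T (\<lambda>n. hcomp (\<psi> n) (\<phi> n))"
proof -
  have iso: "kmod_iso R C (Ch P n) (Ch Q n) (\<phi> n)" "kmod_iso R C (Ch Q n) (Ch T n) (\<psi> n)" for n
    using \<phi> \<psi> by (auto simp: chain_iso_def)
  have "chain_map R C P Q \<phi>" "chain_map R C Q T \<psi>" using \<phi> \<psi> by (auto simp: chain_iso_def)
  note \<phi>D = chain_mapD[OF this(1)] and \<psi>D = chain_mapD[OF this(2)]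
  have "hcomp (\<psi> n) (\<phi> n) c (Diff P (Suc n) c x) = Diff T (Suc n) c (hcomp (\<psi> (Suc n)) (\<phi> (Suc n)) c x)"
    if c: "c \<in> Obj C" and x: "x \<in> carrier (Val (Ch P (Suc n)) c)" for n c x
    using \<phi>D(4)[OF c x] \<psi>D(4)[OF c kmod_hom_closed[OF \<phi>D(3) c x]] by (simp add: hcomp_def)
  then show ?thesis
    using kmod_iso_comp[OF C iso] kmod_isoD[OF kmod_iso_comp[OF C iso]] \<phi>D(1) \<psi>D(2) by (auto simp: chain_iso_def chain_map_def)
qed

section \<open>Minimal resolutions with Artinian support\<close>

lemma minimal_resolutionD:
  assumes C: "category C" and P: "minimal_projective_resolution R C P \<epsilon> M"
  shows "resolution R C P \<epsilon> M" "projective R C (Ch P n)" "essential R C (Ch P 0) \<epsilon>"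
    "essential R C (Ch P (Suc n)) (Diff P (Suc n))"
proof -
  have pr: "projective_resolution R C P \<epsilon> M"
    and cov: "projective_cover R C (Ch P 0) M \<epsilon>"
      "projective_cover R C (Ch P (Suc n)) (image_kmod (Ch P (Suc n)) (Ch P n) (Diff P (Suc n))) (Diff P (Suc n))"
    using P by (auto simp: minimal_projective_resolution_def)
  show "resolution R C P \<epsilon> M" by (rule projective_resolution_imp_resolution[OF pr])
  show "projective R C (Ch P n)" using pr by (simp add: projective_resolution_def)
  show "essential R C (Ch P 0) \<epsilon>" "essential R C (Ch P (Suc n)) (Diff P (Suc n))"
    using cov superfluous_imp_essential[OF C] by (auto simp: projective_cover_def)
qed

text \<open>The bound on the support passes from \<open>M\<close> to \<open>P\<^sub>0\<close> and from \<open>P\<^sub>n\<close> to \<open>P\<^sub>n\<^sub>+\<^sub>1\<close>, in each step because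
  the map to the previous module is essential.\<close>

lemma minimal_resolution_supp:
  assumes C: "category C" and P: "minimal_projective_resolution R C P \<epsilon> M"
    and d: "d \<in> Obj C" "cl C d \<notin> up C (supp C M)"
  shows "\<not> nonzero (Val (Ch P n) d)"
proof -
  let ?U = "{c \<in> Obj C. cl C c \<in> up C (supp C M)}"
  have S: "supp C M \<subseteq> cl C ` Obj C" by (auto simp: supp_def)
  note upS = up_upper_set[OF C S]
  note PD = minimal_resolutionD[OF C P]
  have up: "b \<in> ?U" if "a \<in> ?U" "u \<in> Hom C a b" for a b u
  proof -
    note ab = Hom_Obj[OF C that(2)]
    have "cl_le C (cl C a) (cl C b)" using ab that(2) by (auto simp: cl_le_def)
    then show ?thesis using upS(1) that(1) ab by (auto simp: upper_set_def)
  qed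
  have "\<forall>d \<in> Obj C. d \<notin> ?U \<longrightarrow> \<not> nonzero (Val (Ch P n) d)"
  proof (induction n)
    case 0
    have "\<not> nonzero (Val M d)" if "d \<in> Obj C" "d \<notin> ?U" for d
      using that upS(2) by (auto simp: supp_def)
    then show ?case
      using essential_supp[OF C resolutionD(3)[OF PD(1)] PD(3), of ?U] up by blast
  next
    case (Suc n)
    then show ?case
      using essential_supp[OF C chain_complexD(2)[OF resolutionD(1)[OF PD(1)]] PD(4), of ?U n] up by blast
  qed
  then show ?thesis using d by blast
qed

text \<open>The hypotheses under which restriction along \<open>F\<close> loses nothing of a minimal resolution.\<close>

locale minimal_support_functor =
  fixes R :: "'r ring" and B :: "('o, 'a) cat" and D :: "('p, 'b) cat" and F :: "('o, 'a, 'p, 'b) catfun"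
    and P :: "('p, 'b, 'r, 'x) cplx" and \<epsilon> :: "'p \<Rightarrow> 'x \<Rightarrow> 'm" and M :: "('p, 'b, 'r, 'm) cmod"
  assumes R: "cring R" and EI: "EI_category D" and F: "fully_faithful B D F"
    and P: "minimal_projective_resolution R D P \<epsilon> M" and art: "Artinian D (up D (supp D M))"
    and minsupp: "\<And>d. \<lbrakk>d \<in> Obj D; cl D d \<in> minsupp_cplx R D P\<rbrakk> \<Longrightarrow>
      \<exists>b \<in> Obj B. \<exists>u \<in> Hom D (fobj F b) d. iso_arr D u"
begin

lemma Ff: "is_functor B D F" by (rule fully_faithful_functor[OF F])
lemma D: "category D" by (rule functorD(2)[OF Ff])
lemmas PD = minimal_resolutionD[OF D P]
lemmas Pc = chain_complexD[OF resolutionD(1)[OF PD(1)]]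

lemma generated: "generated_along R B D F (Ch P n)"
proof (rule generated_along_minsupp[OF EI Pc(1) art minimal_resolution_supp[OF D P] Ff])
  fix d assume d: "d \<in> Obj D" and nz: "nonzero (splitting R D (Ch P n) d)"
  then have "cl D d \<in> minsupp_cplx R D P" by (auto simp: minsupp_cplx_def minsupp_def)
  then show "\<exists>b \<in> Obj B. \<exists>u \<in> Hom D (fobj F b) d. iso_arr D u" by (rule minsupp[OF d])
qed

lemma res_essential:
  "essential R B (Ch (res_cplx F P) 0) (res_hom F \<epsilon>)"
  "essential R B (Ch (res_cplx F P) (Suc n)) (Diff (res_cplx F P) (Suc n))"
  using essential_restrict[OF F resolutionD(3)[OF PD(1)] PD(3) generated]
    essential_restrict[OF F Pc(2) PD(4) generated] by (simp_all add: res_cplx_def)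

lemma res_resolution: "resolution R B (res_cplx F P) (res_hom F \<epsilon>) (res F M)"
  by (rule res_resolution[OF Ff PD(1)])

lemma res_lift:
  assumes "kmod_epi R B L K g" "kmod_hom R B (Ch (res_cplx F P) n) K h"
  shows "\<exists>k. kmod_hom R B (Ch (res_cplx F P) n) L k \<and>
    (\<forall>b \<in> Obj B. \<forall>x \<in> carrier (Val (Ch (res_cplx F P) n) b). g b (k b x) = h b x)"
  using res_lifting[OF R F PD(2) generated assms(1)] assms(2) by (simp add: res_cplx_def)

lemma cl_in_minsupp_cplx_iff:
  assumes b: "b \<in> Obj B"
  shows "cl D (fobj F b) \<in> minsupp_cplx R D P \<longleftrightarrow> (\<exists>n. nonzero (splitting R B (Ch (res_cplx F P) n) b))"
  using cl_in_minsupp_iff[OF EI Pc(1) functorD(3)[OF Ff b]]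
    splitting_res_zero_iff[OF EI F Pc(1) kmodule_res_functor[OF Ff Pc(1)] generated b]
  by (simp add: minsupp_cplx_def res_cplx_def)

lemma counit_chain_iso:
  "chain_iso R D (ind_cplx R B D F (res_cplx F P)) P (\<lambda>n. ind_counit B D F (Ch P n))"
  unfolding chain_iso_def
  using counit_chain_map[OF R Ff resolutionD(1)[OF PD(1)]] counit_iso[OF R F PD(2) generated]
  by (simp add: ind_cplx_simps res_cplx_def)

end

section \<open>Betti categories\<close>

text \<open>The arrow type of \<open>incl\<close> is not determined by \<open>res_hom incl g\<close>; this equation removes it.\<close>

lemma res_hom_incl: "res_hom incl g = g"
  by (simp add: res_hom_def incl_def comp_def)

lemma cl_image_iso:
  assumes C: "category C" and S: "S \<subseteq> Obj C" and T: "T \<subseteq> cl C ` S" and c: "c \<in> Obj C" "cl C c \<in> T"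
  shows "\<exists>s \<in> S. \<exists>u \<in> Hom C s c. iso_arr C u"
proof -
  obtain s where "s \<in> S" "cl C s = cl C c" using T c(2) by auto
  then show ?thesis using cl_eq_iff[OF C subsetD[OF S] c(1)] by blast
qed

text \<open>Each object of the Betti category is isomorphic to an object of \<open>C'\<close>, which then lies in
  the Betti category as well.\<close>

lemma betti_incl_equivalence:
  fixes C' :: "('o, 'a) cat"
  assumes C: "category C" and C': "Obj C' \<subseteq> Obj C" "C' = full_subcat C (Obj C')"
    and min: "minsupp_cplx R C P \<subseteq> cl C ` Obj C'"
  defines "BM \<equiv> betti_category R C P"
  shows "cat_equivalence (full_subcat C' (Obj C' \<inter> Obj BM)) BM incl"
proof -
  let ?T = "{c \<in> Obj C. cl C c \<in> minsupp_cplx R C P}" and ?S = "Obj C' \<inter> Obj BM"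
  have BM: "BM = full_subcat C ?T" "Obj BM = ?T" by (simp_all add: BM_def betti_category_def full_subcat_simps)
  have BMc: "category BM" unfolding BM(1) by (rule full_subcat_category[OF C]) auto
  have "full_subcat C' ?S = full_subcat C ?S" by (subst C'(2)) (rule full_subcat_full_subcat, auto)
  also have "\<dots> = full_subcat BM ?S"
    unfolding BM(2) unfolding BM(1) by (rule full_subcat_full_subcat[symmetric]) auto
  finally have "full_subcat C' ?S = full_subcat BM ?S" .
  moreover have "cat_equivalence (full_subcat BM ?S) BM incl"
  proof (rule incl_equivalence[OF BMc])
    fix c assume "c \<in> Obj BM"
    then have c: "c \<in> Obj C" "cl C c \<in> minsupp_cplx R C P" by (auto simp: BM(2))
    obtain s u where s: "s \<in> Obj C'" and u: "u \<in> Hom C s c" "iso_arr C u"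
      using cl_image_iso[OF C C'(1) min c] by blast
    have "cl C s = cl C c" using cl_eq_iff[OF C _ c(1)] u s C'(1) by blast
    then have sT: "s \<in> ?T" using c s C'(1) by auto
    have uB: "u \<in> Hom BM s c" unfolding BM(1) using Hom_full_subcat[OF sT, of c C] c u(1) by simp
    have "iso_arr BM u" using u(2) iso_arr_full_subcat[OF uB[unfolded BM(1)]] by (simp add: BM(1))
    then show "\<exists>s \<in> ?S. \<exists>u \<in> Hom BM s c. iso_arr BM u" using s sT uB by (auto simp: BM(2))
  qed auto
  ultimately show ?thesis by simp
qed

theorem theorem8p1:
  fixes R :: "'r ring"
    and C C' :: "('o, 'a) cat" and D D' :: "('p, 'b) cat"
    and M :: "('o, 'a, 'r, 'm) cmod" and N :: "('p, 'b, 'r, 'n) cmod"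
    and P :: "('o, 'a, 'r, 'x) cplx" and Q :: "('p, 'b, 'r, 'y) cplx"
    and \<epsilon> :: "'o \<Rightarrow> 'x \<Rightarrow> 'm" and \<delta> :: "'p \<Rightarrow> 'y \<Rightarrow> 'n"
    and \<alpha> :: "('o, 'a, 'p, 'b) catfun" and f :: "'o \<Rightarrow> 'm \<Rightarrow> 'n"
  assumes "cring R"
    and "EI_category C" and "EI_category D"
    and "minimal_projective_resolution R C P \<epsilon> M"
    and "minimal_projective_resolution R D Q \<delta> N"
    and "Artinian C (up C (supp C M))" and "Artinian D (up D (supp D N))"
    and "is_full_subcat C' C" and "minsupp_cplx R C P \<subseteq> cl C ` Obj C'"
    and "is_full_subcat D' D" and "minsupp_cplx R D Q \<subseteq> cl D ` Obj D'"
    and "cat_equivalence C' D' \<alpha>"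
    and "kmod_iso R C' (res incl M) (res (incl \<circ>\<^sub>F \<alpha>) N) f"
  shows
    "let BM = betti_category R C P;
         BN = betti_category R D Q;
         BM' = full_subcat C' (Obj C' \<inter> Obj BM);
         BN' = full_subcat D' (Obj D' \<inter> Obj BN);
         rP = res_cplx incl P;
         rQ = res_cplx (incl \<circ>\<^sub>F \<alpha>) Q;
         lift = lifts R C' rP (res_hom incl \<epsilon>) rQ (res_hom (incl \<circ>\<^sub>F \<alpha>) \<delta>) f;
         counit = (\<lambda>n. ind_counit C' C incl (Ch P n))
     in (cat_equivalence BM' BM incl \<and> cat_equivalence BN' BN incl
          \<and> cat_equivalence BM' BN' \<alpha>
          \<and> (\<exists>\<beta>. cat_equivalence BM BN \<beta>
               \<and> naturally_isomorphic BM' BN (\<beta> \<circ>\<^sub>F incl) (incl \<circ>\<^sub>F \<alpha>)))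
        \<and> (\<exists>\<phi>. lift \<phi>)
        \<and> chain_iso R C (ind_cplx R C' C incl rP) P counit
        \<and> (\<forall>\<phi>. lift \<phi> \<longrightarrow> (\<exists>\<psi>. chain_iso R C P (ind_cplx R C' C incl rQ) \<psi>
             \<and> (\<forall>n. \<forall>c \<in> Obj C. \<forall>X \<in> carrier (Val (Ch (ind_cplx R C' C incl rP) n) c).
                  \<psi> n c (counit n c X)
                    = ind_hom R C' C incl (Ch rP n) (Ch rQ n) (\<phi> n) c X)))"
proof -
  note R = assms(1) and f = assms(13)
  have C: "category C" and D: "category D" using assms(2,3) by (auto simp: EI_category_def)
  have C': "Obj C' \<subseteq> Obj C" "C' = full_subcat C (Obj C')" using assms(8) by (auto simp: is_full_subcat_def)
  have D': "Obj D' \<subseteq> Obj D" "D' = full_subcat D (Obj D')" using assms(10) by (auto simp: is_full_subcat_def)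
  note \<alpha> = equivalence_imp_fully_faithful[OF assms(12)] and \<alpha>_es = equivalence_imp_ess_surj[OF assms(12)]
  have inC: "fully_faithful C' C incl" using fully_faithful_incl[OF C C'(1)] C'(2) by simp
  have inD: "fully_faithful D' D incl" using fully_faithful_incl[OF D D'(1)] D'(2) by simp
  have inD\<alpha>: "fully_faithful C' D (incl \<circ>\<^sub>F \<alpha>)" by (rule fully_faithful_fcomp[OF \<alpha> inD])
  have isoD': "\<exists>b \<in> Obj C'. \<exists>u \<in> Hom D (fobj \<alpha> b) d. iso_arr D u" if d: "d \<in> Obj D'" for d
  proof -
    obtain b u where b: "b \<in> Obj C'" and u: "u \<in> Hom D' (fobj \<alpha> b) d" "iso_arr D' u"
      using \<alpha>_es d by (auto simp: ess_surj_def)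
    then show ?thesis using functorD(4)[OF fully_faithful_functor[OF inD] u(1)]
        functor_iso[OF fully_faithful_functor[OF inD] u] by (auto simp: incl_def)
  qed
  have minC: "\<exists>b \<in> Obj C'. \<exists>u \<in> Hom C (fobj incl b) c. iso_arr C u"
    if "c \<in> Obj C" "cl C c \<in> minsupp_cplx R C P" for c
    using cl_image_iso[OF C C'(1) assms(9) that] by (simp add: incl_def)
  interpret P: minimal_support_functor R C' C incl P \<epsilon> M
    by (rule minimal_support_functor.intro[OF R assms(2) inC assms(4,6) minC])
  have minD: "\<exists>b \<in> Obj C'. \<exists>u \<in> Hom D (fobj (incl \<circ>\<^sub>F \<alpha>) b) d. iso_arr D u"
    if d: "d \<in> Obj D" "cl D d \<in> minsupp_cplx R D Q" for d
  proof -
    obtain e v where e: "e \<in> Obj D'" and v: "v \<in> Hom D e d" "iso_arr D v"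
      using cl_image_iso[OF D D'(1) assms(11) d] by blast
    obtain b u where b: "b \<in> Obj C'" and u: "u \<in> Hom D (fobj \<alpha> b) e" "iso_arr D u" using isoD'[OF e] by blast
    show ?thesis
      using b category.Comp_Hom[OF D u(1) v(1)] iso_arr_Comp[OF D u v] by (auto simp: incl_def fcomp_def)
  qed
  interpret Q: minimal_support_functor R C' D "incl \<circ>\<^sub>F \<alpha>" Q \<delta> N
    by (rule minimal_support_functor.intro[OF R assms(3) inD\<alpha> assms(5,7) minD])
  note C'cat = functorD(1)[OF P.Ff]
  let ?rP = "res_cplx incl P" and ?rQ = "res_cplx (incl \<circ>\<^sub>F \<alpha>) Q"
  let ?lift = "lifts R C' ?rP \<epsilon> ?rQ (res_hom (incl \<circ>\<^sub>F \<alpha>) \<delta>) f"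
  let ?counit = "\<lambda>n. ind_counit C' C incl (Ch P n)"
  note P_res = P.res_resolution[unfolded res_hom_incl] and P_ess = P.res_essential[unfolded res_hom_incl]
  note rQc = chain_complexD[OF resolutionD(1)[OF Q.res_resolution]]
  have ex: "\<exists>\<phi>. ?lift \<phi>"
  proof (rule lifts_exist[OF C'cat P_res Q.res_resolution kmod_isoD[OF f]])
    show "\<exists>k. kmod_hom R C' (Ch ?rP 0) (Ch ?rQ 0) k \<and>
        (\<forall>c \<in> Obj C'. \<forall>x \<in> carrier (Val (Ch ?rP 0) c). res_hom (incl \<circ>\<^sub>F \<alpha>) \<delta> c (k c x) = h c x)"
      if "kmod_hom R C' (Ch ?rP 0) (res (incl \<circ>\<^sub>F \<alpha>) N) h" for h
      by (rule P.res_lift[OF resolutionD(2)[OF Q.res_resolution] that])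
    show "\<exists>k. kmod_hom R C' (Ch ?rP (Suc n)) (Ch ?rQ (Suc n)) k \<and>
        (\<forall>c \<in> Obj C'. \<forall>x \<in> carrier (Val (Ch ?rP (Suc n)) c). Diff ?rQ (Suc n) c (k c x) = h c x)"
      if "kmod_hom R C' (Ch ?rP (Suc n)) (image_kmod (Ch ?rQ (Suc n)) (Ch ?rQ n) (Diff ?rQ (Suc n))) h" for n h
      by (rule P.res_lift[OF image_epi[OF C'cat rQc(2)] that])
  qed
  have iso: "kmod_iso R C' (Ch ?rP n) (Ch ?rQ n) (\<phi> n)" if "?lift \<phi>" for \<phi> n
    by (rule lifts_iso[OF C'cat P_res Q.res_resolution f that P_ess Q.res_essential])
      (rule Q.res_lift[OF _ kmod_hom_id[OF rQc(1)]])
  have counit: "chain_iso R C (ind_cplx R C' C incl ?rP) P ?counit" by (rule P.counit_chain_iso)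
  have main: "\<exists>\<psi>. chain_iso R C P (ind_cplx R C' C incl ?rQ) \<psi>
      \<and> (\<forall>n. \<forall>c \<in> Obj C. \<forall>X \<in> carrier (Val (Ch (ind_cplx R C' C incl ?rP) n) c).
        \<psi> n c (?counit n c X) = ind_hom R C' C incl (Ch ?rP n) (Ch ?rQ n) (\<phi> n) c X)" if \<phi>: "?lift \<phi>" for \<phi>
  proof -
    let ?i = "\<lambda>n. ind_hom R C' C incl (Ch ?rP n) (Ch ?rQ n) (\<phi> n)"
    have "chain_map R C' ?rP ?rQ \<phi>" using \<phi> by (simp add: lifts_def)
    then have "chain_iso R C (ind_cplx R C' C incl ?rP) (ind_cplx R C' C incl ?rQ) ?i"
      using ind_chain_map[OF R P.Ff] ind_hom_iso[OF R P.Ff iso[OF \<phi>]]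
      by (simp add: chain_iso_def ind_cplx_simps)
    note chain_iso_comp[OF C chain_iso_inverse[OF C counit] this]
    moreover have "kmod_iso R C (Ch (ind_cplx R C' C incl ?rP) n) (Ch P n) (?counit n)" for n
      using counit by (simp add: chain_iso_def)
    note kinv(1)[OF this]
    ultimately show ?thesis by (intro exI conjI) (assumption, simp add: hcomp_def)
  qed
  let ?BM = "betti_category R C P" and ?BN = "betti_category R D Q"
  let ?S = "Obj C' \<inter> Obj ?BM" and ?T = "Obj D' \<inter> Obj ?BN"
  let ?BM' = "full_subcat C' ?S" and ?BN' = "full_subcat D' ?T"
  have BM: "cat_equivalence ?BM' ?BM incl" by (rule betti_incl_equivalence[OF C C' assms(9)])
  have BN: "cat_equivalence ?BN' ?BN incl" by (rule betti_incl_equivalence[OF D D' assms(11)])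
  have Obj_BM: "Obj ?BM = {c \<in> Obj C. cl C c \<in> minsupp_cplx R C P}"
    and Obj_BN: "Obj ?BN = {d \<in> Obj D. cl D d \<in> minsupp_cplx R D Q}"
    by (simp_all add: betti_category_def full_subcat_simps)
  \<comment> \<open>both sides are determined by the splittings of isomorphic modules over \<open>C'\<close>\<close>
  have minsupp_iff: "cl C c \<in> minsupp_cplx R C P \<longleftrightarrow> cl D (fobj \<alpha> c) \<in> minsupp_cplx R D Q" if c: "c \<in> Obj C'" for c
  proof -
    obtain \<phi> where \<phi>: "?lift \<phi>" using ex by blast
    have "nonzero (splitting R C' (Ch ?rP n) c) \<longleftrightarrow> nonzero (splitting R C' (Ch ?rQ n) c)" for n
      using splitting_zero_kmod_iso[OF C'cat iso[OF \<phi>] c]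
        splitting_zero_kmod_iso[OF C'cat kinv_iso[OF C'cat iso[OF \<phi>]] c] by blast
    then show ?thesis
      using P.cl_in_minsupp_cplx_iff[OF c] Q.cl_in_minsupp_cplx_iff[OF c] by (simp add: incl_def fcomp_def)
  qed
  have \<alpha>_obj: "fobj \<alpha> c \<in> Obj D'" if "c \<in> Obj C'" for c
    using functorD(3)[OF fully_faithful_functor[OF \<alpha>] that] .
  have B\<alpha>: "cat_equivalence ?BM' ?BN' \<alpha>"
  proof (rule fully_faithful_restrict_equivalence[OF \<alpha>])
    show "fobj \<alpha> c \<in> ?T" if "c \<in> ?S" for c
      using that minsupp_iff \<alpha>_obj D'(1) by (auto simp: Obj_BM Obj_BN)
    fix d assume d: "d \<in> ?T"
    then obtain c u where c: "c \<in> Obj C'" and u: "u \<in> Hom D' (fobj \<alpha> c) d" "iso_arr D' u"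
      using \<alpha>_es by (auto simp: ess_surj_def)
    have "u \<in> Hom D (fobj \<alpha> c) d" "iso_arr D u"
      using functorD(4)[OF fully_faithful_functor[OF inD] u(1)] functor_iso[OF fully_faithful_functor[OF inD] u]
      by (auto simp: incl_def)
    then have "cl D (fobj \<alpha> c) = cl D d" using cl_eq_iff[OF D] Hom_Obj[OF D] by blast
    then have "c \<in> ?S" using d c minsupp_iff[OF c] C'(1) by (auto simp: Obj_BM Obj_BN)
    then show "\<exists>c \<in> ?S. \<exists>u \<in> Hom D' (fobj \<alpha> c) d. iso_arr D' u" using u by blast
  qed auto
  \<comment> \<open>\<open>\<beta>\<close> is \<open>\<alpha>\<close> preceded by a quasi-inverse of the inclusion of \<open>?BM'\<close>\<close>
  have "\<exists>\<beta>. cat_equivalence ?BM ?BN \<beta> \<and> naturally_isomorphic ?BM' ?BN (\<beta> \<circ>\<^sub>F incl) (incl \<circ>\<^sub>F \<alpha>)"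
  proof -
    obtain G where G: "cat_equivalence ?BM ?BM' G" and G_incl: "naturally_isomorphic ?BM' ?BM' (G \<circ>\<^sub>F incl) incl"
      using cat_equivalence_sym[OF BM] by blast
    note i\<alpha> = cat_equivalence_fcomp[OF B\<alpha> BN]
    have "naturally_isomorphic ?BM' ?BN ((incl \<circ>\<^sub>F \<alpha>) \<circ>\<^sub>F (G \<circ>\<^sub>F incl)) ((incl \<circ>\<^sub>F \<alpha>) \<circ>\<^sub>F incl)"
      by (rule naturally_isomorphic_whisker[OF _ G_incl]) (use i\<alpha> in \<open>simp add: cat_equivalence_def\<close>)
    moreover have "(incl \<circ>\<^sub>F \<alpha>) \<circ>\<^sub>F (G \<circ>\<^sub>F incl) = ((incl \<circ>\<^sub>F \<alpha>) \<circ>\<^sub>F G) \<circ>\<^sub>F incl" "(incl \<circ>\<^sub>F \<alpha>) \<circ>\<^sub>F incl = incl \<circ>\<^sub>F \<alpha>"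
      by (simp_all add: fcomp_def incl_def comp_def)
    ultimately have "naturally_isomorphic ?BM' ?BN (((incl \<circ>\<^sub>F \<alpha>) \<circ>\<^sub>F G) \<circ>\<^sub>F incl) (incl \<circ>\<^sub>F \<alpha>)" by simp
    then show ?thesis using cat_equivalence_fcomp[OF G i\<alpha>] by blast
  qed
  then show ?thesis using BM BN B\<alpha> ex counit main unfolding Let_def res_hom_incl by blast
qed

end
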